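(* Let $m,n,l$ be positive integers, let $c_3$ be a real number, and let $s\in\{-1,1\}$. Let $\mathcal{X}=\{\mathbf{x}^{(1)},\dots,\mathbf{x}^{(l)}\}$ with $\mathbf{x}^{(i)}\in\mathbb{R}^n$ for $1\le i\le l$. Let $G$ be an $m\times n$ matrix of i.i.d. standard normals, $\mathbf{u}^{(2)}$ an $m\times 1$ vector of i.i.d. standard normals, $\mathbf{h}$ an $n\times 1$ vector of i.i.d. standard normals, and $u^{(4)}$ a standard normal random variable, with $G$, $\mathbf{u}^{(2)}$, $\mathbf{h}$, $u^{(4)}$ independent of each other. For real $\beta>0$ and $t\in[0,1]$ let $$\psi_*(\mathcal{X},\beta,s,c_3,t)=\mathbb{E}_{G,u^{(4)},\mathbf{u}^{(2)},\mathbf{h}}\left(\sum_{i=1}^{l}e^{\beta\left(s\left\|\sqrt{t}\,G\mathbf{x}^{(i)}+\sqrt{1-t}\,\|\mathbf{x}^{(i)}\|_2\,\mathbf{u}^{(2)}\right\|_2+\sqrt{t}\,\|\mathbf{x}^{(i)}\|_2u^{(4)}+\sqrt{1-t}\,\mathbf{h}^T\mathbf{x}^{(i)}\right)}\right)^{c_3}.$$ 1) If $0<c_3<1$, then $\frac{d\psi_*(\mathcal{X},\beta,s,c_3,t)}{dt}<0$, the function $\psi_*(\mathcal{X},\beta,s,c_3,t)$ is decreasing in $t$, and the following comparison principle holds: $$\lim_{\beta\to\infty}\psi_*(\mathcal{X},\beta,s,c_3,0)\ \ge\ \lim_{\beta\to\infty}\psi_*(\mathcal{X},\beta,s,c_3,t)\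 \ge\ \lim_{\beta\to\infty}\psi_*(\mathcal{X},\beta,s,c_3,1).$$ 2) If $c_3>1$ or $c_3<0$, then $\frac{d\psi_*(\mathcal{X},\beta,s,c_3,t)}{dt}>0$, the function $\psi_*(\mathcal{X},\beta,s,c_3,t)$ is increasing in $t$, and the following comparison principle holds: $$\lim_{\beta\to\infty}\psi_*(\mathcal{X},\beta,s,c_3,0)\ \le\ \lim_{\beta\to\infty}\psi_*(\mathcal{X},\beta,s,c_3,t)\ \le\ \lim_{\beta\to\infty}\psi_*(\mathcal{X},\beta,s,c_3,1).$$
   Context: $\|\cdot\|_2$ is the Euclidean norm, and $\mathbb{E}$ is expectation over all the Gaussian variables listed in its subscript.
   Formalization: Strict derivative sign and strict monotonicity hold only if some pair has x_i·x_j < |x_i||x_j| (else ψ is constant, e.g. l=1), and for the derivative only if t>0 (it is 0 at t=0); otherwise the inequalities are weak. Endpoint derivatives are one-sided; limits may be infinite. *)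

theory Defs
  imports "HOL-Probability.Probability"
begin

datatype ('m, 'n) gaussian_index = Entry_G 'm 'n | Entry_u2 'm | Entry_h 'n | Entry_u4

primrec gaussian_entry ::
  "('w \<Rightarrow> real^'n^'m) \<Rightarrow> ('w \<Rightarrow> real^'m) \<Rightarrow> ('w \<Rightarrow> real^'n) \<Rightarrow> ('w \<Rightarrow> real)
    \<Rightarrow> ('m, 'n) gaussian_index \<Rightarrow> 'w \<Rightarrow> real"
where
  "gaussian_entry G u2 h u4 (Entry_G i j) = (\<lambda>\<omega>. G \<omega> $ i $ j)"
| "gaussian_entry G u2 h u4 (Entry_u2 i) = (\<lambda>\<omega>. u2 \<omega> $ i)"
| "gaussian_entry G u2 h u4 (Entry_h j) = (\<lambda>\<omega>. h \<omega> $ j)"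
| "gaussian_entry G u2 h u4 Entry_u4 = u4"

text \<open>
  Joint independence of the family of all scalar entries says both that the entries within each of
  \<open>G\<close>, \<open>u2\<close>, \<open>h\<close> are i.i.d. and that the four blocks are mutually independent.
\<close>

definition independent_std_normals ::
  "'w measure \<Rightarrow> ('w \<Rightarrow> real^'n^'m) \<Rightarrow> ('w \<Rightarrow> real^'m) \<Rightarrow> ('w \<Rightarrow> real^'n)
    \<Rightarrow> ('w \<Rightarrow> real) \<Rightarrow> bool"
where
  "independent_std_normals M G u2 h u4 \<longleftrightarrow>
     prob_space M \<and>
     prob_space.indep_vars M (\<lambda>_. borel) (gaussian_entry G u2 h u4) UNIV \<and>
     (\<forall>k. distributed M lborel (gaussian_entry G u2 h u4 k) std_normal_density)"

definition psi ::
  "'w measure \<Rightarrow> ('w \<Rightarrow> real^'n^'m) \<Rightarrow> ('w \<Rightarrow> real^'m) \<Rightarrow> ('w \<Rightarrow> real^'n)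
    \<Rightarrow> ('w \<Rightarrow> real) \<Rightarrow> nat \<Rightarrow> (nat \<Rightarrow> real^'n) \<Rightarrow> real \<Rightarrow> real \<Rightarrow> real \<Rightarrow> real \<Rightarrow> real"
where
  "psi M G u2 h u4 l x \<beta> s c3 t =
     (LINT \<omega>|M.
       (\<Sum>i = 1..l. exp (\<beta> *
          (s * norm (sqrt t *\<^sub>R (G \<omega> *v x i) + (sqrt (1 - t) * norm (x i)) *\<^sub>R u2 \<omega>)
           + sqrt t * norm (x i) * u4 \<omega>
           + sqrt (1 - t) * (h \<omega> \<bullet> x i)))) powr c3)"

text \<open>
  Equality in the Cauchy--Schwarz inequality for every pair means that all \<open>x i\<close> are
  nonnegative multiples of one vector (for instance \<open>l = 1\<close>).  In that case the law of the
  process does not depend on \<open>t\<close>, so \<open>psi\<close> is constant in \<open>t\<close> and strict monotonicity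
  fails.  Independently of this, the one-sided derivative at \<open>t = 0\<close> is always zero, because the
  vectors inside the norms are then all parallel to \<open>u2\<close>.
\<close>

definition not_codirectional :: "nat \<Rightarrow> (nat \<Rightarrow> real^'n) \<Rightarrow> bool"
where
  "not_codirectional l x \<longleftrightarrow>
     (\<exists>i\<in>{1..l}. \<exists>j\<in>{1..l}. x i \<bullet> x j < norm (x i) * norm (x j))"

end

theory Submission
  imports Defs "HOL-Real_Asymp.Real_Asymp"
begin

text \<open>
  Write \<open>B i\<close> for the Gaussian vector inside the \<open>i\<close>-th norm, \<open>w i\<close> for the \<open>i\<close>-th exponential and \<open>Z\<close> for
  their sum.  As \<open>t\<close> moves from 0 to 1, the covariance of equal entries of \<open>B i\<close> and \<open>B j\<close> changes linearly by
  the covariance gap \<open>a i j = x i \<bullet> x j - norm (x i) * norm (x j)\<close>, which is at most 0 by Cauchy--Schwarz,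
  and the covariance of the scalar Gaussians in the exponents changes by \<open>- a i j\<close>.  The derivative of a
  Gaussian expectation with respect to the covariance is half the expectation of the corresponding
  second derivative (\<open>gaussian_interpolation\<close>), so formally
  \<open>d psi / dt = c3 * (c3 - 1) * \<beta>\<^sup>2 / 2 *
    (\<Sum>i j. a i j * E (Z powr (c3 - 2) * w i * w j * (cos (B i, B j) - 1)))\<close>.
  Both \<open>a i j\<close> and \<open>cos - 1\<close> are at most 0, so the sign is that of \<open>c3 * (c3 - 1)\<close>.  It is strict as soon as
  some \<open>a i j\<close> is negative and \<open>B i\<close>, \<open>B j\<close> are not almost surely codirectional, which holds for \<open>t > 0\<close>
  (\<open>integral_alignment_neg\<close>).

  The norm is not smooth, so the formula is first proved for \<open>sqrt (\<epsilon>\<^sup>2 + norm\<^sup>2)\<close> in place of the norm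
  (\<open>smoothed_psi_has_derivative\<close>).  The gap vanishes for \<open>i = j\<close>, so second derivatives of the norm do
  not occur in it, and the formula survives the limit \<open>\<epsilon> \<rightarrow> 0\<close> in integrated form
  (\<open>smoothed_psi_0_eq_integral\<close>).  Its right-hand side is continuous on the closed unit interval, which
  gives the derivative at every \<open>t\<close>, including the endpoints.

  For the comparison of limits it remains to see that \<open>psi\<close> has a limit in the extended reals as \<open>\<beta>\<close>
  tends to infinity (\<open>partition_function_powr_limit\<close>); the inequalities then pass to the limit.
\<close>

section \<open>Finite families of independent standard normals\<close>

abbreviation std_gaussian :: "real measure"
  where "std_gaussian \<equiv> density lborel (\<lambda>x. ennreal (std_normal_density x))"

text \<open>
  All Gaussian variables of the problem, indexed by an arbitrary finite type, as one product
  measure; expectations over any other probability space reduce to it.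
\<close>

definition gaussian_product :: "('k::finite \<Rightarrow> real) measure"
  where "gaussian_product = PiM UNIV (\<lambda>_. std_gaussian)"

lemma integrable_std_gaussian_exp_abs: "integrable std_gaussian (\<lambda>x. exp (C * \<bar>x\<bar>))"
proof -
  have shift: "std_normal_density x * exp (c * x) = exp (c^2/2) * normal_density c 1 x" for c x :: real
    unfolding normal_density_def
    by (simp add: exp_add[symmetric] field_simps power2_eq_square flip: exp_add)
  have int: "integrable std_gaussian (\<lambda>x. exp (c * x))" for c :: real
    by (subst integrable_density) (auto simp: shift intro!: integrable_mult_right)
  show ?thesis
  proof (rule Bochner_Integration.integrable_bound)
    show "integrable std_gaussian (\<lambda>x. exp (C * x) + exp ((-C) * x))"
      by (intro Bochner_Integration.integrable_add int)
    show "AE x in std_gaussian. norm (exp (C * \<bar>x\<bar>)) \<le> norm (exp (C * x) + exp (- C * x))"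
    proof (intro AE_I2)
      fix x :: real
      have "exp (C * \<bar>x\<bar>) \<le> exp (C * x) + exp (- C * x)"
        by (cases "x \<ge> 0") (auto intro: add_increasing add_increasing2)
      thus "norm (exp (C * \<bar>x\<bar>)) \<le> norm (exp (C * x) + exp (- C * x))"
        by (metis abs_of_pos exp_gt_zero norm_exp real_norm_def add_pos_pos abs_exp_cancel)
    qed
  qed auto
qed

lemma abs_le_exp_abs: "\<bar>x\<bar> \<le> exp \<bar>x::real\<bar>"
  using exp_ge_add_one_self[of "\<bar>x\<bar>"] by linarith

lemma integrable_std_gaussian_bound:
  fixes f :: "real \<Rightarrow> real"
  assumes [measurable]: "f \<in> borel_measurable borel" and "\<And>x. \<bar>f x\<bar> \<le> A * exp (B * \<bar>x\<bar>)"
  shows "integrable std_gaussian f"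
proof (rule Bochner_Integration.integrable_bound)
  show "integrable std_gaussian (\<lambda>x. A * exp (B * \<bar>x\<bar>))"
    by (intro integrable_mult_right integrable_std_gaussian_exp_abs)
  show "AE x in std_gaussian. norm (f x) \<le> norm (A * exp (B * \<bar>x\<bar>))"
    by (intro AE_I2) (use assms(2) in \<open>auto intro: order_trans[OF _ abs_ge_self]\<close>)
qed auto

text \<open>
  Stein's identity.  It holds because \<open>(f \<phi>)' = (f' - x f) \<phi>\<close> for the Gaussian density \<open>\<phi>\<close>, and
  \<open>f \<phi>\<close> vanishes at both ends of the line: exponential growth of \<open>f\<close> loses against \<open>\<phi>\<close>.
\<close>

lemma std_gaussian_integration_by_parts:
  fixes f f' :: "real \<Rightarrow> real"
  assumes deriv: "\<And>x. (f has_real_derivative f' x) (at x)"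
    and cont: "continuous_on UNIV f'"
    and f_bound: "\<And>x. \<bar>f x\<bar> \<le> A * exp (B * \<bar>x\<bar>)"
    and f'_bound: "\<And>x. \<bar>f' x\<bar> \<le> A * exp (B * \<bar>x\<bar>)"
  shows "(\<integral>x. x * f x \<partial>std_gaussian) = (\<integral>x. f' x \<partial>std_gaussian)"
proof -
  have contf: "continuous_on UNIV f"
    using deriv by (meson DERIV_isCont continuous_at_imp_continuous_on)
  note [measurable] = borel_measurable_continuous_onI[OF contf] borel_measurable_continuous_onI[OF cont]
  have A: "A \<ge> 0" using f_bound[of 0] by simp
  have int_xf: "integrable std_gaussian (\<lambda>x. x * f x)"
  proof (rule integrable_std_gaussian_bound)
    fix x
    have "\<bar>x * f x\<bar> \<le> exp \<bar>x\<bar> * (A * exp (B * \<bar>x\<bar>))"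
      unfolding abs_mult by (intro mult_mono f_bound abs_le_exp_abs) auto
    thus "\<bar>x * f x\<bar> \<le> A * exp ((B + 1) * \<bar>x\<bar>)" by (simp add: algebra_simps exp_add)
  qed auto
  have int_f': "integrable std_gaussian f'"
    by (rule integrable_std_gaussian_bound[OF _ f'_bound]) auto
  define P where "P x = f x * std_normal_density x" for x
  define P' where "P' x = std_normal_density x * (f' x - x * f x)" for x
  have dphi: "(std_normal_density has_real_derivative (- x * std_normal_density x)) (at x)" for x :: real
    unfolding normal_density_def
    by (auto intro!: derivative_eq_intros simp: power2_eq_square field_simps)
  have dP: "(P has_real_derivative P' x) (at x)" for x
    unfolding P_def P'_def
    by (rule derivative_eq_intros deriv dphi refl)+ (simp add: algebra_simps)
  have P_bound: "\<bar>P x\<bar> \<le> A * (exp (B * \<bar>x\<bar>) * std_normal_density x)" for x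
    unfolding P_def abs_mult using mult_right_mono[OF f_bound[of x], of "std_normal_density x"] by (simp add: mult_ac)
  have intP': "integrable lborel P'"
  proof -
    have "integrable std_gaussian (\<lambda>x. f' x - x * f x)"
      using int_xf int_f' by (rule Bochner_Integration.integrable_diff[rotated])
    thus ?thesis unfolding P'_def
      by (subst (asm) integrable_density) auto
  qed
  have decay: "((\<lambda>x. exp (B * x) * std_normal_density x) \<longlongrightarrow> 0) at_top"
  proof -
    have "((\<lambda>x. exp (B * x - x^2/2) / sqrt (2 * pi)) \<longlongrightarrow> 0) at_top"
      by real_asymp
    moreover have "exp (B * x) * std_normal_density x = exp (B * x - x^2/2) / sqrt (2 * pi)" for x
      by (simp add: normal_density_def exp_diff exp_minus field_simps flip: exp_add)
    ultimately show ?thesis by simp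
  qed
  have decay_abs: "((\<lambda>x. A * (exp (B * \<bar>x\<bar>) * std_normal_density x)) \<longlongrightarrow> 0) F"
    if "filterlim abs at_top F" for F
  proof -
    have "std_normal_density x = std_normal_density \<bar>x\<bar>" for x :: real
      by (simp add: normal_density_def)
    thus ?thesis
      using filterlim_compose[OF decay that] by (intro tendsto_mult_right_zero) simp
  qed
  have lim_top: "(P \<longlongrightarrow> 0) at_top"
  proof (rule Lim_null_comparison)
    show "eventually (\<lambda>x. norm (P x) \<le> A * (exp (B * \<bar>x\<bar>) * std_normal_density x)) at_top"
      using P_bound by simp
    show "((\<lambda>x. A * (exp (B * \<bar>x\<bar>) * std_normal_density x)) \<longlongrightarrow> 0) at_top"
      by (rule decay_abs) (rule filterlim_abs_real)
  qed
  have lim_bot: "(P \<longlongrightarrow> 0) at_bot"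
  proof (rule Lim_null_comparison)
    show "eventually (\<lambda>x. norm (P x) \<le> A * (exp (B * \<bar>x\<bar>) * std_normal_density x)) at_bot"
      using P_bound by simp
    show "((\<lambda>x. A * (exp (B * \<bar>x\<bar>) * std_normal_density x)) \<longlongrightarrow> 0) at_bot"
      by (rule decay_abs) (simp add: filterlim_at_bot_mirror filterlim_abs_real)
  qed
  have "(LBINT x=-\<infinity>..\<infinity>. P' x) = 0 - 0"
  proof (rule interval_integral_FTC_integrable[where F = P])
    show "isCont P' x" for x
      unfolding P'_def normal_density_def using cont contf
      by (intro continuous_intros) (auto simp: continuous_on_eq_continuous_at)
    show "set_integrable lborel (einterval (-\<infinity>) \<infinity>) P'"
      using intP' by (simp add: set_integrable_def einterval_def)
    show "((P \<circ> real_of_ereal) \<longlongrightarrow> 0) (at_right (-\<infinity>))"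
      using lim_bot by (simp add: ereal_tendsto_simps)
    show "((P \<circ> real_of_ereal) \<longlongrightarrow> 0) (at_left \<infinity>)"
      using lim_top by (simp add: ereal_tendsto_simps)
  qed (use dP in \<open>auto simp: has_real_derivative_iff_has_vector_derivative\<close>)
  hence "integral\<^sup>L lborel P' = 0"
    by (simp add: interval_lebesgue_integral_def set_lebesgue_integral_def einterval_def)
  also have "integral\<^sup>L lborel P' = (\<integral>x. f' x - x * f x \<partial>std_gaussian)"
    unfolding P'_def by (subst integral_density) auto
  also have "\<dots> = (\<integral>x. f' x \<partial>std_gaussian) - (\<integral>x. x * f x \<partial>std_gaussian)"
    by (rule Bochner_Integration.integral_diff[OF int_f' int_xf])
  finally show ?thesis by simp
qed

interpretation std_gaussian: prob_space std_gaussian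
  by (rule prob_space_normal_density) simp

interpretation std_gaussian_family: product_prob_space "\<lambda>_::'k::finite. std_gaussian" UNIV
  by unfold_locales

interpretation gaussian_product: prob_space "gaussian_product :: ('k::finite \<Rightarrow> real) measure"
  unfolding gaussian_product_def by (rule std_gaussian_family.P.prob_space_axioms)

lemma sets_gaussian_product [measurable_cong]:
  "sets (gaussian_product :: ('k::finite \<Rightarrow> real) measure) = sets borel"
proof -
  have "sets (PiM UNIV (\<lambda>_::'k. std_gaussian)) = sets (PiM UNIV (\<lambda>_::'k. borel))"
    by (rule sets_PiM_cong) auto
  thus ?thesis unfolding gaussian_product_def by (simp add: sets_PiM_equal_borel)
qed

lemma space_gaussian_product [simp]: "space gaussian_product = UNIV"
  by (simp add: gaussian_product_def space_PiM)

lemma integrable_gaussian_product_exp: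
  "integrable gaussian_product (\<lambda>g. exp (C * (\<Sum>k\<in>UNIV. \<bar>g k\<bar>)))"
proof -
  have "integrable gaussian_product (\<lambda>g. \<Prod>k\<in>UNIV. exp (C * \<bar>g k\<bar>))"
    unfolding gaussian_product_def
    by (intro std_gaussian_family.product_integrable_prod integrable_std_gaussian_exp_abs) auto
  thus ?thesis by (simp add: exp_sum sum_distrib_left)
qed

lemma continuous_on_coordinate [continuous_intros]: "continuous_on S (\<lambda>g. g k)"
  by (rule continuous_on_product_then_coordinatewise) (rule continuous_on_id)

lemma borel_measurable_coordinate [measurable]:
  "(\<lambda>g :: 'k::finite \<Rightarrow> real. g k) \<in> borel_measurable borel"
  by (intro borel_measurable_continuous_onI continuous_on_coordinate)

lemma integrable_gaussian_product_bound:
  fixes f :: "('k::finite \<Rightarrow> real) \<Rightarrow> real"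
  assumes f: "f \<in> borel_measurable borel"
    and bound: "\<And>g. \<bar>f g\<bar> \<le> A * exp (B * (\<Sum>k\<in>UNIV. \<bar>g k\<bar>))"
  shows "integrable gaussian_product f"
proof (rule Bochner_Integration.integrable_bound)
  show "integrable gaussian_product (\<lambda>g::'k\<Rightarrow>real. A * exp (B * (\<Sum>k\<in>UNIV. \<bar>g k\<bar>)))"
    by (intro integrable_mult_right integrable_gaussian_product_exp)
  show "AE g in gaussian_product. norm (f g) \<le> norm (A * exp (B * (\<Sum>k\<in>UNIV. \<bar>g k\<bar>)))"
    by (intro AE_I2) (use bound in \<open>auto intro: order_trans[OF _ abs_ge_self]\<close>)
qed (use f in measurable)

lemma continuous_on_fun_upd: "continuous_on UNIV (\<lambda>x::real. g(k := x))"
proof (rule continuous_on_coordinatewise_then_product)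
  fix i show "continuous_on UNIV (\<lambda>x. (g(k := x)) i)"
    by (cases "i = k") auto
qed

text \<open>
  Singling out one coordinate, so that Fubini's theorem for product measures applies to it.
\<close>

lemma gaussian_product_split:
  "(gaussian_product :: ('k::finite \<Rightarrow> real) measure) = PiM (insert k (UNIV - {k})) (\<lambda>_. std_gaussian)"
  by (simp add: gaussian_product_def insert_absorb)

text \<open>
  Stein's identity in the coordinate \<open>k\<close>, with all other coordinates frozen by Fubini's theorem.
\<close>

lemma gaussian_product_integration_by_parts:
  fixes f f' :: "('k::finite \<Rightarrow> real) \<Rightarrow> real"
  assumes deriv: "\<And>g x. ((\<lambda>x. f (g(k := x))) has_real_derivative f' (g(k := x))) (at x)"
    and cont_f: "continuous_on UNIV f" and cont_f': "continuous_on UNIV f'"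
    and f_bound: "\<And>g. \<bar>f g\<bar> \<le> A * exp (B * (\<Sum>k\<in>UNIV. \<bar>g k\<bar>))"
    and f'_bound: "\<And>g. \<bar>f' g\<bar> \<le> A * exp (B * (\<Sum>k\<in>UNIV. \<bar>g k\<bar>))"
  shows "(\<integral>g. g k * f g \<partial>gaussian_product) = (\<integral>g. f' g \<partial>gaussian_product)"
proof -
  note [measurable] = borel_measurable_continuous_onI[OF cont_f] borel_measurable_continuous_onI[OF cont_f']
  have A: "A \<ge> 0" using f_bound[of "\<lambda>_. 0"] by simp
  have int_f': "integrable gaussian_product f'"
    by (rule integrable_gaussian_product_bound[OF _ f'_bound]) auto
  have int_kf: "integrable gaussian_product (\<lambda>g. g k * f g)"
  proof (rule integrable_gaussian_product_bound)
    fix g :: "'k \<Rightarrow> real"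
    have "\<bar>g k\<bar> \<le> (\<Sum>k\<in>UNIV. \<bar>g k\<bar>)" by (rule member_le_sum) auto
    hence "\<bar>g k\<bar> \<le> exp (\<Sum>k\<in>UNIV. \<bar>g k\<bar>)"
      using exp_ge_add_one_self[of "\<Sum>k\<in>UNIV. \<bar>g k\<bar>"] by linarith
    hence "\<bar>g k * f g\<bar> \<le> exp (\<Sum>k\<in>UNIV. \<bar>g k\<bar>) * (A * exp (B * (\<Sum>k\<in>UNIV. \<bar>g k\<bar>)))"
      unfolding abs_mult by (intro mult_mono f_bound) auto
    thus "\<bar>g k * f g\<bar> \<le> A * exp ((B + 1) * (\<Sum>k\<in>UNIV. \<bar>g k\<bar>))" by (simp add: algebra_simps exp_add)
  qed auto
  note upd = continuous_on_fun_upd[of g k for g]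
  have inner: "(\<integral>x. x * f (g(k := x)) \<partial>std_gaussian) = (\<integral>x. f' (g(k := x)) \<partial>std_gaussian)" for g
  proof (rule std_gaussian_integration_by_parts)
    let ?R = "\<Sum>j\<in>UNIV - {k}. \<bar>g j\<bar>"
    have sum: "(\<Sum>j\<in>UNIV. \<bar>(g(k := x)) j\<bar>) = \<bar>x\<bar> + ?R" for x
      by (subst sum.remove[of UNIV k]) (auto intro!: sum.cong)
    show "((\<lambda>x. f (g(k := x))) has_real_derivative f' (g(k := x))) (at x)" for x by (rule deriv)
    show "continuous_on UNIV (\<lambda>x. f' (g(k := x)))"
      by (rule continuous_on_compose2[OF cont_f' upd]) auto
    show "\<bar>f (g(k := x))\<bar> \<le> (A * exp (B * ?R)) * exp (B * \<bar>x\<bar>)" for x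
      using f_bound[of "g(k := x)"] by (simp only: sum) (simp add: algebra_simps exp_add)
    show "\<bar>f' (g(k := x))\<bar> \<le> (A * exp (B * ?R)) * exp (B * \<bar>x\<bar>)" for x
      using f'_bound[of "g(k := x)"] by (simp only: sum) (simp add: algebra_simps exp_add)
  qed
  have fubini: "(\<integral>g. h g \<partial>gaussian_product)
      = (\<integral>g. \<integral>x. h (g(k := x)) \<partial>std_gaussian \<partial>PiM (UNIV - {k}) (\<lambda>_. std_gaussian))"
    if "integrable gaussian_product h" for h :: "('k \<Rightarrow> real) \<Rightarrow> real"
    using that unfolding gaussian_product_split[of k]
    by (intro std_gaussian_family.product_integral_insert) auto
  show ?thesis
    by (simp only: fubini[OF int_f'] fubini[OF int_kf] fun_upd_same inner)
qed

text \<open>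
  With the other coordinates fixed, the linear form vanishes at a single value of the coordinate
  \<open>k\<close>, and single points have no Gaussian mass.
\<close>

lemma AE_gaussian_product_linear_nonzero:
  fixes c :: "'k::finite \<Rightarrow> real"
  assumes "c k \<noteq> 0"
  shows "AE g in gaussian_product. (\<Sum>j\<in>UNIV. c j * g j) \<noteq> 0"
proof -
  let ?Z = "{g. (\<Sum>j\<in>UNIV. c j * g j) = 0}"
  have [measurable]: "?Z \<in> sets borel"
    by (intro borel_closed closed_Collect_eq continuous_intros)
  have line: "emeasure std_gaussian {x. (\<Sum>j\<in>UNIV. c j * (g(k := x)) j) = 0} = 0" for g
  proof -
    have "(\<Sum>j\<in>UNIV. c j * (g(k := x)) j) = c k * x + (\<Sum>j\<in>UNIV - {k}. c j * g j)" for x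
      by (subst sum.remove[of UNIV k]) (auto intro!: sum.cong)
    hence "{x. (\<Sum>j\<in>UNIV. c j * (g(k := x)) j) = 0} \<subseteq> {- (\<Sum>j\<in>UNIV - {k}. c j * g j) / c k}"
      using assms by (auto simp: field_simps)
    moreover have "emeasure std_gaussian {y} = 0" for y :: real
      by (subst emeasure_density) (auto intro!: nn_integral_0_iff_AE[THEN iffD2] AE_mp[OF AE_lborel_singleton[of y]])
    moreover have "emeasure std_gaussian {x. (\<Sum>j\<in>UNIV. c j * (g(k := x)) j) = 0}
        \<le> emeasure std_gaussian {- (\<Sum>j\<in>UNIV - {k}. c j * g j) / c k}"
      by (rule emeasure_mono) (use calculation(1) in simp_all)
    ultimately have "emeasure std_gaussian {x. (\<Sum>j\<in>UNIV. c j * (g(k := x)) j) = 0} \<le> 0"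
      by (simp only:)
    thus ?thesis by simp
  qed
  have "emeasure gaussian_product ?Z = (\<integral>\<^sup>+g. indicator ?Z g \<partial>gaussian_product)"
    by (simp add: sets_gaussian_product)
  also have "\<dots> = (\<integral>\<^sup>+g. (\<integral>\<^sup>+x. indicator ?Z (g(k := x)) \<partial>std_gaussian) \<partial>PiM (UNIV - {k}) (\<lambda>_. std_gaussian))"
  proof -
    have "indicator ?Z \<in> borel_measurable (gaussian_product :: ('k \<Rightarrow> real) measure)"
      by measurable
    thus ?thesis
      unfolding gaussian_product_split[of k]
      by (intro std_gaussian_family.product_nn_integral_insert) auto
  qed
  also have "\<dots> = 0"
  proof -
    have "(\<integral>\<^sup>+x. indicator ?Z (g(k := x)) \<partial>std_gaussian) = 0" for g
    proof -
      have "(\<integral>\<^sup>+x. indicator ?Z (g(k := x)) \<partial>std_gaussian)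
          = (\<integral>\<^sup>+x. indicator {x. (\<Sum>j\<in>UNIV. c j * (g(k := x)) j) = 0} x \<partial>std_gaussian)"
        by (intro nn_integral_cong) (auto simp: indicator_def)
      also have "\<dots> = emeasure std_gaussian {x. (\<Sum>j\<in>UNIV. c j * (g(k := x)) j) = 0}"
      proof (rule nn_integral_indicator)
        have "closed {x. (\<Sum>j\<in>UNIV. c j * (g(k := x)) j) = 0}"
          by (intro closed_Collect_eq continuous_intros
              continuous_on_product_then_coordinatewise[OF continuous_on_fun_upd])
        thus "{x. (\<Sum>j\<in>UNIV. c j * (g(k := x)) j) = 0} \<in> sets std_gaussian" by simp
      qed
      finally show ?thesis using line by simp
    qed
    thus ?thesis by simp
  qed
  finally have "emeasure gaussian_product ?Z = 0" .
  thus ?thesis by (intro AE_I[of _ _ ?Z]) (auto simp: sets_gaussian_product)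
qed

text \<open>
  The Gaussian measure has full support: \<open>U\<close> contains an open box, and every side of the box has
  positive Gaussian measure because the density is positive.
\<close>

lemma gaussian_product_open_positive:
  fixes U :: "('k::finite \<Rightarrow> real) set"
  assumes "open U" "w \<in> U"
  shows "emeasure gaussian_product U > 0"
proof -
  obtain X where X: "w \<in> PiE UNIV X" "\<And>k. open (X k)" "PiE UNIV X \<subseteq> U"
    using product_topology_open_contains_basis[OF assms(1)[unfolded open_fun_def] assms(2)]
    by auto
  have pos: "emeasure std_gaussian (X k) > 0" for k
  proof (rule ccontr)
    assume "\<not> ?thesis"
    hence 0: "emeasure std_gaussian (X k) = 0" by simp
    have "(\<integral>\<^sup>+x. ennreal (std_normal_density x) * indicator (X k) x \<partial>lborel) = 0"
      using 0 X(2)[of k] by (subst (asm) emeasure_density) simp_all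
    hence "AE x in lborel. ennreal (std_normal_density x) * indicator (X k) x = 0"
      using X(2)[of k] by (subst (asm) nn_integral_0_iff_AE) simp_all
    hence "AE x in lborel. x \<notin> X k"
    proof eventually_elim
      case (elim x)
      have "std_normal_density x > 0" by (simp add: normal_density_pos)
      with elim show ?case by (auto simp: indicator_def split: if_splits)
    qed
    hence null: "emeasure lborel (X k) = 0"
      using X(2)[of k] by (subst (asm) AE_iff_measurable[where N = "X k"]) auto
    have "w k \<in> X k" using X(1) by auto
    then obtain e where e: "e > 0" "ball (w k) e \<subseteq> X k"
      using X(2)[of k] open_contains_ball by blast
    have "emeasure lborel {w k - e<..<w k + e} \<le> emeasure lborel (X k)"
      using e X(2)[of k] by (intro emeasure_mono) (auto simp: ball_eq_greaterThanLessThan)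
    thus False using null e by simp
  qed
  have "0 < (\<Prod>k\<in>I. emeasure std_gaussian (X k))" if "finite I" for I
    using that by induction (simp_all add: pos ennreal_zero_less_mult_iff)
  hence "0 < (\<Prod>k\<in>UNIV. emeasure std_gaussian (X k))" by simp
  also have "\<dots> = emeasure gaussian_product (PiE UNIV X)"
    unfolding gaussian_product_def using X(2)
    by (subst std_gaussian_family.emeasure_PiM) auto
  also have "\<dots> \<le> emeasure gaussian_product U"
    using X(3) assms by (intro emeasure_mono) (auto simp: sets_gaussian_product)
  finally show ?thesis .
qed

section \<open>Gaussian interpolation\<close>

text \<open>
  Differentiation under the integral sign.  The mean value theorem bounds the difference
  quotients by the envelope \<open>h\<close> of the derivatives, so dominated convergence applies.
\<close>

lemma has_real_derivative_integral:
  fixes f f' :: "real \<Rightarrow> 'w \<Rightarrow> real"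
  assumes t: "t \<in> {a<..<b}"
    and int: "\<And>t. t \<in> {a<..<b} \<Longrightarrow> integrable M (f t)"
    and meas: "f' t \<in> borel_measurable M"
    and deriv: "\<And>t \<omega>. t \<in> {a<..<b} \<Longrightarrow> ((\<lambda>t. f t \<omega>) has_real_derivative f' t \<omega>) (at t)"
    and bound: "\<And>t \<omega>. t \<in> {a<..<b} \<Longrightarrow> \<bar>f' t \<omega>\<bar> \<le> h \<omega>" and h: "integrable M h"
  shows "((\<lambda>t. \<integral>\<omega>. f t \<omega> \<partial>M) has_real_derivative (\<integral>\<omega>. f' t \<omega> \<partial>M)) (at t)"
proof -
  have "((\<lambda>u. ((\<integral>\<omega>. f u \<omega> \<partial>M) - (\<integral>\<omega>. f t \<omega> \<partial>M)) / (u - t)) \<longlongrightarrow> (\<integral>\<omega>. f' t \<omega> \<partial>M)) (at t within {a<..<b})"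
    unfolding tendsto_at_iff_sequentially
  proof (intro allI impI)
    fix X :: "nat \<Rightarrow> real" assume X: "\<forall>i. X i \<in> {a<..<b} - {t}" "X \<longlonglongrightarrow> t"
    note [measurable] = borel_measurable_integrable[OF int[OF t]] meas
    have [measurable]: "f (X i) \<in> borel_measurable M" for i
      using X by (intro borel_measurable_integrable int) auto
    have "(\<lambda>i. \<integral>\<omega>. (f (X i) \<omega> - f t \<omega>) / (X i - t) \<partial>M) \<longlonglongrightarrow> (\<integral>\<omega>. f' t \<omega> \<partial>M)"
    proof (rule integral_dominated_convergence[OF _ _ h])
      show "AE \<omega> in M. (\<lambda>i. (f (X i) \<omega> - f t \<omega>) / (X i - t)) \<longlonglongrightarrow> f' t \<omega>"
      proof (rule AE_I2)
        fix \<omega>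
        have "((\<lambda>u. (f u \<omega> - f t \<omega>) / (u - t)) \<longlongrightarrow> f' t \<omega>) (at t)"
          using deriv[OF t, of \<omega>] by (simp add: has_field_derivative_iff)
        moreover have "filterlim X (at t) sequentially"
          using X by (auto simp: filterlim_at)
        ultimately show "(\<lambda>i. (f (X i) \<omega> - f t \<omega>) / (X i - t)) \<longlonglongrightarrow> f' t \<omega>"
          by (rule filterlim_compose)
      qed
      show "AE \<omega> in M. norm ((f (X i) \<omega> - f t \<omega>) / (X i - t)) \<le> h \<omega>" for i
      proof (rule AE_I2)
        fix \<omega>
        have "norm (f (X i) \<omega> - f t \<omega>) \<le> h \<omega> * norm (X i - t)"
        proof (rule field_differentiable_bound[of "{a<..<b}"])
          show "((\<lambda>t. f t \<omega>) has_field_derivative f' u \<omega>) (at u within {a<..<b})"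
            if "u \<in> {a<..<b}" for u
            using deriv[OF that, of \<omega>] by (rule has_field_derivative_at_within)
          show "norm (f' u \<omega>) \<le> h \<omega>" if "u \<in> {a<..<b}" for u
            using bound[OF that] by simp
        qed (use X t in auto)
        thus "norm ((f (X i) \<omega> - f t \<omega>) / (X i - t)) \<le> h \<omega>"
          using X(1)[rule_format, of i] by (simp add: divide_simps abs_mult mult.commute)
      qed
    qed measurable
    also have "(\<lambda>i. \<integral>\<omega>. (f (X i) \<omega> - f t \<omega>) / (X i - t) \<partial>M)
        = (\<lambda>i. ((\<integral>\<omega>. f (X i) \<omega> \<partial>M) - (\<integral>\<omega>. f t \<omega> \<partial>M)) / (X i - t))"
    proof
      fix i
      have "integrable M (f (X i))" using X by (intro int) auto
      thus "(\<integral>\<omega>. (f (X i) \<omega> - f t \<omega>) / (X i - t) \<partial>M)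
          = ((\<integral>\<omega>. f (X i) \<omega> \<partial>M) - (\<integral>\<omega>. f t \<omega> \<partial>M)) / (X i - t)"
        using int[OF t] by simp
    qed
    finally show "((\<lambda>u. ((\<integral>\<omega>. f u \<omega> \<partial>M) - (\<integral>\<omega>. f t \<omega> \<partial>M)) / (u - t)) \<circ> X) \<longlonglongrightarrow> (\<integral>\<omega>. f' t \<omega> \<partial>M)"
      by (simp add: comp_def)
  qed
  moreover have "at t within {a<..<b} = at t"
    using t by (intro at_within_open) auto
  ultimately show ?thesis
    by (simp only: has_field_derivative_iff)
qed

text \<open>
  A family of Gaussian variables that moves from the linear forms with coefficients \<open>r\<close> (at \<open>t = 0\<close>)
  to those with coefficients \<open>p\<close> (at \<open>t = 1\<close>).
\<close>

definition interpolant ::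
  "('q \<Rightarrow> 'k::finite \<Rightarrow> real) \<Rightarrow> ('q \<Rightarrow> 'k \<Rightarrow> real) \<Rightarrow> real \<Rightarrow> ('k \<Rightarrow> real) \<Rightarrow> 'q \<Rightarrow> real"
  where "interpolant p r t g q =
    sqrt t * (\<Sum>k\<in>UNIV. p q k * g k) + sqrt (1 - t) * (\<Sum>k\<in>UNIV. r q k * g k)"

text \<open>
  Differentiability is expressed as the chain rule along curves.  This form refers to finitely many
  coordinates of a function space, so the number of coordinates may be a variable.
\<close>

definition has_partial_derivatives ::
  "'q set \<Rightarrow> (('q \<Rightarrow> real) \<Rightarrow> real) \<Rightarrow> ('q \<Rightarrow> ('q \<Rightarrow> real) \<Rightarrow> real) \<Rightarrow> bool"
  where "has_partial_derivatives Q F DF \<longleftrightarrow>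
    (\<forall>(y :: real \<Rightarrow> 'q \<Rightarrow> real) y' \<tau>.
      (\<forall>q\<in>Q. ((\<lambda>\<tau>. y \<tau> q) has_real_derivative y' q) (at \<tau>)) \<longrightarrow>
      ((\<lambda>\<tau>. F (y \<tau>)) has_real_derivative (\<Sum>q\<in>Q. DF q (y \<tau>) * y' q)) (at \<tau>))"

lemma has_partial_derivativesD:
  assumes "has_partial_derivatives Q F DF"
    and "\<And>q. q \<in> Q \<Longrightarrow> ((\<lambda>\<tau>. y \<tau> q) has_real_derivative y' q) (at \<tau>)"
  shows "((\<lambda>\<tau>. F (y \<tau>)) has_real_derivative (\<Sum>q\<in>Q. DF q (y \<tau>) * y' q)) (at \<tau>)"
  using assms unfolding has_partial_derivatives_def by blast

text \<open>
  The growth class in which all Gaussian integrals below converge.  The constants are explicit since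
  several functions have to share them.
\<close>

definition exp_bounded :: "'q set \<Rightarrow> real \<Rightarrow> real \<Rightarrow> (('q \<Rightarrow> real) \<Rightarrow> real) \<Rightarrow> bool"
  where "exp_bounded Q A B F \<longleftrightarrow> (\<forall>y. \<bar>F y\<bar> \<le> A * exp (B * (\<Sum>q\<in>Q. \<bar>y q\<bar>)))"

definition coefficient_sum ::
  "('q \<Rightarrow> 'k::finite \<Rightarrow> real) \<Rightarrow> ('q \<Rightarrow> 'k \<Rightarrow> real) \<Rightarrow> 'q set \<Rightarrow> real"
  where "coefficient_sum p r Q = (\<Sum>q\<in>Q. \<Sum>k\<in>UNIV. \<bar>p q k\<bar> + \<bar>r q k\<bar>)"

lemma coefficient_sum_nonneg: "coefficient_sum p r Q \<ge> 0"
  unfolding coefficient_sum_def by (intro sum_nonneg) auto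

lemma sum_linear_forms_le:
  assumes "finite Q"
  shows "(\<Sum>q\<in>Q. \<bar>\<Sum>k\<in>UNIV. p q k * g k\<bar> + \<bar>\<Sum>k\<in>UNIV. r q k * g k\<bar>)
    \<le> coefficient_sum p r Q * (\<Sum>k\<in>UNIV. \<bar>g k\<bar>)"
proof -
  have le: "\<bar>\<Sum>k\<in>UNIV. c k * g k\<bar> \<le> (\<Sum>k\<in>UNIV. \<bar>c k\<bar> * (\<Sum>k\<in>UNIV. \<bar>g k\<bar>))" for c
  proof -
    have "\<bar>\<Sum>k\<in>UNIV. c k * g k\<bar> \<le> (\<Sum>k\<in>UNIV. \<bar>c k\<bar> * \<bar>g k\<bar>)"
      by (rule order_trans[OF sum_abs]) (simp add: abs_mult)
    also have "\<dots> \<le> (\<Sum>k\<in>UNIV. \<bar>c k\<bar> * (\<Sum>k\<in>UNIV. \<bar>g k\<bar>))"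
      by (intro sum_mono mult_left_mono member_le_sum) auto
    finally show ?thesis .
  qed
  have "(\<Sum>q\<in>Q. \<bar>\<Sum>k\<in>UNIV. p q k * g k\<bar> + \<bar>\<Sum>k\<in>UNIV. r q k * g k\<bar>)
      \<le> (\<Sum>q\<in>Q. (\<Sum>k\<in>UNIV. \<bar>p q k\<bar> * (\<Sum>k\<in>UNIV. \<bar>g k\<bar>)) + (\<Sum>k\<in>UNIV. \<bar>r q k\<bar> * (\<Sum>k\<in>UNIV. \<bar>g k\<bar>)))"
    by (intro sum_mono add_mono le)
  also have "\<dots> = coefficient_sum p r Q * (\<Sum>k\<in>UNIV. \<bar>g k\<bar>)"
    unfolding coefficient_sum_def
    by (simp only: sum_distrib_right[symmetric] sum.distrib distrib_right)
  finally show ?thesis .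
qed

lemma sum_interpolant_le:
  assumes "finite Q" "t \<in> {0..1}"
  shows "(\<Sum>q\<in>Q. \<bar>interpolant p r t g q\<bar>) \<le> coefficient_sum p r Q * (\<Sum>k\<in>UNIV. \<bar>g k\<bar>)"
proof -
  have "\<bar>interpolant p r t g q\<bar> \<le> \<bar>\<Sum>k\<in>UNIV. p q k * g k\<bar> + \<bar>\<Sum>k\<in>UNIV. r q k * g k\<bar>" for q
  proof -
    have "sqrt t * \<bar>u\<bar> \<le> \<bar>u\<bar>" "sqrt (1 - t) * \<bar>u\<bar> \<le> \<bar>u\<bar>" for u
      using assms(2) by (auto intro!: mult_left_le_one_le)
    thus ?thesis unfolding interpolant_def using assms(2)
      by (intro order_trans[OF abs_triangle_ineq] add_mono) (auto simp: abs_mult)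
  qed
  hence "(\<Sum>q\<in>Q. \<bar>interpolant p r t g q\<bar>)
      \<le> (\<Sum>q\<in>Q. \<bar>\<Sum>k\<in>UNIV. p q k * g k\<bar> + \<bar>\<Sum>k\<in>UNIV. r q k * g k\<bar>)"
    by (intro sum_mono)
  also note sum_linear_forms_le[OF assms(1)]
  finally show ?thesis .
qed

lemma exp_bounded_interpolant:
  assumes "finite Q" "t \<in> {0..1}" "exp_bounded Q A B F" "A \<ge> 0" "B \<ge> 0"
  shows "\<bar>F (interpolant p r t g)\<bar> \<le> A * exp (B * coefficient_sum p r Q * (\<Sum>k\<in>UNIV. \<bar>g k\<bar>))"
proof -
  have "\<bar>F (interpolant p r t g)\<bar> \<le> A * exp (B * (\<Sum>q\<in>Q. \<bar>interpolant p r t g q\<bar>))"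
    using assms(3) unfolding exp_bounded_def by blast
  also have "\<dots> \<le> A * exp (B * (coefficient_sum p r Q * (\<Sum>k\<in>UNIV. \<bar>g k\<bar>)))"
    using assms by (intro mult_left_mono[of "exp _"]) (simp_all add: mult_left_mono sum_interpolant_le)
  finally show ?thesis by (simp add: mult.assoc)
qed

lemma continuous_on_interpolant: "continuous_on UNIV (\<lambda>g. interpolant p r t g)"
  unfolding interpolant_def
  by (intro continuous_on_coordinatewise_then_product continuous_intros)

lemma integrable_interpolant:
  assumes "finite Q" "t \<in> {0..1}" "exp_bounded Q A B F" "A \<ge> 0" "B \<ge> 0"
    and "continuous_on UNIV F"
  shows "integrable gaussian_product (\<lambda>g. F (interpolant p r t g))"
proof (rule integrable_gaussian_product_bound)
  have "continuous_on UNIV (\<lambda>g. F (interpolant p r t g))"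
    by (rule continuous_on_compose2[OF assms(6) continuous_on_interpolant subset_UNIV])
  thus "(\<lambda>g. F (interpolant p r t g)) \<in> borel_measurable borel"
    by (rule borel_measurable_continuous_onI)
  show "\<bar>F (interpolant p r t g)\<bar> \<le> A * exp (B * coefficient_sum p r Q * (\<Sum>k\<in>UNIV. \<bar>g k\<bar>))" for g
    by (rule exp_bounded_interpolant[OF assms(1-5)])
qed

text \<open>
  The multivariate form of Stein's identity: moving the linear map of the interpolant through the
  derivative produces one term for each coordinate on which \<open>f\<close> depends.
\<close>

lemma gaussian_product_expectation_times_coordinate:
  fixes p r :: "'q \<Rightarrow> 'k::finite \<Rightarrow> real"
  assumes Q: "finite Q" and t: "t \<in> {0..1}"
    and D: "has_partial_derivatives Q f Df"
    and cont: "continuous_on UNIV f" "\<And>q. q \<in> Q \<Longrightarrow> continuous_on UNIV (Df q)"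
    and bd: "A \<ge> 0" "B \<ge> 0" "exp_bounded Q A B f" "\<And>q. q \<in> Q \<Longrightarrow> exp_bounded Q A B (Df q)"
  shows "(\<integral>g. g k * f (interpolant p r t g) \<partial>gaussian_product)
    = (\<Sum>q\<in>Q. (sqrt t * p q k + sqrt (1 - t) * r q k) * (\<integral>g. Df q (interpolant p r t g) \<partial>gaussian_product))"
proof -
  define w where "w q = sqrt t * p q k + sqrt (1 - t) * r q k" for q
  define C where "C = B * coefficient_sum p r Q"
  define A' where "A' = A + (\<Sum>q\<in>Q. \<bar>w q\<bar> * A)"
  have A': "A \<le> A'" "(\<Sum>q\<in>Q. \<bar>w q\<bar> * A) \<le> A'"
    using bd by (auto simp: A'_def intro!: sum_nonneg)
  have "(\<integral>g. g k * f (interpolant p r t g) \<partial>gaussian_product)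
      = (\<integral>g. (\<Sum>q\<in>Q. Df q (interpolant p r t g) * w q) \<partial>gaussian_product)"
  proof (rule gaussian_product_integration_by_parts)
    fix g :: "'k \<Rightarrow> real" and x
    have "((\<lambda>x. interpolant p r t (g(k := x)) q) has_real_derivative w q) (at x)" for q
    proof -
      have "(\<Sum>j\<in>UNIV. c j * (g(k := x)) j) = c k * x + (\<Sum>j\<in>UNIV - {k}. c j * g j)" for x c
        by (subst sum.remove[of UNIV k]) (auto intro!: sum.cong)
      thus ?thesis unfolding interpolant_def w_def
        by (auto intro!: derivative_eq_intros)
    qed
    thus "((\<lambda>x. f (interpolant p r t (g(k := x)))) has_real_derivative
        (\<Sum>q\<in>Q. Df q (interpolant p r t (g(k := x))) * w q)) (at x)"
      by (rule has_partial_derivativesD[OF D])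
    have "\<bar>f (interpolant p r t g)\<bar> \<le> A * exp (C * (\<Sum>k\<in>UNIV. \<bar>g k\<bar>))"
      unfolding C_def using Q t bd by (intro exp_bounded_interpolant) auto
    also have "\<dots> \<le> A' * exp (C * (\<Sum>k\<in>UNIV. \<bar>g k\<bar>))"
      by (intro mult_right_mono A') auto
    finally show "\<bar>f (interpolant p r t g)\<bar> \<le> A' * exp (C * (\<Sum>k\<in>UNIV. \<bar>g k\<bar>))" .
    have "\<bar>\<Sum>q\<in>Q. Df q (interpolant p r t g) * w q\<bar> \<le> (\<Sum>q\<in>Q. \<bar>w q\<bar> * (A * exp (C * (\<Sum>k\<in>UNIV. \<bar>g k\<bar>))))"
      unfolding C_def
      by (intro order_trans[OF sum_abs] sum_mono)
        (auto simp: abs_mult mult.commute[of "\<bar>Df _ _\<bar>"]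
          intro!: mult_left_mono exp_bounded_interpolant[OF Q t bd(4) bd(1,2)])
    also have "\<dots> = (\<Sum>q\<in>Q. \<bar>w q\<bar> * A) * exp (C * (\<Sum>k\<in>UNIV. \<bar>g k\<bar>))"
      by (simp add: sum_distrib_right mult.assoc)
    also have "\<dots> \<le> A' * exp (C * (\<Sum>k\<in>UNIV. \<bar>g k\<bar>))"
      by (intro mult_right_mono A') auto
    finally show "\<bar>\<Sum>q\<in>Q. Df q (interpolant p r t g) * w q\<bar> \<le> A' * exp (C * (\<Sum>k\<in>UNIV. \<bar>g k\<bar>))" .
  qed (intro continuous_intros continuous_on_compose2[OF cont(1) continuous_on_interpolant]
      continuous_on_compose2[OF cont(2) continuous_on_interpolant] subset_UNIV; assumption)+
  also have "\<dots> = (\<Sum>q\<in>Q. (\<integral>g. Df q (interpolant p r t g) * w q \<partial>gaussian_product))"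
    by (intro Bochner_Integration.integral_sum integrable_mult_left
        integrable_interpolant[OF Q t bd(4) bd(1,2) cont(2)])
  finally show ?thesis by (simp add: w_def mult.commute)
qed

text \<open>
  Gaussian interpolation.  Differentiating under the expectation gives the factors
  \<open>P / (2 sqrt t) - R / (2 sqrt (1 - t))\<close>, with \<open>P\<close> and \<open>R\<close> the two linear forms.  Stein's identity
  replaces each Gaussian factor by a further derivative of \<open>F\<close>, and the chain rule returns the factors
  \<open>sqrt t\<close> and \<open>sqrt (1 - t)\<close>, which cancel the singular denominators.  Because \<open>p\<close> and \<open>r\<close> use
  disjoint sets of variables, what is left is the difference of the two covariance matrices.
\<close>

theorem gaussian_interpolation:
  fixes p r :: "'q \<Rightarrow> 'k::finite \<Rightarrow> real"
  assumes Q: "finite Q" and t: "0 < t" "t < 1"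
    and disjoint: "\<And>q q' k. q \<in> Q \<Longrightarrow> q' \<in> Q \<Longrightarrow> p q k * r q' k = 0"
    and D: "has_partial_derivatives Q F DF"
      "\<And>q. q \<in> Q \<Longrightarrow> has_partial_derivatives Q (DF q) (DDF q)"
    and cont: "continuous_on UNIV F" "\<And>q. q \<in> Q \<Longrightarrow> continuous_on UNIV (DF q)"
      "\<And>q q'. q \<in> Q \<Longrightarrow> q' \<in> Q \<Longrightarrow> continuous_on UNIV (DDF q q')"
    and bd: "A \<ge> 0" "B \<ge> 0" "exp_bounded Q A B F" "\<And>q. q \<in> Q \<Longrightarrow> exp_bounded Q A B (DF q)"
      "\<And>q q'. q \<in> Q \<Longrightarrow> q' \<in> Q \<Longrightarrow> exp_bounded Q A B (DDF q q')"
  shows "((\<lambda>t. \<integral>g. F (interpolant p r t g) \<partial>gaussian_product) has_real_derivative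
    (1/2) * (\<Sum>q\<in>Q. \<Sum>q'\<in>Q. (\<Sum>k\<in>UNIV. p q k * p q' k - r q k * r q' k) *
      (\<integral>g. DDF q q' (interpolant p r t g) \<partial>gaussian_product))) (at t)"
proof -
  define P where "P q g = (\<Sum>k\<in>UNIV. p q k * g k)" for q and g :: "'k \<Rightarrow> real"
  define R where "R q g = (\<Sum>k\<in>UNIV. r q k * g k)" for q and g :: "'k \<Rightarrow> real"
  define f' where "f' t g = (\<Sum>q\<in>Q. DF q (interpolant p r t g) * (P q g / (2 * sqrt t) - R q g / (2 * sqrt (1 - t))))"
    for t and g :: "'k \<Rightarrow> real"
  define C where "C = coefficient_sum p r Q"
  have contP: "continuous_on UNIV (P q)" "continuous_on UNIV (R q)" for q
    unfolding P_def R_def by (intro continuous_intros)+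
  obtain \<delta> where "0 < \<delta>" "\<delta> < min t (1 - t)"
    using dense[of 0 "min t (1 - t)"] t by (metis diff_gt_0_iff_gt min_less_iff_conj)
  hence \<delta>: "\<delta> > 0" "t \<in> {\<delta><..<1-\<delta>}" by simp_all
  \<comment> \<open>The speed of the interpolant blows up at 0 and 1, so it is bounded away from both ends.\<close>
  define c where "c = 1 / (2 * sqrt \<delta>)"
  have c: "c > 0" using \<delta> by (simp add: c_def)
  have "((\<lambda>t. \<integral>g. F (interpolant p r t g) \<partial>gaussian_product) has_real_derivative
      (\<integral>g. f' t g \<partial>gaussian_product)) (at t)"
  proof (rule has_real_derivative_integral[OF \<delta>(2)])
    fix u assume u: "u \<in> {\<delta><..<1-\<delta>}"
    hence u01: "u \<in> {0..1}" "0 < u" "u < 1" using \<delta> by auto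
    show "integrable gaussian_product (\<lambda>g. F (interpolant p r u g))"
      by (rule integrable_interpolant[OF Q u01(1) bd(3,1,2) cont(1)])
    fix g :: "'k \<Rightarrow> real"
    show "((\<lambda>u. F (interpolant p r u g)) has_real_derivative f' u g) (at u)"
      unfolding f'_def
    proof (rule has_partial_derivativesD[OF D(1)])
      show "((\<lambda>u. interpolant p r u g q) has_real_derivative
          P q g / (2 * sqrt u) - R q g / (2 * sqrt (1 - u))) (at u)" for q
        unfolding interpolant_def P_def[symmetric] R_def[symmetric]
        using u01 by (auto intro!: derivative_eq_intros simp: field_simps)
    qed
    let ?S = "\<Sum>k\<in>UNIV. \<bar>g k\<bar>"
    have "1 / (2 * sqrt u) \<le> c" "1 / (2 * sqrt (1 - u)) \<le> c"
      unfolding c_def using u \<delta> u01 by (auto intro!: divide_left_mono)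
    hence PR: "\<bar>P q g / (2 * sqrt u) - R q g / (2 * sqrt (1 - u))\<bar> \<le> c * (\<bar>P q g\<bar> + \<bar>R q g\<bar>)" for q
    proof -
      have "\<bar>P q g / (2 * sqrt u)\<bar> \<le> c * \<bar>P q g\<bar>"
        using mult_right_mono[OF \<open>1 / (2 * sqrt u) \<le> c\<close>, of "\<bar>P q g\<bar>"] u01 by (simp add: abs_mult)
      moreover have "\<bar>R q g / (2 * sqrt (1 - u))\<bar> \<le> c * \<bar>R q g\<bar>"
        using mult_right_mono[OF \<open>1 / (2 * sqrt (1 - u)) \<le> c\<close>, of "\<bar>R q g\<bar>"] u01 by (simp add: abs_mult)
      ultimately show ?thesis
        unfolding distrib_left by (rule order_trans[OF abs_triangle_ineq4 add_mono])
    qed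
    have "\<bar>f' u g\<bar> \<le> (\<Sum>q\<in>Q. (A * exp (B * C * ?S)) * (c * (\<bar>P q g\<bar> + \<bar>R q g\<bar>)))"
      unfolding f'_def C_def
      by (intro order_trans[OF sum_abs] sum_mono, unfold abs_mult)
        (intro mult_mono exp_bounded_interpolant[OF Q u01(1) bd(4,1,2)] PR
          mult_nonneg_nonneg bd(1) abs_ge_zero exp_ge_zero)
    also have "\<dots> = (A * exp (B * C * ?S)) * (c * (\<Sum>q\<in>Q. \<bar>P q g\<bar> + \<bar>R q g\<bar>))"
      by (simp add: sum_distrib_left)
    also have "\<dots> \<le> (A * exp (B * C * ?S)) * (c * (C * ?S))"
      using c bd(1) sum_linear_forms_le[OF Q, of p g r]
      by (intro mult_left_mono) (simp_all add: P_def R_def C_def)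
    also have "\<dots> \<le> (A * exp (B * C * ?S)) * (c * (C * exp ?S))"
    proof (intro mult_left_mono)
      show "?S \<le> exp ?S" using exp_ge_add_one_self[of ?S] by linarith
    qed (use c bd(1) coefficient_sum_nonneg[of p r Q] in \<open>simp_all add: C_def\<close>)
    also have "\<dots> = A * c * C * exp ((B * C + 1) * ?S)"
      by (simp add: distrib_right exp_add)
    finally show "\<bar>f' u g\<bar> \<le> A * c * C * exp ((B * C + 1) * ?S)" .
  next
    show "integrable gaussian_product (\<lambda>g::'k\<Rightarrow>real. A * c * C * exp ((B * C + 1) * (\<Sum>k\<in>UNIV. \<bar>g k\<bar>)))"
      by (intro integrable_mult_right integrable_gaussian_product_exp)
    have "continuous_on UNIV (f' t)"
      unfolding f'_def using t
      by (intro continuous_intros continuous_on_compose2[OF cont(2) continuous_on_interpolant] contP) auto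
    hence "f' t \<in> borel_measurable borel" by (rule borel_measurable_continuous_onI)
    thus "f' t \<in> borel_measurable gaussian_product" by measurable
  qed
  also have "(\<integral>g. f' t g \<partial>gaussian_product)
      = (\<integral>g. (\<Sum>q\<in>Q. \<Sum>k\<in>UNIV. (p q k / (2 * sqrt t) - r q k / (2 * sqrt (1 - t))) * (g k * DF q (interpolant p r t g))) \<partial>gaussian_product)"
  proof (intro Bochner_Integration.integral_cong refl)
    fix g :: "'k \<Rightarrow> real"
    have "P q g / (2 * sqrt t) - R q g / (2 * sqrt (1 - t))
        = (\<Sum>k\<in>UNIV. (p q k / (2 * sqrt t) - r q k / (2 * sqrt (1 - t))) * g k)" for q
      by (simp add: P_def R_def sum_divide_distrib sum_subtractf left_diff_distrib)
    thus "f' t g = (\<Sum>q\<in>Q. \<Sum>k\<in>UNIV. (p q k / (2 * sqrt t) - r q k / (2 * sqrt (1 - t))) * (g k * DF q (interpolant p r t g)))"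
      by (simp only: f'_def sum_distrib_left mult_ac)
  qed
  also have "\<dots> = (\<Sum>q\<in>Q. \<Sum>k\<in>UNIV. (p q k / (2 * sqrt t) - r q k / (2 * sqrt (1 - t))) *
      (\<integral>g. g k * DF q (interpolant p r t g) \<partial>gaussian_product))"
  proof -
    have int: "integrable gaussian_product (\<lambda>g. g k * DF q (interpolant p r t g))" if "q \<in> Q" for q k
    proof (rule integrable_gaussian_product_bound)
      show "(\<lambda>g. g k * DF q (interpolant p r t g)) \<in> borel_measurable borel"
        by (intro borel_measurable_continuous_onI continuous_intros that
            continuous_on_compose2[OF cont(2) continuous_on_interpolant] subset_UNIV)
      fix g :: "'k \<Rightarrow> real"
      let ?S = "\<Sum>k\<in>UNIV. \<bar>g k\<bar>"
      have "\<bar>g k\<bar> \<le> ?S" by (rule member_le_sum) auto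
      hence "\<bar>g k\<bar> \<le> exp ?S" using exp_ge_add_one_self[of ?S] by linarith
      moreover have "\<bar>DF q (interpolant p r t g)\<bar> \<le> A * exp (B * C * ?S)"
        unfolding C_def using t by (intro exp_bounded_interpolant[OF Q _ bd(4)[OF that] bd(1,2)]) simp
      ultimately have "\<bar>g k * DF q (interpolant p r t g)\<bar> \<le> exp ?S * (A * exp (B * C * ?S))"
        unfolding abs_mult by (intro mult_mono) auto
      thus "\<bar>g k * DF q (interpolant p r t g)\<bar> \<le> A * exp ((B * C + 1) * ?S)"
        by (simp add: distrib_right exp_add mult_ac)
    qed
    define a where "a q k = p q k / (2 * sqrt t) - r q k / (2 * sqrt (1 - t))" for q k
    have "(\<integral>g. (\<Sum>q\<in>Q. \<Sum>k\<in>UNIV. a q k * (g k * DF q (interpolant p r t g))) \<partial>gaussian_product)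
        = (\<Sum>q\<in>Q. (\<integral>g. (\<Sum>k\<in>UNIV. a q k * (g k * DF q (interpolant p r t g))) \<partial>gaussian_product))"
      by (intro Bochner_Integration.integral_sum Bochner_Integration.integrable_sum
          integrable_mult_right int)
    also have "\<dots> = (\<Sum>q\<in>Q. \<Sum>k\<in>UNIV. a q k * (\<integral>g. g k * DF q (interpolant p r t g) \<partial>gaussian_product))"
    proof (intro sum.cong refl)
      fix q assume "q \<in> Q"
      thus "(\<integral>g. (\<Sum>k\<in>UNIV. a q k * (g k * DF q (interpolant p r t g))) \<partial>gaussian_product)
          = (\<Sum>k\<in>UNIV. a q k * (\<integral>g. g k * DF q (interpolant p r t g) \<partial>gaussian_product))"
        by (subst Bochner_Integration.integral_sum) (auto intro: integrable_mult_right int)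
    qed
    finally show ?thesis by (simp only: a_def)
  qed
  also have "\<dots> = (\<Sum>q\<in>Q. \<Sum>k\<in>UNIV. (p q k / (2 * sqrt t) - r q k / (2 * sqrt (1 - t))) *
      (\<Sum>q'\<in>Q. (sqrt t * p q' k + sqrt (1 - t) * r q' k) * (\<integral>g. DDF q q' (interpolant p r t g) \<partial>gaussian_product)))"
    using t by (intro sum.cong refl arg_cong2[of _ _ _ _ "(*)"]
        gaussian_product_expectation_times_coordinate[OF Q _ D(2) cont(2) cont(3) bd(1,2,4,5)]) auto
  also have "\<dots> = (\<Sum>q\<in>Q. \<Sum>q'\<in>Q. \<Sum>k\<in>UNIV. (p q k / (2 * sqrt t) - r q k / (2 * sqrt (1 - t))) *
      (sqrt t * p q' k + sqrt (1 - t) * r q' k) * (\<integral>g. DDF q q' (interpolant p r t g) \<partial>gaussian_product))"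
    by (intro sum.cong refl, subst sum.swap) (simp add: sum_distrib_left mult.assoc)
  also have "\<dots> = (\<Sum>q\<in>Q. \<Sum>q'\<in>Q. \<Sum>k\<in>UNIV. (1/2) * (p q k * p q' k - r q k * r q' k) * (\<integral>g. DDF q q' (interpolant p r t g) \<partial>gaussian_product))"
  proof (intro sum.cong refl)
    fix q q' k assume "q \<in> Q" "q' \<in> Q"
    hence 0: "p q k * r q' k = 0" "p q' k * r q k = 0" using disjoint by blast+
    have "(p q k / (2 * a) - r q k / (2 * b)) * (a * p q' k + b * r q' k)
        = p q k * p q' k / 2 + (p q k * r q' k) * b / (2 * a) - (p q' k * r q k) * a / (2 * b) - r q k * r q' k / 2"
      if "a > 0" "b > 0" for a b
      using that by (simp add: field_simps)
    from this[of "sqrt t" "sqrt (1 - t)"]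
    have "(p q k / (2 * sqrt t) - r q k / (2 * sqrt (1 - t))) * (sqrt t * p q' k + sqrt (1 - t) * r q' k)
        = (1/2) * (p q k * p q' k - r q k * r q' k)"
      using t unfolding 0 by (simp add: field_simps)
    thus "(p q k / (2 * sqrt t) - r q k / (2 * sqrt (1 - t))) * (sqrt t * p q' k + sqrt (1 - t) * r q' k) *
        (\<integral>g. DDF q q' (interpolant p r t g) \<partial>gaussian_product)
        = (1/2) * (p q k * p q' k - r q k * r q' k) * (\<integral>g. DDF q q' (interpolant p r t g) \<partial>gaussian_product)"
      by (simp only:)
  qed
  also have "\<dots> = (1/2) * (\<Sum>q\<in>Q. \<Sum>q'\<in>Q. (\<Sum>k\<in>UNIV. p q k * p q' k - r q k * r q' k) *
      (\<integral>g. DDF q q' (interpolant p r t g) \<partial>gaussian_product))"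
    by (simp only: sum_distrib_left sum_distrib_right mult.assoc)
  finally show ?thesis .
qed

section \<open>Powers of the smoothed partition function\<close>

text \<open>
  The coordinate \<open>(i, Some a)\<close> stands for entry \<open>a\<close> of the Gaussian vector inside the norm of the
  \<open>i\<close>-th exponent, the coordinate \<open>(i, None)\<close> for the scalar Gaussian added to that norm.
\<close>

type_synonym 'm process = "nat \<times> 'm option \<Rightarrow> real"

locale power_of_partition_function =
  fixes l :: nat and \<beta> s c :: real
  assumes l: "l \<ge> 1" and s: "s \<in> {-1, 1}" and \<beta>: "\<beta> > 0"
begin

text \<open>
  The Euclidean norm is not differentiable at the origin, and for \<open>m = 1\<close> its second derivative is
  not even a function.  The parameter \<open>\<epsilon> > 0\<close> makes it smooth; \<open>\<epsilon> = 0\<close> gives the norm itself.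
\<close>

definition smoothed_norm :: "real \<Rightarrow> 'm::finite process \<Rightarrow> nat \<Rightarrow> real"
  where "smoothed_norm \<epsilon> y i = sqrt (\<epsilon>\<^sup>2 + (\<Sum>a\<in>UNIV. (y (i, Some a))\<^sup>2))"

definition weight :: "real \<Rightarrow> 'm::finite process \<Rightarrow> nat \<Rightarrow> real"
  where "weight \<epsilon> y i = exp (\<beta> * (s * smoothed_norm \<epsilon> y i + y (i, None)))"

definition partition_function :: "real \<Rightarrow> 'm::finite process \<Rightarrow> real"
  where "partition_function \<epsilon> y = (\<Sum>i=1..l. weight \<epsilon> y i)"

text \<open>
  The integrand of \<open>psi\<close>, smoothed.
\<close>

definition F :: "real \<Rightarrow> 'm::finite process \<Rightarrow> real"
  where "F \<epsilon> y = partition_function \<epsilon> y powr c"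

text \<open>
  \<open>slope\<close> and \<open>curvature\<close> are the first and second partial derivatives of the \<open>i\<close>-th exponent divided
  by \<open>\<beta>\<close>; \<open>DF\<close> and \<open>DDF\<close> are those of \<open>F\<close>.  Only the curvature becomes unbounded as \<open>\<epsilon> \<rightarrow> 0\<close>, and it
  enters \<open>DDF\<close> only when both coordinates belong to the same index \<open>i\<close>.
\<close>

primrec slope :: "real \<Rightarrow> 'm::finite process \<Rightarrow> nat \<Rightarrow> 'm option \<Rightarrow> real"
  where "slope \<epsilon> y i None = 1"
  | "slope \<epsilon> y i (Some a) = s * y (i, Some a) / smoothed_norm \<epsilon> y i"

fun curvature :: "real \<Rightarrow> 'm::finite process \<Rightarrow> nat \<Rightarrow> 'm option \<Rightarrow> 'm option \<Rightarrow> real"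
  where "curvature \<epsilon> y i (Some a) (Some b) =
      s * ((if a = b then 1 else 0) / smoothed_norm \<epsilon> y i - y (i, Some a) * y (i, Some b) / smoothed_norm \<epsilon> y i ^ 3)"
  | "curvature \<epsilon> y i _ _ = 0"

definition DF :: "real \<Rightarrow> nat \<times> 'm option \<Rightarrow> 'm::finite process \<Rightarrow> real"
  where "DF \<epsilon> q y = c * \<beta> * partition_function \<epsilon> y powr (c - 1) * weight \<epsilon> y (fst q) * slope \<epsilon> y (fst q) (snd q)"

definition DDF :: "real \<Rightarrow> nat \<times> 'm option \<Rightarrow> nat \<times> 'm option \<Rightarrow> 'm::finite process \<Rightarrow> real"
  where "DDF \<epsilon> q q' y =
    c * (c - 1) * \<beta>\<^sup>2 * partition_function \<epsilon> y powr (c - 2) * weight \<epsilon> y (fst q) * weight \<epsilon> y (fst q')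
      * slope \<epsilon> y (fst q) (snd q) * slope \<epsilon> y (fst q') (snd q')
    + (if fst q = fst q'
       then c * \<beta> * partition_function \<epsilon> y powr (c - 1) * weight \<epsilon> y (fst q)
         * (\<beta> * slope \<epsilon> y (fst q) (snd q) * slope \<epsilon> y (fst q') (snd q') + curvature \<epsilon> y (fst q) (snd q) (snd q'))
       else 0)"

abbreviation Q :: "(nat \<times> 'm::finite option) set"
  where "Q \<equiv> {1..l} \<times> UNIV"

lemma weight_pos: "weight \<epsilon> y i > 0"
  by (simp add: weight_def)

lemma partition_function_pos: "partition_function \<epsilon> y > 0"
  unfolding partition_function_def using l by (intro sum_pos weight_pos) auto

lemma weight_le_partition_function: "i \<in> {1..l} \<Longrightarrow> weight \<epsilon> y i \<le> partition_function \<epsilon> y"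
  unfolding partition_function_def by (rule member_le_sum) (auto intro: less_imp_le weight_pos)

lemma smoothed_norm_pos: "\<epsilon> > 0 \<Longrightarrow> smoothed_norm \<epsilon> y i > 0"
  unfolding smoothed_norm_def by (intro real_sqrt_gt_zero add_pos_nonneg sum_nonneg) auto

lemma smoothed_norm_nonneg: "smoothed_norm \<epsilon> y i \<ge> 0"
  unfolding smoothed_norm_def by (intro real_sqrt_ge_zero add_nonneg_nonneg sum_nonneg) auto

lemma sum_UNIV_option: "(\<Sum>\<alpha>\<in>UNIV. f \<alpha>) = f None + (\<Sum>a\<in>UNIV. f (Some a))" for f :: "'m::finite option \<Rightarrow> real"
  by (simp add: UNIV_option_conv sum.reindex)

lemma smoothed_norm_has_derivative:
  assumes "\<epsilon> > 0" and "\<And>a. ((\<lambda>\<tau>. y \<tau> (i, Some a)) has_real_derivative y' (i, Some a)) (at \<tau>)"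
  shows "((\<lambda>\<tau>. smoothed_norm \<epsilon> (y \<tau>) i) has_real_derivative
    (\<Sum>a\<in>UNIV. y \<tau> (i, Some a) * y' (i, Some a)) / smoothed_norm \<epsilon> (y \<tau>) i) (at \<tau>)"
proof -
  have pos: "\<epsilon>\<^sup>2 + (\<Sum>a\<in>UNIV. (y \<tau> (i, Some a))\<^sup>2) > 0"
    using assms(1) by (intro add_pos_nonneg sum_nonneg) auto
  have "((\<lambda>\<tau>. \<epsilon>\<^sup>2 + (\<Sum>a\<in>UNIV. (y \<tau> (i, Some a))\<^sup>2)) has_real_derivative
      (\<Sum>a\<in>UNIV. 2 * y \<tau> (i, Some a) * y' (i, Some a))) (at \<tau>)"
    by (rule derivative_eq_intros assms(2) refl)+ (simp add: mult_ac)
  from DERIV_chain2[OF DERIV_real_sqrt[OF pos] this] show ?thesis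
    unfolding smoothed_norm_def by (simp add: sum_distrib_left[symmetric] mult.assoc field_simps)
qed

lemma weight_has_derivative:
  assumes "\<epsilon> > 0" and "\<And>\<alpha>. ((\<lambda>\<tau>. y \<tau> (i, \<alpha>)) has_real_derivative y' (i, \<alpha>)) (at \<tau>)"
  shows "((\<lambda>\<tau>. weight \<epsilon> (y \<tau>) i) has_real_derivative
    \<beta> * weight \<epsilon> (y \<tau>) i * (\<Sum>\<alpha>\<in>UNIV. slope \<epsilon> (y \<tau>) i \<alpha> * y' (i, \<alpha>))) (at \<tau>)"
proof -
  have "s * ((\<Sum>a\<in>UNIV. y \<tau> (i, Some a) * y' (i, Some a)) / smoothed_norm \<epsilon> (y \<tau>) i) + y' (i, None)
      = (\<Sum>\<alpha>\<in>UNIV. slope \<epsilon> (y \<tau>) i \<alpha> * y' (i, \<alpha>))"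
    by (simp add: sum_UNIV_option sum_distrib_left sum_divide_distrib mult_ac)
  moreover have "((\<lambda>\<tau>. weight \<epsilon> (y \<tau>) i) has_real_derivative weight \<epsilon> (y \<tau>) i *
      (\<beta> * (s * ((\<Sum>a\<in>UNIV. y \<tau> (i, Some a) * y' (i, Some a)) / smoothed_norm \<epsilon> (y \<tau>) i) + y' (i, None)))) (at \<tau>)"
    unfolding weight_def
    by (rule DERIV_fun_exp DERIV_cmult DERIV_add smoothed_norm_has_derivative assms)+
  ultimately show ?thesis by (simp add: mult_ac)
qed

lemma slope_has_derivative:
  assumes "\<epsilon> > 0" and d: "\<And>\<alpha>. ((\<lambda>\<tau>. y \<tau> (i, \<alpha>)) has_real_derivative y' (i, \<alpha>)) (at \<tau>)"
  shows "((\<lambda>\<tau>. slope \<epsilon> (y \<tau>) i \<alpha>) has_real_derivative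
    (\<Sum>\<alpha>'\<in>UNIV. curvature \<epsilon> (y \<tau>) i \<alpha> \<alpha>' * y' (i, \<alpha>'))) (at \<tau>)"
proof (cases \<alpha>)
  case None
  thus ?thesis by simp
next
  case (Some a)
  let ?r = "smoothed_norm \<epsilon> (y \<tau>) i" and ?v = "\<Sum>b\<in>UNIV. y \<tau> (i, Some b) * y' (i, Some b)"
  have r: "?r > 0" by (rule smoothed_norm_pos[OF assms(1)])
  have "((\<lambda>\<tau>. s * y \<tau> (i, Some a) / smoothed_norm \<epsilon> (y \<tau>) i) has_real_derivative
      (s * y' (i, Some a) * ?r - s * y \<tau> (i, Some a) * (?v / ?r)) / (?r * ?r)) (at \<tau>)"
    using r by (intro DERIV_divide DERIV_cmult d smoothed_norm_has_derivative assms) simp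
  also have "(s * y' (i, Some a) * ?r - s * y \<tau> (i, Some a) * (?v / ?r)) / (?r * ?r)
      = s * y' (i, Some a) / ?r - s * y \<tau> (i, Some a) / ?r ^ 3 * ?v"
    using r by (simp add: field_simps power3_eq_cube)
  also have "\<dots> = (\<Sum>b\<in>UNIV. curvature \<epsilon> (y \<tau>) i (Some a) (Some b) * y' (i, Some b))"
  proof -
    have "(\<Sum>b\<in>UNIV. curvature \<epsilon> (y \<tau>) i (Some a) (Some b) * y' (i, Some b))
        = (\<Sum>b\<in>UNIV. (if a = b then s * y' (i, Some b) / ?r else 0)
            - s * y \<tau> (i, Some a) / ?r ^ 3 * (y \<tau> (i, Some b) * y' (i, Some b)))"
      by (intro sum.cong refl) (simp add: algebra_simps)
    also have "\<dots> = s * y' (i, Some a) / ?r - s * y \<tau> (i, Some a) / ?r ^ 3 * ?v"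
      by (simp add: sum_subtractf sum_distrib_left)
    finally show ?thesis by simp
  qed
  finally show ?thesis
    by (simp add: Some sum_UNIV_option)
qed

lemma partition_function_has_derivative:
  fixes y :: "real \<Rightarrow> 'm::finite process"
  assumes "\<epsilon> > 0" and d: "\<And>q. q \<in> Q \<Longrightarrow> ((\<lambda>\<tau>. y \<tau> q) has_real_derivative y' q) (at \<tau>)"
  shows "((\<lambda>\<tau>. partition_function \<epsilon> (y \<tau>)) has_real_derivative
    (\<Sum>q\<in>Q. \<beta> * weight \<epsilon> (y \<tau>) (fst q) * slope \<epsilon> (y \<tau>) (fst q) (snd q) * y' q)) (at \<tau>)"
proof -
  have "((\<lambda>\<tau>. partition_function \<epsilon> (y \<tau>)) has_real_derivative
    (\<Sum>i=1..l. \<beta> * weight \<epsilon> (y \<tau>) i * (\<Sum>\<alpha>\<in>UNIV. slope \<epsilon> (y \<tau>) i \<alpha> * y' (i, \<alpha>)))) (at \<tau>)"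
    unfolding partition_function_def
    by (intro DERIV_sum weight_has_derivative[OF assms(1)] d) auto
  also have "(\<Sum>i=1..l. \<beta> * weight \<epsilon> (y \<tau>) i * (\<Sum>\<alpha>\<in>UNIV. slope \<epsilon> (y \<tau>) i \<alpha> * y' (i, \<alpha>)))
      = (\<Sum>q\<in>Q. \<beta> * weight \<epsilon> (y \<tau>) (fst q) * slope \<epsilon> (y \<tau>) (fst q) (snd q) * y' q)"
    by (simp add: sum_distrib_left sum.cartesian_product case_prod_unfold mult.assoc)
  finally show ?thesis .
qed

lemma partition_function_powr_has_derivative:
  fixes y :: "real \<Rightarrow> 'm::finite process"
  assumes "\<epsilon> > 0" and d: "\<And>q. q \<in> Q \<Longrightarrow> ((\<lambda>\<tau>. y \<tau> q) has_real_derivative y' q) (at \<tau>)"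
  shows "((\<lambda>\<tau>. partition_function \<epsilon> (y \<tau>) powr e) has_real_derivative
    (\<Sum>q\<in>Q. e * partition_function \<epsilon> (y \<tau>) powr (e - 1) * \<beta> * weight \<epsilon> (y \<tau>) (fst q) * slope \<epsilon> (y \<tau>) (fst q) (snd q) * y' q)) (at \<tau>)"
proof -
  have "((\<lambda>\<tau>. partition_function \<epsilon> (y \<tau>) powr e) has_real_derivative
      e * partition_function \<epsilon> (y \<tau>) powr (e - 1) *
      (\<Sum>q\<in>Q. \<beta> * weight \<epsilon> (y \<tau>) (fst q) * slope \<epsilon> (y \<tau>) (fst q) (snd q) * y' q)) (at \<tau>)"
    using DERIV_fun_powr[where r = e, OF partition_function_has_derivative[OF assms] partition_function_pos]
    by simp
  thus ?thesis by (simp add: sum_distrib_left mult.assoc)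
qed

lemma F_has_partial_derivatives:
  assumes "\<epsilon> > 0"
  shows "has_partial_derivatives Q (F \<epsilon>) (DF \<epsilon> :: _ \<Rightarrow> 'm::finite process \<Rightarrow> real)"
  unfolding has_partial_derivatives_def F_def DF_def
proof (intro allI impI)
  fix y :: "real \<Rightarrow> 'm process" and y' \<tau>
  assume "\<forall>q\<in>Q. ((\<lambda>\<tau>. y \<tau> q) has_real_derivative y' q) (at \<tau>)"
  hence "\<And>q. q \<in> Q \<Longrightarrow> ((\<lambda>\<tau>. y \<tau> q) has_real_derivative y' q) (at \<tau>)" by blast
  from partition_function_powr_has_derivative[where e = c, OF assms this]
  show "((\<lambda>\<tau>. partition_function \<epsilon> (y \<tau>) powr c) has_real_derivative
      (\<Sum>q\<in>Q. c * \<beta> * partition_function \<epsilon> (y \<tau>) powr (c - 1) * weight \<epsilon> (y \<tau>) (fst q) * slope \<epsilon> (y \<tau>) (fst q) (snd q) * y' q)) (at \<tau>)"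
    by (simp add: mult_ac)
qed

text \<open>
  The first summand of \<open>DDF\<close> comes from the power of the partition function, which depends on all
  indices; the second one from the factor \<open>weight * slope\<close>, which depends on a single index.
\<close>

lemma DF_has_partial_derivatives:
  assumes "\<epsilon> > 0" and q: "q \<in> Q"
  shows "has_partial_derivatives Q (DF \<epsilon> q) (DDF \<epsilon> q :: _ \<Rightarrow> 'm::finite process \<Rightarrow> real)"
  unfolding has_partial_derivatives_def
proof (intro allI impI)
  fix y :: "real \<Rightarrow> 'm process" and y' \<tau>
  assume "\<forall>q\<in>Q. ((\<lambda>\<tau>. y \<tau> q) has_real_derivative y' q) (at \<tau>)"
  hence d: "\<And>q. q \<in> Q \<Longrightarrow> ((\<lambda>\<tau>. y \<tau> q) has_real_derivative y' q) (at \<tau>)" by blast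
  obtain i \<alpha> where q_eq [simp]: "q = (i, \<alpha>)" by (cases q)
  have i: "i \<in> {1..l}" using q by simp
  let ?Z = "partition_function \<epsilon> (y \<tau>)" and ?w = "weight \<epsilon> (y \<tau>)" and ?d = "slope \<epsilon> (y \<tau>)"
  let ?k = "curvature \<epsilon> (y \<tau>)"
  have di: "((\<lambda>\<tau>. y \<tau> (i, \<alpha>)) has_real_derivative y' (i, \<alpha>)) (at \<tau>)" for \<alpha>
    using i by (intro d) auto
  have "((\<lambda>\<tau>. c * \<beta> * (partition_function \<epsilon> (y \<tau>) powr (c - 1) * (weight \<epsilon> (y \<tau>) i * slope \<epsilon> (y \<tau>) i \<alpha>)))
      has_real_derivative c * \<beta> *
       ((\<Sum>q\<in>Q. (c - 1) * ?Z powr (c - 1 - 1) * \<beta> * ?w (fst q) * ?d (fst q) (snd q) * y' q) * (?w i * ?d i \<alpha>)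
        + ((\<beta> * ?w i * (\<Sum>\<alpha>'\<in>UNIV. ?d i \<alpha>' * y' (i, \<alpha>'))) * ?d i \<alpha>
           + (\<Sum>\<alpha>'\<in>UNIV. ?k i \<alpha> \<alpha>' * y' (i, \<alpha>')) * ?w i) * ?Z powr (c - 1))) (at \<tau>)"
    by (intro DERIV_cmult DERIV_mult 
        weight_has_derivative[where y = y and y' = y' and i = i, OF assms(1) di]
        slope_has_derivative[where y = y and y' = y' and i = i, OF assms(1) di]
        partition_function_powr_has_derivative[OF assms(1) d])
  also have "(\<lambda>\<tau>. c * \<beta> * (partition_function \<epsilon> (y \<tau>) powr (c - 1) * (weight \<epsilon> (y \<tau>) i * slope \<epsilon> (y \<tau>) i \<alpha>)))
      = (\<lambda>\<tau>. DF \<epsilon> q (y \<tau>))"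
    by (simp add: DF_def mult.assoc)
  also have "c * \<beta> *
       ((\<Sum>q\<in>Q. (c - 1) * ?Z powr (c - 1 - 1) * \<beta> * ?w (fst q) * ?d (fst q) (snd q) * y' q) * (?w i * ?d i \<alpha>)
        + ((\<beta> * ?w i * (\<Sum>\<alpha>'\<in>UNIV. ?d i \<alpha>' * y' (i, \<alpha>'))) * ?d i \<alpha>
           + (\<Sum>\<alpha>'\<in>UNIV. ?k i \<alpha> \<alpha>' * y' (i, \<alpha>')) * ?w i) * ?Z powr (c - 1))
     = (\<Sum>q'\<in>Q. c * (c - 1) * \<beta>\<^sup>2 * ?Z powr (c - 2) * ?w i * ?w (fst q') * ?d i \<alpha> * ?d (fst q') (snd q') * y' q')
       + (\<Sum>\<alpha>'\<in>UNIV. c * \<beta> * ?Z powr (c - 1) * ?w i * (\<beta> * ?d i \<alpha> * ?d i \<alpha>' + ?k i \<alpha> \<alpha>') * y' (i, \<alpha>'))"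
  proof -
    have 1: "c * \<beta> * ((\<Sum>q\<in>Q. (c - 1) * ?Z powr (c - 1 - 1) * \<beta> * ?w (fst q) * ?d (fst q) (snd q) * y' q) * (?w i * ?d i \<alpha>))
      = (\<Sum>q'\<in>Q. c * (c - 1) * \<beta>\<^sup>2 * ?Z powr (c - 2) * ?w i * ?w (fst q') * ?d i \<alpha> * ?d (fst q') (snd q') * y' q')"
      unfolding sum_distrib_left sum_distrib_right
      by (intro sum.cong refl) (simp add: power2_eq_square mult_ac)
    have 2: "c * \<beta> * (((\<beta> * ?w i * (\<Sum>\<alpha>'\<in>UNIV. ?d i \<alpha>' * y' (i, \<alpha>'))) * ?d i \<alpha>
           + (\<Sum>\<alpha>'\<in>UNIV. ?k i \<alpha> \<alpha>' * y' (i, \<alpha>')) * ?w i) * ?Z powr (c - 1))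
       = (\<Sum>\<alpha>'\<in>UNIV. c * \<beta> * ?Z powr (c - 1) * ?w i * (\<beta> * ?d i \<alpha> * ?d i \<alpha>' + ?k i \<alpha> \<alpha>') * y' (i, \<alpha>'))"
      unfolding sum_distrib_left sum_distrib_right sum.distrib[symmetric]
      by (intro sum.cong refl) (simp add: algebra_simps)
    show ?thesis by (simp only: distrib_left[of "c * \<beta>"] 1 2)
  qed
  also have "\<dots> = (\<Sum>q'\<in>Q. DDF \<epsilon> q q' (y \<tau>) * y' q')"
  proof -
    have "(\<Sum>\<alpha>'\<in>UNIV. c * \<beta> * ?Z powr (c - 1) * ?w i * (\<beta> * ?d i \<alpha> * ?d i \<alpha>' + ?k i \<alpha> \<alpha>') * y' (i, \<alpha>'))
       = (\<Sum>j=1..l. if i = j then (\<Sum>\<alpha>'\<in>UNIV. c * \<beta> * ?Z powr (c - 1) * ?w i * (\<beta> * ?d i \<alpha> * ?d j \<alpha>' + ?k i \<alpha> \<alpha>') * y' (j, \<alpha>')) else 0)"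
      using i by (subst sum.delta') auto
    also have "\<dots> = (\<Sum>q'\<in>Q. (if i = fst q' then c * \<beta> * ?Z powr (c - 1) * ?w i
          * (\<beta> * ?d i \<alpha> * ?d (fst q') (snd q') + ?k i \<alpha> (snd q')) else 0) * y' q')"
    proof -
      have "(if i = j then (\<Sum>\<alpha>'\<in>UNIV. c * \<beta> * ?Z powr (c - 1) * ?w i * (\<beta> * ?d i \<alpha> * ?d j \<alpha>' + ?k i \<alpha> \<alpha>') * y' (j, \<alpha>')) else 0)
          = (\<Sum>\<alpha>'\<in>UNIV. (if i = j then c * \<beta> * ?Z powr (c - 1) * ?w i * (\<beta> * ?d i \<alpha> * ?d j \<alpha>' + ?k i \<alpha> \<alpha>') else 0) * y' (j, \<alpha>'))" for j
        by simp
      thus ?thesis by (simp only: sum.cartesian_product case_prod_unfold prod.collapse)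
    qed
    finally show ?thesis
      unfolding DDF_def distrib_right sum.distrib q_eq fst_conv snd_conv by (simp only:)
  qed
  finally show "((\<lambda>\<tau>. DF \<epsilon> q (y \<tau>)) has_real_derivative (\<Sum>q'\<in>Q. DDF \<epsilon> q q' (y \<tau>) * y' q')) (at \<tau>)" .
qed

lemma continuous_on_smoothed_norm: "continuous_on UNIV (\<lambda>y. smoothed_norm \<epsilon> y i)"
  unfolding smoothed_norm_def by (intro continuous_intros)

lemma continuous_on_weight: "continuous_on UNIV (\<lambda>y. weight \<epsilon> y i)"
  unfolding weight_def by (intro continuous_intros continuous_on_smoothed_norm)

lemma continuous_on_partition_function: "continuous_on UNIV (\<lambda>y. partition_function \<epsilon> y)"
  unfolding partition_function_def by (intro continuous_intros continuous_on_weight)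

lemma continuous_on_partition_function_powr: "continuous_on UNIV (\<lambda>y. partition_function \<epsilon> y powr e)"
proof (intro continuous_intros continuous_on_partition_function)
  show "\<forall>y\<in>UNIV. partition_function \<epsilon> y \<noteq> 0"
    by (metis partition_function_pos less_irrefl)
qed

lemma continuous_on_slope:
  assumes "\<epsilon> > 0" shows "continuous_on UNIV (\<lambda>y. slope \<epsilon> y i \<alpha>)"
proof -
  have "smoothed_norm \<epsilon> y i \<noteq> 0" for y :: "'a process" using smoothed_norm_pos[OF assms, of y i] by simp
  thus ?thesis by (cases \<alpha>) (auto intro!: continuous_intros continuous_on_smoothed_norm)
qed

lemma continuous_on_curvature:
  assumes "\<epsilon> > 0" shows "continuous_on UNIV (\<lambda>y. curvature \<epsilon> y i \<alpha> \<alpha>')"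
proof -
  have "smoothed_norm \<epsilon> y i \<noteq> 0" for y :: "'a process" using smoothed_norm_pos[OF assms, of y i] by simp
  thus ?thesis by (cases \<alpha>; cases \<alpha>') (auto intro!: continuous_intros continuous_on_smoothed_norm)
qed

lemma continuous_on_F: "continuous_on UNIV (F \<epsilon>)"
  unfolding F_def by (rule continuous_on_partition_function_powr)

lemma continuous_on_DF: "\<epsilon> > 0 \<Longrightarrow> continuous_on UNIV (DF \<epsilon> q)"
  unfolding DF_def
  by (intro continuous_intros continuous_on_partition_function_powr continuous_on_weight continuous_on_slope)

lemma continuous_on_DDF: 
  assumes "\<epsilon> > 0" shows "continuous_on UNIV (DDF \<epsilon> q q')"
proof (cases "fst q = fst q'")
  case True
  thus ?thesis unfolding DDF_def using assms
    by (simp, intro continuous_intros continuous_on_partition_function_powr continuous_on_weight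
        continuous_on_slope continuous_on_curvature)
next
  case False
  thus ?thesis unfolding DDF_def using assms
    by (simp, intro continuous_intros continuous_on_partition_function_powr continuous_on_weight
        continuous_on_slope continuous_on_curvature)
qed

text \<open>
  Bounds for the integrand that are uniform over \<open>\<epsilon>\<close> in the unit interval; they will dominate the
  limit \<open>\<epsilon> \<rightarrow> 0\<close>.
\<close>

definition growth_factor :: real where "growth_factor = l powr \<bar>c\<bar> * exp (\<bar>c\<bar> * \<beta>)"
definition growth_rate :: real where "growth_rate = 2 * \<bar>c\<bar> * \<beta>"

lemma growth_factor_nonneg: "growth_factor \<ge> 0" and growth_rate_nonneg: "growth_rate \<ge> 0"
  using \<beta> by (auto simp: growth_factor_def growth_rate_def)

lemma coordinate_le_smoothed_norm: "\<bar>y (i, Some a)\<bar> \<le> smoothed_norm \<epsilon> y i"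
proof -
  have "(y (i, Some a))\<^sup>2 \<le> (\<Sum>a\<in>UNIV. (y (i, Some a))\<^sup>2)"
    by (rule member_le_sum) auto
  also have "\<dots> \<le> \<epsilon>\<^sup>2 + (\<Sum>a\<in>UNIV. (y (i, Some a))\<^sup>2)" by simp
  finally show ?thesis unfolding smoothed_norm_def by (metis real_sqrt_abs real_sqrt_le_mono)
qed

lemma smoothed_norm_le:
  assumes "0 \<le> \<epsilon>" "\<epsilon> \<le> 1"
  shows "smoothed_norm \<epsilon> y i \<le> 1 + (\<Sum>a\<in>UNIV. \<bar>y (i, Some a)\<bar>)"
proof -
  have "smoothed_norm \<epsilon> y i = sqrt (\<epsilon>\<^sup>2 + (L2_set (\<lambda>a. y (i, Some a)) UNIV)\<^sup>2)"
    unfolding smoothed_norm_def L2_set_def by (simp add: sum_nonneg)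
  also have "\<dots> \<le> \<epsilon> + L2_set (\<lambda>a. y (i, Some a)) UNIV"
    using assms by (intro sqrt_sum_squares_le_sum L2_set_nonneg)
  also have "L2_set (\<lambda>a. y (i, Some a)) UNIV \<le> (\<Sum>a\<in>UNIV. \<bar>y (i, Some a)\<bar>)"
    by (rule L2_set_le_sum_abs)
  finally show ?thesis using assms by simp
qed

text \<open>
  Every exponent lies in \<open>[-e, e]\<close> with \<open>e = \<beta> (1 + 2 S)\<close>, where \<open>S\<close> is the sum of the absolute
  coordinates, so the partition function lies between \<open>exp (-e)\<close> and \<open>l exp e\<close>.  The upper bound
  serves positive powers and the lower one negative powers.
\<close>

lemma F_exp_bounded:
  assumes "0 \<le> \<epsilon>" "\<epsilon> \<le> 1"
  shows "exp_bounded Q growth_factor growth_rate (F \<epsilon> :: 'm::finite process \<Rightarrow> real)"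
  unfolding exp_bounded_def
proof
  fix y :: "'m process"
  let ?S = "\<Sum>q\<in>Q. \<bar>y q\<bar>"
  define e where "e = \<beta> * (1 + 2 * ?S)"
  have S: "?S \<ge> 0" by (intro sum_nonneg) auto
  hence e: "e \<ge> 0" using \<beta> by (simp add: e_def)
  have exponent: "\<bar>\<beta> * (s * smoothed_norm \<epsilon> y i + y (i, None))\<bar> \<le> e" if i: "i \<in> {1..l}" for i
  proof -
    have "(\<Sum>a\<in>UNIV. \<bar>y (i, Some a)\<bar>) = (\<Sum>q\<in>(\<lambda>a. (i, Some a)) ` UNIV. \<bar>y q\<bar>)"
      by (subst sum.reindex) (auto simp: inj_on_def)
    also have "\<dots> \<le> ?S"
      using i by (intro sum_mono2) auto
    finally have "smoothed_norm \<epsilon> y i \<le> 1 + ?S" using smoothed_norm_le[OF assms, of y i] by linarith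
    moreover have "\<bar>y (i, None)\<bar> \<le> ?S" using i by (intro member_le_sum) auto
    moreover have "\<bar>s * smoothed_norm \<epsilon> y i\<bar> = smoothed_norm \<epsilon> y i" using s by (auto simp: abs_mult abs_of_nonneg[OF smoothed_norm_nonneg])
    ultimately have "\<bar>s * smoothed_norm \<epsilon> y i + y (i, None)\<bar> \<le> 1 + 2 * ?S" by linarith
    thus ?thesis using \<beta> by (simp add: e_def abs_mult)
  qed
  have up: "partition_function \<epsilon> y \<le> l * exp e"
  proof -
    have "partition_function \<epsilon> y \<le> (\<Sum>i=1..l. exp e)"
      unfolding partition_function_def weight_def
      using exponent by (intro sum_mono) (auto simp: abs_le_iff)
    thus ?thesis by simp
  qed
  have lo: "exp (- e) \<le> partition_function \<epsilon> y"
  proof -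
    have "exp (- e) \<le> weight \<epsilon> y 1"
      unfolding weight_def using exponent[of 1] l by (auto simp: abs_le_iff)
    also have "\<dots> \<le> partition_function \<epsilon> y" using l by (intro weight_le_partition_function) auto
    finally show ?thesis .
  qed
  have "partition_function \<epsilon> y powr c \<le> l powr \<bar>c\<bar> * exp (\<bar>c\<bar> * e)"
  proof (cases "c \<ge> 0")
    case True
    have "partition_function \<epsilon> y powr c \<le> (l * exp e) powr c"
      using True up partition_function_pos[of \<epsilon> y] by (intro powr_mono2) auto
    also have "\<dots> = l powr \<bar>c\<bar> * exp (\<bar>c\<bar> * e)"
      using True by (simp add: powr_mult exp_powr_real mult.commute)
    finally show ?thesis .
  next
    case False
    have "partition_function \<epsilon> y powr c \<le> exp (- e) powr c"
      using False lo partition_function_pos[of \<epsilon> y] by (intro powr_mono2') auto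
    also have "\<dots> = exp (\<bar>c\<bar> * e)"
      using False by (simp add: exp_powr_real mult.commute)
    also have "\<dots> \<le> l powr \<bar>c\<bar> * exp (\<bar>c\<bar> * e)"
      using l ge_one_powr_ge_zero[of "real l" "\<bar>c\<bar>"] by simp
    finally show ?thesis .
  qed
  also have "\<dots> = growth_factor * exp (growth_rate * ?S)"
    by (simp add: growth_factor_def growth_rate_def e_def algebra_simps exp_add)
  finally show "\<bar>F \<epsilon> y\<bar> \<le> growth_factor * exp (growth_rate * ?S)"
    by (simp add: F_def)
qed

text \<open>
  A weight never exceeds the partition function.  Hence each weight can be absorbed into a missing power,
  and all derivatives of \<open>F\<close> are bounded by multiples of \<open>F\<close>.
\<close>

lemma powr_weight_le: "i \<in> {1..l} \<Longrightarrow> partition_function \<epsilon> y powr (c - 1) * weight \<epsilon> y i \<le> F \<epsilon> y"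
  using mult_left_mono[OF weight_le_partition_function, of i "partition_function \<epsilon> y powr (c - 1)" \<epsilon> y]
    partition_function_pos[of \<epsilon> y] unfolding F_def
  by (simp add: powr_mult_base[of "partition_function \<epsilon> y" "c - 1"] mult.commute)

lemma powr_weight_weight_le:
  assumes "i \<in> {1..l}" "j \<in> {1..l}"
  shows "partition_function \<epsilon> y powr (c - 2) * weight \<epsilon> y i * weight \<epsilon> y j \<le> F \<epsilon> y"
proof -
  have "partition_function \<epsilon> y powr (c - 2) * weight \<epsilon> y i * weight \<epsilon> y j
      \<le> partition_function \<epsilon> y powr (c - 2) * partition_function \<epsilon> y * weight \<epsilon> y j"
    using assms by (intro mult_right_mono mult_left_mono weight_le_partition_function) (auto intro: less_imp_le weight_pos)
  also have "\<dots> = partition_function \<epsilon> y powr (c - 1) * weight \<epsilon> y j"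
    using partition_function_pos[of \<epsilon> y]
    by (simp add: powr_mult_base[of "partition_function \<epsilon> y" "c - 2"] mult.commute)
  also have "\<dots> \<le> F \<epsilon> y" by (rule powr_weight_le[OF assms(2)])
  finally show ?thesis .
qed

lemma abs_slope_le: "\<epsilon> > 0 \<Longrightarrow> \<bar>slope \<epsilon> y i \<alpha>\<bar> \<le> 1"
  using s coordinate_le_smoothed_norm[of y i _ \<epsilon>] smoothed_norm_pos[of \<epsilon> y i]
  by (cases \<alpha>) (auto simp: abs_mult divide_simps)

lemma abs_curvature_le:
  assumes "\<epsilon> > 0"
  shows "\<bar>curvature \<epsilon> y i \<alpha> \<alpha>'\<bar> \<le> 2 / \<epsilon>"
proof -
  let ?r = "smoothed_norm \<epsilon> y i"
  have r: "\<epsilon> \<le> ?r" "?r > 0"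
    using assms smoothed_norm_pos[OF assms, of y i] unfolding smoothed_norm_def
    by (auto intro!: real_le_rsqrt simp: sum_nonneg)
  have "\<bar>curvature \<epsilon> y i (Some a) (Some b)\<bar> \<le> 2 / \<epsilon>" for a b
  proof -
    have "\<bar>y (i, Some a) * y (i, Some b)\<bar> \<le> ?r * ?r"
      unfolding abs_mult by (intro mult_mono coordinate_le_smoothed_norm smoothed_norm_nonneg) auto
    hence "\<bar>y (i, Some a) * y (i, Some b) / ?r ^ 3\<bar> \<le> 1 / ?r"
      using r by (simp add: power3_eq_cube divide_simps abs_mult)
    moreover have "\<bar>(if a = b then 1 else 0) / ?r\<bar> \<le> 1 / ?r" using r by auto
    moreover have "1 / ?r \<le> 1 / \<epsilon>" using r assms by (intro divide_left_mono) auto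
    moreover have "\<bar>curvature \<epsilon> y i (Some a) (Some b)\<bar>
        = \<bar>(if a = b then 1 else 0) / ?r - y (i, Some a) * y (i, Some b) / ?r ^ 3\<bar>"
      using s by (auto simp: abs_mult)
    ultimately show ?thesis by linarith
  qed
  thus ?thesis using assms by (cases \<alpha>; cases \<alpha>') auto
qed

text \<open>
  One common constant for \<open>F\<close>, \<open>DF\<close> and \<open>DDF\<close>.  It diverges as \<open>\<epsilon> \<rightarrow> 0\<close>, so it only serves at fixed
  \<open>\<epsilon> > 0\<close>.
\<close>

definition smoothed_growth_factor :: "real \<Rightarrow> real"
  where "smoothed_growth_factor \<epsilon> = growth_factor * (1 + \<bar>c\<bar> * \<beta> + \<bar>c * (c - 1)\<bar> * \<beta>\<^sup>2 + \<bar>c\<bar> * \<beta> * (\<beta> + 2 / \<epsilon>))"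

lemma exp_bounded_of_le_F:
  fixes f :: "'m::finite process \<Rightarrow> real"
  assumes \<epsilon>: "0 \<le> \<epsilon>" "\<epsilon> \<le> 1" and le: "\<And>y. \<bar>f y\<bar> \<le> K * F \<epsilon> y" and K: "0 \<le> K" "growth_factor * K \<le> A"
  shows "exp_bounded Q A growth_rate f"
  unfolding exp_bounded_def
proof
  fix y :: "'m process"
  have "\<bar>f y\<bar> \<le> K * F \<epsilon> y" by (rule le)
  also have "\<dots> \<le> K * (growth_factor * exp (growth_rate * (\<Sum>q\<in>Q. \<bar>y q\<bar>)))"
    using F_exp_bounded[OF \<epsilon>] K(1) unfolding exp_bounded_def by (intro mult_left_mono) (auto simp: abs_le_iff)
  also have "\<dots> = growth_factor * K * exp (growth_rate * (\<Sum>q\<in>Q. \<bar>y q\<bar>))" by simp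
  also have "\<dots> \<le> A * exp (growth_rate * (\<Sum>q\<in>Q. \<bar>y q\<bar>))"
    using K(2) by (intro mult_right_mono) auto
  finally show "\<bar>f y\<bar> \<le> A * exp (growth_rate * (\<Sum>q\<in>Q. \<bar>y q\<bar>))" .
qed

lemma smoothed_growth_factor_bounds:
  assumes "\<epsilon> > 0"
  shows "smoothed_growth_factor \<epsilon> \<ge> 0" "growth_factor * 1 \<le> smoothed_growth_factor \<epsilon>" "growth_factor * (\<bar>c\<bar> * \<beta>) \<le> smoothed_growth_factor \<epsilon>"
    "growth_factor * (\<bar>c * (c - 1)\<bar> * \<beta>\<^sup>2 + \<bar>c\<bar> * \<beta> * (\<beta> + 2 / \<epsilon>)) \<le> smoothed_growth_factor \<epsilon>"
proof -
  have "0 \<le> \<bar>c\<bar> * \<beta>" "0 \<le> \<bar>c * (c - 1)\<bar> * \<beta>\<^sup>2" "0 \<le> \<bar>c\<bar> * \<beta> * (\<beta> + 2 / \<epsilon>)"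
    using \<beta> assms by auto
  thus "growth_factor * 1 \<le> smoothed_growth_factor \<epsilon>" "growth_factor * (\<bar>c\<bar> * \<beta>) \<le> smoothed_growth_factor \<epsilon>"
      "growth_factor * (\<bar>c * (c - 1)\<bar> * \<beta>\<^sup>2 + \<bar>c\<bar> * \<beta> * (\<beta> + 2 / \<epsilon>)) \<le> smoothed_growth_factor \<epsilon>"
    unfolding smoothed_growth_factor_def by (intro mult_left_mono[OF _ growth_factor_nonneg]; linarith)+
  thus "smoothed_growth_factor \<epsilon> \<ge> 0" using growth_factor_nonneg by linarith
qed

lemma F_exp_bounded':
  assumes \<epsilon>: "0 < \<epsilon>" "\<epsilon> \<le> 1" shows "exp_bounded Q (smoothed_growth_factor \<epsilon>) growth_rate (F \<epsilon> :: 'm::finite process \<Rightarrow> real)"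
  using \<epsilon> smoothed_growth_factor_bounds(2)[OF \<epsilon>(1)] by (intro exp_bounded_of_le_F[of \<epsilon> _ 1]) (auto simp: F_def)

lemma DF_exp_bounded:
  assumes \<epsilon>: "0 < \<epsilon>" "\<epsilon> \<le> 1" and q: "q \<in> Q"
  shows "exp_bounded Q (smoothed_growth_factor \<epsilon>) growth_rate (DF \<epsilon> q :: 'm::finite process \<Rightarrow> real)"
proof (rule exp_bounded_of_le_F[of \<epsilon> _ "\<bar>c\<bar> * \<beta>"])
  fix y :: "'m process"
  have "\<bar>DF \<epsilon> q y\<bar> = \<bar>c\<bar> * \<beta> * ((partition_function \<epsilon> y powr (c - 1) * weight \<epsilon> y (fst q)) * \<bar>slope \<epsilon> y (fst q) (snd q)\<bar>)"
    using \<beta> weight_pos[of \<epsilon> y "fst q"] by (simp add: DF_def abs_mult)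
  also have "\<dots> \<le> \<bar>c\<bar> * \<beta> * (F \<epsilon> y * 1)"
    using q \<beta> \<epsilon> by (intro mult_left_mono mult_mono powr_weight_le abs_slope_le) (auto simp: F_def)
  finally show "\<bar>DF \<epsilon> q y\<bar> \<le> \<bar>c\<bar> * \<beta> * F \<epsilon> y" by simp
qed (use \<epsilon> \<beta> smoothed_growth_factor_bounds(3)[OF \<epsilon>(1)] in auto)

lemma DDF_exp_bounded:
  assumes \<epsilon>: "0 < \<epsilon>" "\<epsilon> \<le> 1" and q: "q \<in> Q" "q' \<in> Q"
  shows "exp_bounded Q (smoothed_growth_factor \<epsilon>) growth_rate (DDF \<epsilon> q q' :: 'm::finite process \<Rightarrow> real)"
proof (rule exp_bounded_of_le_F[of \<epsilon> _ "\<bar>c * (c - 1)\<bar> * \<beta>\<^sup>2 + \<bar>c\<bar> * \<beta> * (\<beta> + 2 / \<epsilon>)"])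
  fix y :: "'m process"
  let ?Z = "partition_function \<epsilon> y" and ?w = "weight \<epsilon> y" and ?d = "slope \<epsilon> y (fst q) (snd q)" and ?d' = "slope \<epsilon> y (fst q') (snd q')"
  let ?k = "curvature \<epsilon> y (fst q) (snd q) (snd q')"
  have F: "F \<epsilon> y \<ge> 0" by (simp add: F_def)
  have d: "\<bar>?d\<bar> \<le> 1" "\<bar>?d'\<bar> \<le> 1" using \<epsilon> by (auto intro: abs_slope_le)
  have dd: "\<bar>?d * ?d'\<bar> \<le> 1" using mult_mono[OF d] by (simp add: abs_mult)
  have w: "0 \<le> ?w i" for i by (rule less_imp_le[OF weight_pos])
  have "\<bar>c * (c - 1) * \<beta>\<^sup>2 * ?Z powr (c - 2) * ?w (fst q) * ?w (fst q') * ?d * ?d'\<bar>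
      = \<bar>c * (c - 1)\<bar> * \<beta>\<^sup>2 * ((?Z powr (c - 2) * ?w (fst q) * ?w (fst q')) * \<bar>?d * ?d'\<bar>)"
    using w by (simp add: abs_mult)
  also have "\<dots> \<le> \<bar>c * (c - 1)\<bar> * \<beta>\<^sup>2 * (F \<epsilon> y * 1)"
    using q F by (intro mult_left_mono mult_mono powr_weight_weight_le dd) auto
  finally have 1: "\<bar>c * (c - 1) * \<beta>\<^sup>2 * ?Z powr (c - 2) * ?w (fst q) * ?w (fst q') * ?d * ?d'\<bar> \<le> \<bar>c * (c - 1)\<bar> * \<beta>\<^sup>2 * F \<epsilon> y"
    by simp
  have "\<bar>\<beta> * ?d * ?d' + ?k\<bar> \<le> \<bar>\<beta> * (?d * ?d')\<bar> + \<bar>?k\<bar>" by (simp add: mult.assoc abs_triangle_ineq)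
  also have "\<dots> \<le> \<beta> * 1 + 2 / \<epsilon>"
    unfolding abs_mult[of \<beta>] using \<beta> \<epsilon> by (intro add_mono mult_mono dd abs_curvature_le) auto
  finally have k: "\<bar>\<beta> * ?d * ?d' + ?k\<bar> \<le> \<beta> + 2 / \<epsilon>" by simp
  have "\<bar>c * \<beta> * ?Z powr (c - 1) * ?w (fst q) * (\<beta> * ?d * ?d' + ?k)\<bar>
      = \<bar>c\<bar> * \<beta> * (\<bar>\<beta> * ?d * ?d' + ?k\<bar> * (?Z powr (c - 1) * ?w (fst q)))"
    using w \<beta> by (simp add: abs_mult)
  also have "\<dots> \<le> \<bar>c\<bar> * \<beta> * ((\<beta> + 2 / \<epsilon>) * F \<epsilon> y)"
    using q w \<beta> \<epsilon> by (intro mult_left_mono mult_mono powr_weight_le k) auto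
  finally have 2: "\<bar>c * \<beta> * ?Z powr (c - 1) * ?w (fst q) * (\<beta> * ?d * ?d' + ?k)\<bar> \<le> \<bar>c\<bar> * \<beta> * (\<beta> + 2 / \<epsilon>) * F \<epsilon> y"
    by simp
  have 3: "0 \<le> \<bar>c\<bar> * \<beta> * (\<beta> + 2 / \<epsilon>) * F \<epsilon> y" using \<beta> \<epsilon> F by simp
  have "\<bar>DDF \<epsilon> q q' y\<bar> \<le> \<bar>c * (c - 1)\<bar> * \<beta>\<^sup>2 * F \<epsilon> y + \<bar>c\<bar> * \<beta> * (\<beta> + 2 / \<epsilon>) * F \<epsilon> y"
    unfolding DDF_def using 1 2 3 by (intro order_trans[OF abs_triangle_ineq add_mono]) auto
  thus "\<bar>DDF \<epsilon> q q' y\<bar> \<le> (\<bar>c * (c - 1)\<bar> * \<beta>\<^sup>2 + \<bar>c\<bar> * \<beta> * (\<beta> + 2 / \<epsilon>)) * F \<epsilon> y"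
    by (simp only: distrib_right)
qed (use \<epsilon> \<beta> smoothed_growth_factor_bounds(4)[OF \<epsilon>(1)] in auto)

end

section \<open>The interpolating process and its covariance\<close>

lemma UNIV_gaussian_index:
  "(UNIV :: ('m, 'n) gaussian_index set)
    = range (\<lambda>(i, j). Entry_G i j) \<union> (range Entry_u2 \<union> (range Entry_h \<union> {Entry_u4}))"
proof -
  have "k \<in> range (\<lambda>(i, j). Entry_G i j) \<union> (range Entry_u2 \<union> (range Entry_h \<union> {Entry_u4}))"
    for k :: "('m, 'n) gaussian_index"
    by (cases k) (auto simp: image_iff)
  thus ?thesis by blast
qed

instance gaussian_index :: (finite, finite) finite
  by standard (simp add: UNIV_gaussian_index)

lemma sum_gaussian_index:
  fixes f :: "('m::finite, 'n::finite) gaussian_index \<Rightarrow> real"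
  shows "(\<Sum>k\<in>UNIV. f k) = (\<Sum>i\<in>UNIV. \<Sum>j\<in>UNIV. f (Entry_G i j)) + (\<Sum>i\<in>UNIV. f (Entry_u2 i))
    + (\<Sum>j\<in>UNIV. f (Entry_h j)) + f Entry_u4"
proof -
  have "(\<Sum>k\<in>UNIV. f k) = (\<Sum>k\<in>range (\<lambda>(i, j). Entry_G i j). f k) + ((\<Sum>k\<in>range Entry_u2. f k)
      + ((\<Sum>k\<in>range Entry_h. f k) + (\<Sum>k\<in>{Entry_u4}. f k)))"
    unfolding UNIV_gaussian_index by ((subst sum.union_disjoint, simp, simp, force)+, rule refl)
  also have "(\<Sum>k\<in>range (\<lambda>(i, j). Entry_G i j). f k) = (\<Sum>i\<in>UNIV. \<Sum>j\<in>UNIV. f (Entry_G i j))"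
    by (subst sum.reindex) (auto simp: inj_on_def sum.cartesian_product case_prod_unfold)
  also have "(\<Sum>k\<in>range Entry_u2. f k) = (\<Sum>i\<in>UNIV. f (Entry_u2 i))"
    by (subst sum.reindex) (auto simp: inj_on_def)
  also have "(\<Sum>k\<in>range Entry_h. f k) = (\<Sum>j\<in>UNIV. f (Entry_h j))"
    by (subst sum.reindex) (auto simp: inj_on_def)
  finally show ?thesis by simp
qed

text \<open>
  \<open>coeff_one\<close> collects what is multiplied by \<open>sqrt t\<close> in the exponents of \<open>psi\<close>, namely \<open>G\<close> and \<open>u4\<close>;
  \<open>coeff_zero\<close> what is multiplied by \<open>sqrt (1 - t)\<close>, namely \<open>u2\<close> and \<open>h\<close>.
\<close>

fun coeff_one :: "(nat \<Rightarrow> real^'n) \<Rightarrow> nat \<times> 'm option \<Rightarrow> ('m, 'n) gaussian_index \<Rightarrow> real"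
  where "coeff_one x (i, Some a) (Entry_G b j) = (if a = b then x i $ j else 0)"
  | "coeff_one x (i, None) Entry_u4 = norm (x i)"
  | "coeff_one x _ _ = 0"

fun coeff_zero :: "(nat \<Rightarrow> real^'n) \<Rightarrow> nat \<times> 'm option \<Rightarrow> ('m, 'n) gaussian_index \<Rightarrow> real"
  where "coeff_zero x (i, Some a) (Entry_u2 b) = (if a = b then norm (x i) else 0)"
  | "coeff_zero x (i, None) (Entry_h j) = x i $ j"
  | "coeff_zero x _ _ = 0"

definition process :: "(nat \<Rightarrow> real^'n) \<Rightarrow> real \<Rightarrow> (('m::finite, 'n::finite) gaussian_index \<Rightarrow> real) \<Rightarrow> 'm process"
  where "process x = interpolant (coeff_one x) (coeff_zero x)"

lemma process_simps:
  "process x t g (i, Some a) = sqrt t * (\<Sum>j\<in>UNIV. x i $ j * g (Entry_G a j)) + sqrt (1 - t) * (norm (x i) * g (Entry_u2 a))"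
  "process x t g (i, None) = sqrt t * (norm (x i) * g Entry_u4) + sqrt (1 - t) * (\<Sum>j\<in>UNIV. x i $ j * g (Entry_h j))"
proof -
  have G: "(\<Sum>b\<in>UNIV. \<Sum>j\<in>UNIV. (if a = b then x i $ j else 0) * g (Entry_G b j))
      = (\<Sum>j\<in>UNIV. x i $ j * g (Entry_G a j))" for a
  proof -
    have "(\<Sum>b\<in>UNIV. \<Sum>j\<in>UNIV. (if a = b then x i $ j else 0) * g (Entry_G b j))
        = (\<Sum>b\<in>UNIV. if a = b then (\<Sum>j\<in>UNIV. x i $ j * g (Entry_G b j)) else 0)"
      by (intro sum.cong refl) simp
    thus ?thesis by simp
  qed
  have u2: "(\<Sum>b\<in>UNIV. (if a = b then norm (x i) else 0) * g (Entry_u2 b)) = norm (x i) * g (Entry_u2 a)" for a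
    by (simp add: if_distribR if_distrib[of "\<lambda>z. z * _"] cong: if_cong)
  show "process x t g (i, Some a) = sqrt t * (\<Sum>j\<in>UNIV. x i $ j * g (Entry_G a j)) + sqrt (1 - t) * (norm (x i) * g (Entry_u2 a))"
    by (simp add: process_def interpolant_def sum_gaussian_index G u2)
  show "process x t g (i, None) = sqrt t * (norm (x i) * g Entry_u4) + sqrt (1 - t) * (\<Sum>j\<in>UNIV. x i $ j * g (Entry_h j))"
    by (simp add: process_def interpolant_def sum_gaussian_index)
qed

lemma coeff_disjoint: "coeff_one x q k * coeff_zero x q' k = 0"
  by (cases "(x, q, k)" rule: coeff_one.cases; cases "(x, q', k)" rule: coeff_zero.cases) auto

text \<open>
  At \<open>t = 1\<close> equal entries of the vectors for \<open>i\<close> and \<open>j\<close> have covariance \<open>x i \<bullet> x j\<close>, at \<open>t = 0\<close> they have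
  covariance \<open>norm (x i) * norm (x j)\<close>; for the scalar parts the two roles are exchanged.  So a single
  number, with opposite signs, governs both, and it vanishes on the diagonal.
\<close>

definition covariance_gap :: "(nat \<Rightarrow> real^'n) \<Rightarrow> nat \<Rightarrow> nat \<Rightarrow> real"
  where "covariance_gap x i j = x i \<bullet> x j - norm (x i) * norm (x j)"

lemma covariance_gap_le_0: "covariance_gap x i j \<le> 0"
  using norm_cauchy_schwarz[of "x i" "x j"] by (simp add: covariance_gap_def)

lemma covariance_gap_self [simp]: "covariance_gap x i i = 0"
  by (simp add: covariance_gap_def dot_square_norm power2_eq_square)

lemma covariance_difference:
  fixes x :: "nat \<Rightarrow> real^'n" and \<alpha> \<alpha>' :: "'m::finite option"
  shows "(\<Sum>k\<in>UNIV. coeff_one x (i, \<alpha>) k * coeff_one x (j, \<alpha>') k - coeff_zero x (i, \<alpha>) k * coeff_zero x (j, \<alpha>') k)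
    = (case (\<alpha>, \<alpha>') of (Some a, Some b) \<Rightarrow> if a = b then covariance_gap x i j else 0
       | (None, None) \<Rightarrow> - covariance_gap x i j | _ \<Rightarrow> 0)"
proof -
  have "(\<Sum>b\<in>UNIV. \<Sum>k\<in>UNIV. (if a = b then x i $ k else 0) * (if a' = b then x j $ k else 0))
      = (if a = a' then x i \<bullet> x j else 0)" for a a' :: 'm
  proof -
    have "(\<Sum>b\<in>UNIV. \<Sum>k\<in>UNIV. (if a = b then x i $ k else 0) * (if a' = b then x j $ k else 0))
       = (\<Sum>b\<in>UNIV. if a = b then (if a = a' then x i \<bullet> x j else 0) else 0)"
      by (intro sum.cong refl) (auto simp: inner_vec_def)
    thus ?thesis by simp
  qed
  moreover have "(\<Sum>b\<in>UNIV. (if a = b then norm (x i) else 0) * (if a' = b then norm (x j) else 0))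
      = (if a = a' then norm (x i) * norm (x j) else 0)" for a a' :: 'm
  proof -
    have "(\<Sum>b\<in>UNIV. (if a = b then norm (x i) else 0) * (if a' = b then norm (x j) else 0))
       = (\<Sum>b\<in>UNIV. if a = b then (if a = a' then norm (x i) * norm (x j) else 0) else 0)"
      by (intro sum.cong refl) auto
    thus ?thesis by simp
  qed
  moreover have "(\<Sum>k\<in>UNIV. x i $ k * x j $ k) = x i \<bullet> x j" by (simp add: inner_vec_def)
  ultimately show ?thesis
    by (cases \<alpha>; cases \<alpha>') (auto simp: sum_subtractf sum_gaussian_index covariance_gap_def sum_negf)
qed

context power_of_partition_function
begin

text \<open>
  The fraction is the (smoothed) cosine of the angle between the vectors for \<open>i\<close> and \<open>j\<close>, and the term
  \<open>-1\<close> comes from the scalar parts.  At \<open>\<epsilon> = 0\<close> a vanishing vector gives the fraction the value 0.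
\<close>

definition alignment :: "real \<Rightarrow> 'm::finite process \<Rightarrow> nat \<Rightarrow> nat \<Rightarrow> real"
  where "alignment \<epsilon> y i j = partition_function \<epsilon> y powr (c - 2) * weight \<epsilon> y i * weight \<epsilon> y j *
    ((\<Sum>a\<in>UNIV. y (i, Some a) * y (j, Some a)) / (smoothed_norm \<epsilon> y i * smoothed_norm \<epsilon> y j) - 1)"

text \<open>
  The number of rows of \<open>G\<close> is visible in no other argument, hence the type argument.
\<close>

definition smoothed_psi :: "'m::finite itself \<Rightarrow> (nat \<Rightarrow> real^'n) \<Rightarrow> real \<Rightarrow> real \<Rightarrow> real"
  where "smoothed_psi _ x \<epsilon> t = (\<integral>g. F \<epsilon> (process x t g :: 'm process) \<partial>gaussian_product)"

definition smoothed_psi_slope :: "'m::finite itself \<Rightarrow> (nat \<Rightarrow> real^'n) \<Rightarrow> real \<Rightarrow> real \<Rightarrow> real"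
  where "smoothed_psi_slope _ x \<epsilon> t = c * (c - 1) * \<beta>\<^sup>2 / 2 *
    (\<Sum>i=1..l. \<Sum>j=1..l. covariance_gap x i j * (\<integral>g. alignment \<epsilon> (process x t g :: 'm process) i j \<partial>gaussian_product))"

text \<open>
  Gaussian interpolation for the smoothed integrand.  The covariance difference vanishes for \<open>i = j\<close>,
  which removes every term with a curvature; the terms with \<open>i \<noteq> j\<close> contain first derivatives of the
  norm only, and \<open>s\<close> enters through \<open>s * s = 1\<close>.  What is left stays bounded as \<open>\<epsilon> \<rightarrow> 0\<close>.
\<close>

lemma smoothed_psi_has_derivative:
  fixes x :: "nat \<Rightarrow> real^'n"
  assumes \<epsilon>: "0 < \<epsilon>" "\<epsilon> \<le> 1" and t: "0 < t" "t < 1"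
  shows "(smoothed_psi TYPE('m::finite) x \<epsilon> has_real_derivative smoothed_psi_slope TYPE('m) x \<epsilon> t) (at t)"
proof -
  let ?Y = "process x t :: _ \<Rightarrow> 'm process"
  let ?p = "coeff_one x :: nat \<times> 'm option \<Rightarrow> _" and ?r = "coeff_zero x :: nat \<times> 'm option \<Rightarrow> _"
  let ?E = "\<lambda>f. \<integral>g. f (?Y g) \<partial>gaussian_product"
  let ?C = "\<lambda>q q'. \<Sum>k\<in>UNIV. ?p q k * ?p q' k - ?r q k * ?r q' k"
  have fin: "finite (Q :: (nat \<times> 'm option) set)" by simp
  have int: "integrable gaussian_product (\<lambda>g. DDF \<epsilon> q q' (?Y g))" if "q \<in> Q" "q' \<in> Q" for q q'
    unfolding process_def using t
    by (intro integrable_interpolant[OF fin _ DDF_exp_bounded[OF \<epsilon> that]] smoothed_growth_factor_bounds(1) \<epsilon> growth_rate_nonneg continuous_on_DDF) auto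
  have "(smoothed_psi TYPE('m) x \<epsilon> has_real_derivative (1/2) * (\<Sum>q\<in>Q. \<Sum>q'\<in>Q. ?C q q' * ?E (DDF \<epsilon> q q'))) (at t)"
    unfolding smoothed_psi_def process_def
    by (rule gaussian_interpolation[OF fin t, where A = "smoothed_growth_factor \<epsilon>" and B = growth_rate and DF = "DF \<epsilon>" and DDF = "DDF \<epsilon>"])
      (intro coeff_disjoint F_has_partial_derivatives DF_has_partial_derivatives continuous_on_F continuous_on_DF
        continuous_on_DDF smoothed_growth_factor_bounds(1) growth_rate_nonneg F_exp_bounded' DF_exp_bounded DDF_exp_bounded \<epsilon>; assumption)+
  also have "(1/2) * (\<Sum>q\<in>Q. \<Sum>q'\<in>Q. ?C q q' * ?E (DDF \<epsilon> q q'))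
      = (1/2) * (\<Sum>i=1..l. \<Sum>\<alpha>\<in>UNIV. \<Sum>j=1..l. \<Sum>\<alpha>'\<in>UNIV. ?C (i, \<alpha>) (j, \<alpha>') * ?E (DDF \<epsilon> (i, \<alpha>) (j, \<alpha>')))"
    by (simp only: sum.cartesian_product' fst_conv snd_conv)
  also have "\<dots> = (1/2) * (\<Sum>i=1..l. \<Sum>j=1..l. \<Sum>\<alpha>\<in>UNIV. \<Sum>\<alpha>'\<in>UNIV. ?C (i, \<alpha>) (j, \<alpha>') * ?E (DDF \<epsilon> (i, \<alpha>) (j, \<alpha>')))"
    by (intro arg_cong[of _ _ "\<lambda>z. (1/2) * z"] sum.cong refl sum.swap)
  also have "\<dots> = (1/2) * (\<Sum>i=1..l. \<Sum>j=1..l. c * (c - 1) * \<beta>\<^sup>2 * covariance_gap x i j * ?E (\<lambda>y. alignment \<epsilon> y i j))"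
  proof (intro arg_cong[of _ _ "\<lambda>z. (1/2) * z"] sum.cong refl)
    fix i j assume ij: "i \<in> {1..l}" "j \<in> {1..l}"
    have "(\<Sum>\<alpha>\<in>UNIV. \<Sum>\<alpha>'\<in>UNIV. ?C (i, \<alpha>) (j, \<alpha>') * ?E (DDF \<epsilon> (i, \<alpha>) (j, \<alpha>')))
        = - covariance_gap x i j * ?E (DDF \<epsilon> (i, None) (j, None))
          + (\<Sum>a\<in>UNIV. \<Sum>b\<in>UNIV. (if a = b then covariance_gap x i j else 0) * ?E (DDF \<epsilon> (i, Some a) (j, Some b)))"
      by (simp add: covariance_difference sum_UNIV_option)
    also have "(\<Sum>a\<in>UNIV. \<Sum>b\<in>UNIV. (if a = b then covariance_gap x i j else 0) * ?E (DDF \<epsilon> (i, Some a) (j, Some b)))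
        = (\<Sum>a\<in>UNIV. covariance_gap x i j * ?E (DDF \<epsilon> (i, Some a) (j, Some a)))"
      by (simp add: if_distribR if_distrib[of "\<lambda>z. z * _"] cong: if_cong)
    also have "- covariance_gap x i j * ?E (DDF \<epsilon> (i, None) (j, None)) + (\<Sum>a\<in>UNIV. covariance_gap x i j * ?E (DDF \<epsilon> (i, Some a) (j, Some a)))
        = covariance_gap x i j * ((\<Sum>a\<in>UNIV. ?E (DDF \<epsilon> (i, Some a) (j, Some a))) - ?E (DDF \<epsilon> (i, None) (j, None)))"
      by (simp add: sum_distrib_left right_diff_distrib)
    also have "\<dots> = covariance_gap x i j * ?E (\<lambda>y. (\<Sum>a\<in>UNIV. DDF \<epsilon> (i, Some a) (j, Some a) y) - DDF \<epsilon> (i, None) (j, None) y)"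
    proof -
      have "?E (\<lambda>y. (\<Sum>a\<in>UNIV. DDF \<epsilon> (i, Some a) (j, Some a) y) - DDF \<epsilon> (i, None) (j, None) y)
          = ?E (\<lambda>y. \<Sum>a\<in>UNIV. DDF \<epsilon> (i, Some a) (j, Some a) y) - ?E (DDF \<epsilon> (i, None) (j, None))"
        using ij by (intro Bochner_Integration.integral_diff Bochner_Integration.integrable_sum int) auto
      also have "?E (\<lambda>y. \<Sum>a\<in>UNIV. DDF \<epsilon> (i, Some a) (j, Some a) y) = (\<Sum>a\<in>UNIV. ?E (DDF \<epsilon> (i, Some a) (j, Some a)))"
        using ij by (intro Bochner_Integration.integral_sum int) auto
      finally show ?thesis by simp
    qed
    also have "\<dots> = covariance_gap x i j * ?E (\<lambda>y. c * (c - 1) * \<beta>\<^sup>2 * alignment \<epsilon> y i j)"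
    proof (cases "i = j")
      case False
      have ss: "s * s = 1" using s by auto
      have "(\<Sum>a\<in>UNIV. DDF \<epsilon> (i, Some a) (j, Some a) y) - DDF \<epsilon> (i, None) (j, None) y
          = c * (c - 1) * \<beta>\<^sup>2 * alignment \<epsilon> y i j" for y :: "'m process"
      proof -
        define K where "K = c * (c - 1) * \<beta>\<^sup>2 * partition_function \<epsilon> y powr (c - 2) * weight \<epsilon> y i * weight \<epsilon> y j"
        have "DDF \<epsilon> (i, Some a) (j, Some a) y = K * ((y (i, Some a) * y (j, Some a)) / (smoothed_norm \<epsilon> y i * smoothed_norm \<epsilon> y j))" for a
        proof -
          have "DDF \<epsilon> (i, Some a) (j, Some a) y = K * ((s * s) * (y (i, Some a) * y (j, Some a)) / (smoothed_norm \<epsilon> y i * smoothed_norm \<epsilon> y j))"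
            using False by (simp add: DDF_def K_def mult_ac)
          thus ?thesis by (simp add: ss)
        qed
        moreover have "DDF \<epsilon> (i, None) (j, None) y = K"
          using False by (simp add: DDF_def K_def)
        moreover have "c * (c - 1) * \<beta>\<^sup>2 * alignment \<epsilon> y i j
            = K * ((\<Sum>a\<in>UNIV. y (i, Some a) * y (j, Some a)) / (smoothed_norm \<epsilon> y i * smoothed_norm \<epsilon> y j) - 1)"
          by (simp only: alignment_def K_def mult.assoc)
        ultimately show ?thesis
          by (simp add: sum_distrib_left[symmetric] sum_divide_distrib[symmetric] right_diff_distrib)
      qed
      thus ?thesis by simp
    qed simp
    finally show "(\<Sum>\<alpha>\<in>UNIV. \<Sum>\<alpha>'\<in>UNIV. ?C (i, \<alpha>) (j, \<alpha>') * ?E (DDF \<epsilon> (i, \<alpha>) (j, \<alpha>')))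
      = c * (c - 1) * \<beta>\<^sup>2 * covariance_gap x i j * ?E (\<lambda>y. alignment \<epsilon> y i j)"
      by simp
  qed
  also have "\<dots> = smoothed_psi_slope TYPE('m) x \<epsilon> t"
    by (simp add: smoothed_psi_slope_def sum_distrib_left mult_ac)
  finally show ?thesis .
qed

end

section \<open>Removing the smoothing\<close>

lemma process_tendsto:
  assumes "(\<tau> \<longlongrightarrow> t) net"
  shows "((\<lambda>n. process x (\<tau> n) g q) \<longlongrightarrow> process x t g q) net"
  unfolding process_def interpolant_def by (intro tendsto_intros assms)

lemma continuous_on_process: "continuous_on UNIV (process x t)"
  unfolding process_def by (rule continuous_on_interpolant)

text \<open>
  For \<open>t < 1\<close> the entry of \<open>u2\<close> has a nonzero coefficient, for \<open>t = 1\<close> some entry of \<open>G\<close> has.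
\<close>

lemma AE_process_nonzero:
  fixes x :: "nat \<Rightarrow> real^'n" and a :: "'m::finite"
  assumes "x i \<noteq> 0" "t \<in> {0..1}"
  shows "AE g in gaussian_product. process x t g (i, Some a) \<noteq> 0"
proof -
  define w where "w k = sqrt t * coeff_one x (i, Some a) k + sqrt (1 - t) * coeff_zero x (i, Some a) k"
    for k :: "('m, 'n) gaussian_index"
  have "\<exists>k. w k \<noteq> 0"
  proof (cases "t = 1")
    case True
    obtain j where "x i $ j \<noteq> 0" using assms(1) by (auto simp: vec_eq_iff)
    hence "w (Entry_G a j) \<noteq> 0" using True by (simp add: w_def)
    thus ?thesis ..
  next
    case False
    hence "w (Entry_u2 a) \<noteq> 0" using assms by (simp add: w_def)
    thus ?thesis ..
  qed
  then obtain k where "w k \<noteq> 0" ..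
  from AE_gaussian_product_linear_nonzero[where c = w, OF this] show ?thesis
    by (simp add: process_def interpolant_def w_def sum.distrib sum_distrib_left distrib_right mult.assoc)
qed

context power_of_partition_function
begin

lemma smoothed_norm_tendsto:
  assumes "(\<epsilon>' \<longlongrightarrow> \<epsilon>) net" "\<And>q. ((\<lambda>n. y' n q) \<longlongrightarrow> y q) net"
  shows "((\<lambda>n. smoothed_norm (\<epsilon>' n) (y' n) i) \<longlongrightarrow> smoothed_norm \<epsilon> y i) net"
  unfolding smoothed_norm_def by (intro tendsto_intros assms)

lemma weight_tendsto:
  assumes "(\<epsilon>' \<longlongrightarrow> \<epsilon>) net" "\<And>q. ((\<lambda>n. y' n q) \<longlongrightarrow> y q) net"
  shows "((\<lambda>n. weight (\<epsilon>' n) (y' n) i) \<longlongrightarrow> weight \<epsilon> y i) net"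
  unfolding weight_def by (intro tendsto_intros smoothed_norm_tendsto assms)

lemma partition_function_powr_tendsto:
  assumes "(\<epsilon>' \<longlongrightarrow> \<epsilon>) net" "\<And>q. ((\<lambda>n. y' n q) \<longlongrightarrow> y q) net"
  shows "((\<lambda>n. partition_function (\<epsilon>' n) (y' n) powr e) \<longlongrightarrow> partition_function \<epsilon> y powr e) net"
proof (rule tendsto_powr[OF _ tendsto_const])
  show "((\<lambda>n. partition_function (\<epsilon>' n) (y' n)) \<longlongrightarrow> partition_function \<epsilon> y) net"
    unfolding partition_function_def by (intro tendsto_intros weight_tendsto assms)
  show "partition_function \<epsilon> y \<noteq> 0" using partition_function_pos[of \<epsilon> y] by simp
qed

lemma alignment_tendsto:
  assumes "(\<epsilon>' \<longlongrightarrow> \<epsilon>) net" "\<And>q. ((\<lambda>n. y' n q) \<longlongrightarrow> y q) net"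
    and "smoothed_norm \<epsilon> y i \<noteq> 0" "smoothed_norm \<epsilon> y j \<noteq> 0"
  shows "((\<lambda>n. alignment (\<epsilon>' n) (y' n) i j) \<longlongrightarrow> alignment \<epsilon> y i j) net"
  unfolding alignment_def
  by (intro tendsto_intros partition_function_powr_tendsto weight_tendsto smoothed_norm_tendsto assms) (use assms in auto)

lemma abs_overlap_le: "\<bar>\<Sum>a\<in>UNIV. y (i, Some a) * y (j, Some a)\<bar> \<le> smoothed_norm \<epsilon> y i * smoothed_norm \<epsilon> y j"
proof -
  have L: "L2_set (\<lambda>a. y (i, Some a)) UNIV \<le> smoothed_norm \<epsilon> y i" for i
    unfolding smoothed_norm_def L2_set_def by simp
  have "\<bar>\<Sum>a\<in>UNIV. y (i, Some a) * y (j, Some a)\<bar> \<le> (\<Sum>a\<in>UNIV. \<bar>y (i, Some a)\<bar> * \<bar>y (j, Some a)\<bar>)"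
    by (rule order_trans[OF sum_abs]) (simp add: abs_mult)
  also have "\<dots> \<le> L2_set (\<lambda>a. y (i, Some a)) UNIV * L2_set (\<lambda>a. y (j, Some a)) UNIV"
    by (rule L2_set_mult_ineq)
  also have "\<dots> \<le> smoothed_norm \<epsilon> y i * smoothed_norm \<epsilon> y j"
    by (intro mult_mono L smoothed_norm_nonneg L2_set_nonneg)
  finally show ?thesis .
qed

lemma abs_cosine_le: "\<bar>(\<Sum>a\<in>UNIV. y (i, Some a) * y (j, Some a)) / (smoothed_norm \<epsilon> y i * smoothed_norm \<epsilon> y j)\<bar> \<le> 1"
  using abs_overlap_le[of y i j \<epsilon>] smoothed_norm_nonneg[of \<epsilon> y i] smoothed_norm_nonneg[of \<epsilon> y j]
  by (auto simp: abs_mult divide_simps mult_nonneg_nonneg)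

lemma alignment_le_0: "alignment \<epsilon> y i j \<le> 0"
proof -
  have "(\<Sum>a\<in>UNIV. y (i, Some a) * y (j, Some a)) / (smoothed_norm \<epsilon> y i * smoothed_norm \<epsilon> y j) - 1 \<le> 0"
    using abs_cosine_le[of y i j \<epsilon>] by linarith
  thus ?thesis
    unfolding alignment_def
    by (intro mult_nonneg_nonpos mult_nonneg_nonneg) (auto intro: less_imp_le weight_pos)
qed

lemma abs_alignment_le:
  assumes "i \<in> {1..l}" "j \<in> {1..l}"
  shows "\<bar>alignment \<epsilon> y i j\<bar> \<le> 2 * F \<epsilon> y"
proof -
  let ?c = "(\<Sum>a\<in>UNIV. y (i, Some a) * y (j, Some a)) / (smoothed_norm \<epsilon> y i * smoothed_norm \<epsilon> y j) - 1"
  have "\<bar>alignment \<epsilon> y i j\<bar> = (partition_function \<epsilon> y powr (c - 2) * weight \<epsilon> y i * weight \<epsilon> y j) * \<bar>?c\<bar>"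
    using weight_pos[of \<epsilon> y i] weight_pos[of \<epsilon> y j] by (simp add: alignment_def abs_mult)
  also have "\<dots> \<le> F \<epsilon> y * 2"
  proof (intro mult_mono powr_weight_weight_le assms)
    show "\<bar>?c\<bar> \<le> 2" using abs_cosine_le[of y i j \<epsilon>] by linarith
  qed (auto simp: F_def)
  finally show ?thesis by simp
qed

definition envelope :: "'m::finite itself \<Rightarrow> (nat \<Rightarrow> real^'n) \<Rightarrow> (('m, 'n) gaussian_index \<Rightarrow> real) \<Rightarrow> real"
  where "envelope m x g = growth_factor * exp (growth_rate * coefficient_sum (coeff_one x) (coeff_zero x) (Q :: (nat \<times> 'm option) set) * (\<Sum>k\<in>UNIV. \<bar>g k\<bar>))"

lemma integrable_envelope: "integrable gaussian_product (envelope m x)"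
  unfolding envelope_def by (intro integrable_mult_right integrable_gaussian_product_exp)

lemma F_process_le_envelope:
  fixes g :: "('m::finite, 'n::finite) gaussian_index \<Rightarrow> real"
  assumes "\<epsilon> \<in> {0..1}" "t \<in> {0..1}"
  shows "\<bar>F \<epsilon> (process x t g)\<bar> \<le> envelope TYPE('m) x g"
  unfolding process_def envelope_def
  using assms by (intro exp_bounded_interpolant F_exp_bounded growth_factor_nonneg growth_rate_nonneg) auto

lemma borel_measurable_F_process: "(\<lambda>g. F \<epsilon> (process x t g)) \<in> borel_measurable gaussian_product"
proof -
  have "(\<lambda>g. F \<epsilon> (process x t g)) \<in> borel_measurable borel"
    by (intro borel_measurable_continuous_onI continuous_on_compose2[OF continuous_on_F continuous_on_process] subset_UNIV)
  thus ?thesis by measurable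
qed

lemma borel_measurable_alignment_process:
  "(\<lambda>g. alignment \<epsilon> (process x t g) i j) \<in> borel_measurable gaussian_product"
proof -
  have "(\<lambda>g. alignment \<epsilon> (process x t g) i j) \<in> borel_measurable borel"
    unfolding alignment_def
    by (intro borel_measurable_times borel_measurable_diff borel_measurable_divide borel_measurable_sum
        borel_measurable_const borel_measurable_continuous_onI[OF continuous_on_compose2[OF _ continuous_on_process subset_UNIV]]
        continuous_on_partition_function_powr continuous_on_weight continuous_on_smoothed_norm continuous_on_coordinate)
  thus ?thesis by measurable
qed

lemma alignment_process_le_envelope:
  fixes g :: "('m::finite, 'n::finite) gaussian_index \<Rightarrow> real"
  assumes "\<epsilon> \<in> {0..1}" "t \<in> {0..1}" "i \<in> {1..l}" "j \<in> {1..l}"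
  shows "\<bar>alignment \<epsilon> (process x t g) i j\<bar> \<le> 2 * envelope TYPE('m) x g"
  using abs_alignment_le[OF assms(3,4), of \<epsilon> "process x t g"] F_process_le_envelope[OF assms(1,2), of x g]
  by linarith

lemma integrable_alignment_process:
  assumes "\<epsilon> \<in> {0..1}" "t \<in> {0..1}" "i \<in> {1..l}" "j \<in> {1..l}"
  shows "integrable gaussian_product (\<lambda>g. alignment \<epsilon> (process x t g :: 'm::finite process) i j)"
proof (rule Bochner_Integration.integrable_bound)
  show "integrable gaussian_product (\<lambda>g. 2 * envelope TYPE('m) x g)"
    by (intro integrable_mult_right integrable_envelope)
  show "AE g in gaussian_product. norm (alignment \<epsilon> (process x t g :: 'm process) i j) \<le> norm (2 * envelope TYPE('m) x g)"
    unfolding real_norm_def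
    by (intro AE_I2 order_trans[OF alignment_process_le_envelope[OF assms] abs_ge_self])
qed (rule borel_measurable_alignment_process)

lemma integral_alignment_nonpos: "(\<integral>g. alignment \<epsilon> (process x t g) i j \<partial>gaussian_product) \<le> 0"
proof -
  have "0 \<le> (\<integral>g. - alignment \<epsilon> (process x t g) i j \<partial>gaussian_product)"
    by (intro Bochner_Integration.integral_nonneg) (simp add: alignment_le_0)
  thus ?thesis by simp
qed

lemma smoothed_psi_tendsto:
  fixes x :: "nat \<Rightarrow> real^'n"
  assumes "\<And>n. \<epsilon>' n \<in> {0..1}" "\<epsilon>' \<longlonglongrightarrow> \<epsilon>" "\<And>n. \<tau> n \<in> {0..1}" "\<tau> \<longlonglongrightarrow> t"
  shows "(\<lambda>n. smoothed_psi TYPE('m::finite) x (\<epsilon>' n) (\<tau> n)) \<longlonglongrightarrow> smoothed_psi TYPE('m) x \<epsilon> t"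
  unfolding smoothed_psi_def
proof (rule integral_dominated_convergence[OF borel_measurable_F_process borel_measurable_F_process
      integrable_envelope[of "TYPE('m)" x]])
  show "AE g in gaussian_product. (\<lambda>n. F (\<epsilon>' n) (process x (\<tau> n) g :: 'm process)) \<longlonglongrightarrow> F \<epsilon> (process x t g)"
    unfolding F_def by (intro AE_I2 partition_function_powr_tendsto process_tendsto assms)
  show "AE g in gaussian_product. norm (F (\<epsilon>' n) (process x (\<tau> n) g :: 'm process)) \<le> envelope TYPE('m) x g" for n
    using F_process_le_envelope[OF assms(1,3)] by (intro AE_I2) simp
qed

text \<open>
  The sequence \<open>\<epsilon>'\<close> may be constantly 0, so this also states that the limiting slope is continuous
  in \<open>t\<close>.  The integrand converges wherever the two vectors are nonzero, that is almost surely: if one of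
  the points is 0, then the covariance gap is 0 and the term is absent.
\<close>

lemma smoothed_psi_slope_tendsto:
  fixes x :: "nat \<Rightarrow> real^'n"
  assumes \<epsilon>: "\<And>n. \<epsilon>' n \<in> {0..1}" "\<epsilon>' \<longlonglongrightarrow> 0" and \<tau>: "\<And>n. \<tau> n \<in> {0..1}" "\<tau> \<longlonglongrightarrow> t"
  shows "(\<lambda>n. smoothed_psi_slope TYPE('m::finite) x (\<epsilon>' n) (\<tau> n)) \<longlonglongrightarrow> smoothed_psi_slope TYPE('m) x 0 t"
  unfolding smoothed_psi_slope_def
proof (rule tendsto_mult[OF tendsto_const], rule tendsto_sum, rule tendsto_sum)
  fix i j assume ij: "i \<in> {1..l}" "j \<in> {1..l}"
  have t: "t \<in> {0..1}"
    using \<tau>(1) by (intro closed_sequentially[OF _ _ \<tau>(2)]) auto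
  show "(\<lambda>n. covariance_gap x i j * (\<integral>g. alignment (\<epsilon>' n) (process x (\<tau> n) g :: 'm process) i j \<partial>gaussian_product))
    \<longlonglongrightarrow> covariance_gap x i j * (\<integral>g. alignment 0 (process x t g :: 'm process) i j \<partial>gaussian_product)"
  proof (cases "covariance_gap x i j = 0")
    case False
    hence nz: "x i \<noteq> 0" "x j \<noteq> 0" by (auto simp: covariance_gap_def)
    have "AE g in gaussian_product. smoothed_norm 0 (process x t g :: 'm process) i \<noteq> 0" if "x i \<noteq> 0" for i
      using AE_process_nonzero[where x = x and i = i and t = t and a = undefined, OF that t]
    proof eventually_elim
      case (elim g)
      thus ?case using coordinate_le_smoothed_norm[of "process x t g" i undefined 0] by auto
    qed
    from this[OF nz(1)] this[OF nz(2)]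
    have "AE g in gaussian_product. (\<lambda>n. alignment (\<epsilon>' n) (process x (\<tau> n) g :: 'm process) i j) \<longlonglongrightarrow> alignment 0 (process x t g) i j"
    proof eventually_elim
      case (elim g)
      thus ?case by (intro alignment_tendsto process_tendsto \<epsilon> \<tau>)
    qed
    moreover have "AE g in gaussian_product. norm (alignment (\<epsilon>' n) (process x (\<tau> n) g :: 'm process) i j) \<le> 2 * envelope TYPE('m) x g" for n
      using alignment_process_le_envelope[OF \<epsilon>(1) \<tau>(1) ij] by (intro AE_I2) simp
    ultimately show ?thesis
      by (intro tendsto_intros integral_dominated_convergence[OF borel_measurable_alignment_process borel_measurable_alignment_process
          integrable_mult_right[OF integrable_envelope[of "TYPE('m)" x], of 2]])
  qed simp
qed

lemma smoothed_psi_slope_bounded: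
  fixes x :: "nat \<Rightarrow> real^'n"
  obtains K where "\<And>\<epsilon> t. \<epsilon> \<in> {0..1} \<Longrightarrow> t \<in> {0..1} \<Longrightarrow> \<bar>smoothed_psi_slope TYPE('m::finite) x \<epsilon> t\<bar> \<le> K"
proof
  define E where "E = (\<integral>g. 2 * envelope TYPE('m) x g \<partial>gaussian_product)"
  fix \<epsilon> t :: real assume \<epsilon>t: "\<epsilon> \<in> {0..1}" "t \<in> {0..1}"
  have "\<bar>\<integral>g. alignment \<epsilon> (process x t g :: 'm process) i j \<partial>gaussian_product\<bar> \<le> E"
    if ij: "i \<in> {1..l}" "j \<in> {1..l}" for i j
  proof -
    have "\<bar>\<integral>g. alignment \<epsilon> (process x t g :: 'm process) i j \<partial>gaussian_product\<bar>
        \<le> (\<integral>g. \<bar>alignment \<epsilon> (process x t g :: 'm process) i j\<bar> \<partial>gaussian_product)"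
      by (rule integral_abs_bound)
    also have "\<dots> \<le> E" unfolding E_def
      by (intro integral_mono integrable_abs integrable_alignment_process \<epsilon>t ij integrable_mult_right
          integrable_envelope alignment_process_le_envelope)
    finally show ?thesis .
  qed
  hence "\<bar>\<Sum>i=1..l. \<Sum>j=1..l. covariance_gap x i j * (\<integral>g. alignment \<epsilon> (process x t g :: 'm process) i j \<partial>gaussian_product)\<bar>
      \<le> (\<Sum>i=1..l. \<Sum>j=1..l. \<bar>covariance_gap x i j\<bar> * E)"
    by (intro order_trans[OF sum_abs] sum_mono) (auto simp: abs_mult intro!: mult_left_mono)
  thus "\<bar>smoothed_psi_slope TYPE('m) x \<epsilon> t\<bar> \<le> \<bar>c * (c - 1) * \<beta>\<^sup>2 / 2\<bar> * (\<Sum>i=1..l. \<Sum>j=1..l. \<bar>covariance_gap x i j\<bar> * E)"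
    unfolding smoothed_psi_slope_def abs_mult by (rule mult_left_mono) auto
qed

text \<open>
  The fundamental theorem of calculus for \<open>\<epsilon> = 1 / (n + 1)\<close>, where the derivative is known in the
  open interval, and then the limit on both sides.
\<close>

lemma smoothed_psi_0_eq_integral:
  fixes x :: "nat \<Rightarrow> real^'n"
  assumes t: "t \<in> {0..1}"
  shows "smoothed_psi TYPE('m::finite) x 0 t = smoothed_psi TYPE('m) x 0 0 + integral {0..t} (smoothed_psi_slope TYPE('m) x 0)"
proof -
  define e where "e n = inverse (real (Suc n))" for n
  have e: "0 < e n" "e n \<le> 1" for n by (auto simp: e_def field_simps)
  have e01: "e n \<in> {0..1}" for n using e[of n] by simp
  have e0: "e \<longlonglongrightarrow> 0" unfolding e_def by (rule LIMSEQ_inverse_real_of_nat)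
  have int: "(smoothed_psi_slope TYPE('m) x (e n) has_integral (smoothed_psi TYPE('m) x (e n) t - smoothed_psi TYPE('m) x (e n) 0)) {0..t}" for n
  proof (rule fundamental_theorem_of_calculus_interior)
    show "continuous_on {0..t} (smoothed_psi TYPE('m) x (e n))"
    proof (rule continuous_on_sequentiallyI)
      fix u a assume u: "\<forall>k. u k \<in> {0..t}" "a \<in> {0..t}" "u \<longlonglongrightarrow> a"
      show "(\<lambda>k. smoothed_psi TYPE('m) x (e n) (u k)) \<longlonglongrightarrow> smoothed_psi TYPE('m) x (e n) a"
        using u t e01 by (intro smoothed_psi_tendsto) (auto intro: order_trans)
    qed
    show "(smoothed_psi TYPE('m) x (e n) has_vector_derivative smoothed_psi_slope TYPE('m) x (e n) u) (at u)" if "u \<in> {0<..<t}" for u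
      using smoothed_psi_has_derivative[OF e, of u] that t by (simp add: has_real_derivative_iff_has_vector_derivative)
  qed (use t in auto)
  obtain K where K: "\<And>\<epsilon> t. \<epsilon> \<in> {0..1} \<Longrightarrow> t \<in> {0..1} \<Longrightarrow> \<bar>smoothed_psi_slope TYPE('m::finite) x \<epsilon> t\<bar> \<le> K"
    using smoothed_psi_slope_bounded by blast
  have "(\<lambda>n. integral {0..t} (smoothed_psi_slope TYPE('m) x (e n))) \<longlonglongrightarrow> integral {0..t} (smoothed_psi_slope TYPE('m) x 0)"
  proof (rule dominated_convergence)
    show "smoothed_psi_slope TYPE('m) x (e n) integrable_on {0..t}" for n using int by blast
    show "(\<lambda>_. K) integrable_on {0..t}"
      by (intro integrable_continuous_real continuous_on_const)
    show "norm (smoothed_psi_slope TYPE('m) x (e n) u) \<le> K" if "u \<in> {0..t}" for n u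
      using K[OF e01, of u] that t by simp
    show "(\<lambda>n. smoothed_psi_slope TYPE('m) x (e n) u) \<longlonglongrightarrow> smoothed_psi_slope TYPE('m) x 0 u" if "u \<in> {0..t}" for u
      using that t by (intro smoothed_psi_slope_tendsto e01 e0) auto
  qed
  hence "(\<lambda>n. smoothed_psi TYPE('m) x (e n) t - smoothed_psi TYPE('m) x (e n) 0) \<longlonglongrightarrow> integral {0..t} (smoothed_psi_slope TYPE('m) x 0)"
    using integral_unique[OF int] by simp
  moreover have "(\<lambda>n. smoothed_psi TYPE('m) x (e n) t - smoothed_psi TYPE('m) x (e n) 0) \<longlonglongrightarrow> smoothed_psi TYPE('m) x 0 t - smoothed_psi TYPE('m) x 0 0"
    using t by (intro tendsto_diff smoothed_psi_tendsto e01 e0) auto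
  ultimately show ?thesis
    using LIMSEQ_unique by fastforce
qed

text \<open>
  Passing through the integral yields the derivative also at the endpoints, where the square roots
  are not differentiable.
\<close>

theorem smoothed_psi_0_has_derivative:
  fixes x :: "nat \<Rightarrow> real^'n"
  assumes t: "t \<in> {0..1}"
  shows "(smoothed_psi TYPE('m::finite) x 0 has_real_derivative smoothed_psi_slope TYPE('m) x 0 t) (at t within {0..1})"
proof -
  have "continuous_on {0..1} (smoothed_psi_slope TYPE('m) x 0)"
  proof (rule continuous_on_sequentiallyI)
    fix u a assume "\<forall>k. u k \<in> {0..1::real}" "a \<in> {0..1}" "u \<longlonglongrightarrow> a"
    thus "(\<lambda>k. smoothed_psi_slope TYPE('m) x 0 (u k)) \<longlonglongrightarrow> smoothed_psi_slope TYPE('m) x 0 a"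
      by (intro smoothed_psi_slope_tendsto) auto
  qed
  hence "((\<lambda>t. smoothed_psi TYPE('m) x 0 0 + integral {0..t} (smoothed_psi_slope TYPE('m) x 0)) has_real_derivative smoothed_psi_slope TYPE('m) x 0 t) (at t within {0..1})"
    using t by (auto intro!: derivative_eq_intros integral_has_real_derivative)
  thus ?thesis
    by (rule has_field_derivative_transform_within[OF _ zero_less_one t])
      (rule smoothed_psi_0_eq_integral[symmetric])
qed

text \<open>
  For \<open>t > 0\<close> the inner product of the two vectors is negative on a nonempty open set of Gaussian
  values, and open sets have positive mass.
\<close>

lemma integral_alignment_neg:
  fixes x :: "nat \<Rightarrow> real^'n"
  assumes covariance_gap: "covariance_gap x i j < 0" and ij: "i \<in> {1..l}" "j \<in> {1..l}" and t: "0 < t" "t \<le> 1"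
  shows "(\<integral>g. alignment 0 (process x t g :: 'm::finite process) i j \<partial>gaussian_product) < 0"
proof -
  let ?Y = "process x t :: _ \<Rightarrow> 'm process"
  let ?A = "\<lambda>g. alignment 0 (?Y g) i j"
  define U where "U = {g. (\<Sum>a\<in>UNIV. ?Y g (i, Some a) * ?Y g (j, Some a)) < 0}"
  have nz: "x i \<noteq> 0" "x j \<noteq> 0" using covariance_gap by (auto simp: covariance_gap_def)
  have neg: "?A g < 0" if "g \<in> U" for g
  proof -
    have "(\<Sum>a\<in>UNIV. ?Y g (i, Some a) * ?Y g (j, Some a)) / (smoothed_norm 0 (?Y g) i * smoothed_norm 0 (?Y g) j) \<le> 0"
      using that smoothed_norm_nonneg unfolding U_def by (intro divide_nonpos_nonneg mult_nonneg_nonneg) auto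
    hence "(\<Sum>a\<in>UNIV. ?Y g (i, Some a) * ?Y g (j, Some a)) / (smoothed_norm 0 (?Y g) i * smoothed_norm 0 (?Y g) j) - 1 < 0" by linarith
    thus ?thesis unfolding alignment_def
      using partition_function_pos[of 0 "?Y g"] weight_pos[of 0 "?Y g"] by (intro mult_pos_neg mult_pos_pos) auto
  qed
  have "open U" unfolding U_def
    by (intro open_Collect_less continuous_intros continuous_on_product_then_coordinatewise[OF continuous_on_process])
  \<comment> \<open>The difference of the unit vectors has a positive inner product with \<open>x i\<close> and a negative one with
    \<open>x j\<close>, because the two are not codirectional.\<close>
  moreover define v where "v = x i /\<^sub>R norm (x i) - x j /\<^sub>R norm (x j)"
  define g0 :: "('m, 'n) gaussian_index \<Rightarrow> real"
    where "g0 k = (case k of Entry_G a b \<Rightarrow> v $ b | _ \<Rightarrow> 0)" for k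
  have "g0 \<in> U"
  proof -
    have Y: "?Y g0 (k, Some a) = sqrt t * (x k \<bullet> v)" for k a
      by (simp add: process_simps g0_def inner_vec_def)
    have "x i \<bullet> v = - covariance_gap x i j / norm (x j)"
      using nz by (simp add: v_def covariance_gap_def inner_diff_right dot_square_norm power2_eq_square field_simps)
    hence 1: "x i \<bullet> v > 0" using covariance_gap nz by (simp add: divide_less_0_iff)
    have "x j \<bullet> v = covariance_gap x i j / norm (x i)"
      using nz by (simp add: v_def covariance_gap_def inner_diff_right dot_square_norm power2_eq_square field_simps inner_commute)
    hence 2: "x j \<bullet> v < 0" using covariance_gap nz by (simp add: divide_less_0_iff)
    have "(sqrt t * (x i \<bullet> v)) * (sqrt t * (x j \<bullet> v)) < 0"
      using t 1 2 by (intro mult_pos_neg mult_pos_pos) auto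
    thus ?thesis unfolding U_def by (simp add: Y mult_pos_neg)
  qed
  ultimately have pos: "emeasure gaussian_product U > 0" and [measurable]: "U \<in> sets borel"
    by (auto intro: gaussian_product_open_positive)
  have int: "integrable gaussian_product ?A"
    using t ij by (intro integrable_alignment_process) auto
  have "(\<integral>g. ?A g \<partial>gaussian_product) \<le> 0"
    by (rule integral_alignment_nonpos)
  moreover have "(\<integral>g. ?A g \<partial>gaussian_product) \<noteq> 0"
  proof
    assume "(\<integral>g. ?A g \<partial>gaussian_product) = 0"
    hence "(\<integral>g. - ?A g \<partial>gaussian_product) = 0" by simp
    hence "AE g in gaussian_product. - ?A g = 0"
      using int by (subst (asm) integral_nonneg_eq_0_iff_AE) (auto simp: alignment_le_0)
    hence "AE g in gaussian_product. g \<notin> U"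
      by eventually_elim (use neg in force)
    hence "emeasure gaussian_product U = 0"
      by (subst (asm) AE_iff_measurable[where N = U]) (auto simp: sets_gaussian_product)
    thus False using pos by simp
  qed
  ultimately show ?thesis by linarith
qed

lemma smoothed_psi_slope_0_sign:
  fixes x :: "nat \<Rightarrow> real^'n"
  assumes t: "t \<in> {0..1}"
  obtains T where "smoothed_psi_slope TYPE('m::finite) x 0 t = c * (c - 1) * T" "T \<ge> 0"
    "not_codirectional l x \<Longrightarrow> 0 < t \<Longrightarrow> T > 0"
proof
  let ?I = "\<lambda>i j. \<integral>g. alignment 0 (process x t g :: 'm process) i j \<partial>gaussian_product"
  let ?T = "\<Sum>i=1..l. \<Sum>j=1..l. covariance_gap x i j * ?I i j"
  show "smoothed_psi_slope TYPE('m) x 0 t = c * (c - 1) * (\<beta>\<^sup>2 / 2 * ?T)"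
    by (simp add: smoothed_psi_slope_def)
  have nonneg: "0 \<le> covariance_gap x i j * ?I i j" for i j
    by (intro mult_nonpos_nonpos covariance_gap_le_0 integral_alignment_nonpos)
  have "0 \<le> ?T" by (intro sum_nonneg nonneg)
  thus "0 \<le> \<beta>\<^sup>2 / 2 * ?T" by simp
  assume "not_codirectional l x" "0 < t"
  then obtain i j where ij: "i \<in> {1..l}" "j \<in> {1..l}" "covariance_gap x i j < 0"
    unfolding not_codirectional_def covariance_gap_def by auto
  have "0 < covariance_gap x i j * ?I i j"
    using ij t \<open>0 < t\<close> by (intro mult_neg_neg integral_alignment_neg) auto
  also have "\<dots> \<le> (\<Sum>j=1..l. covariance_gap x i j * ?I i j)"
    using ij nonneg by (intro member_le_sum) auto
  also have "\<dots> \<le> ?T"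
    using ij nonneg by (intro member_le_sum[of i "{1..l}" "\<lambda>i. \<Sum>j=1..l. covariance_gap x i j * ?I i j"] sum_nonneg) auto
  finally show "0 < \<beta>\<^sup>2 / 2 * ?T" using \<beta> by simp
qed

end

section \<open>The limit of infinite \<open>\<beta>\<close>\<close>

text \<open>
  Write \<open>Y\<close> for the largest exponent.  Up to constant factors the integrand is \<open>exp (\<beta> c Y)\<close>.  If
  \<open>c Y > 0\<close> has positive probability, then the expectation grows at least linearly in \<open>\<beta>\<close> and the limit is
  infinite.  Otherwise the integrand is bounded and converges almost surely, with limit 0 where
  \<open>c Y < 0\<close> and limit \<open>N powr c\<close> where \<open>Y = 0\<close> is attained \<open>N\<close> times, so the limit is finite.
\<close>

lemma partition_function_powr_limit:
  fixes y :: "nat \<Rightarrow> 'w \<Rightarrow> real"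
  assumes N: "prob_space N" and l: "l \<ge> 1" and c: "c \<noteq> 0"
    and meas: "\<And>i. i \<in> {1..l} \<Longrightarrow> y i \<in> borel_measurable N"
    and int: "\<And>\<beta>. \<beta> > 0 \<Longrightarrow> integrable N (\<lambda>\<omega>. (\<Sum>i=1..l. exp (\<beta> * y i \<omega>)) powr c)"
  obtains L :: ereal
  where "((\<lambda>\<beta>. ereal (\<integral>\<omega>. (\<Sum>i=1..l. exp (\<beta> * y i \<omega>)) powr c \<partial>N)) \<longlongrightarrow> L) at_top"
proof -
  interpret prob_space N by fact
  define Z where "Z \<beta> \<omega> = (\<Sum>i=1..l. exp (\<beta> * y i \<omega>))" for \<beta> \<omega>
  define Y where "Y \<omega> = Max ((\<lambda>i. y i \<omega>) ` {1..l})" for \<omega>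
  have fin: "finite ((\<lambda>i. y i \<omega>) ` {1..l})" "(\<lambda>i. y i \<omega>) ` {1..l} \<noteq> {}" for \<omega>
    using l by auto
  have Y_ge: "y i \<omega> \<le> Y \<omega>" if "i \<in> {1..l}" for i \<omega>
    unfolding Y_def using fin that by (intro Max_ge) auto
  have Y_eq: "\<exists>i\<in>{1..l}. y i \<omega> = Y \<omega>" for \<omega>
  proof -
    have "Y \<omega> \<in> (\<lambda>i. y i \<omega>) ` {1..l}" unfolding Y_def by (rule Max_in[OF fin])
    thus ?thesis by (elim imageE) (metis)
  qed
  note [measurable] = meas
  have [measurable]: "Y \<in> borel_measurable N"
    unfolding Y_def by (intro borel_measurable_Max meas) auto
  have Zpos: "Z \<beta> \<omega> > 0" for \<beta> \<omega>
    unfolding Z_def using l by (intro sum_pos) auto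
  have Z_lower: "exp (\<beta> * Y \<omega>) \<le> Z \<beta> \<omega>" for \<beta> \<omega>
  proof -
    obtain i where i: "i \<in> {1..l}" "y i \<omega> = Y \<omega>" using Y_eq by blast
    have "exp (\<beta> * y i \<omega>) \<le> Z \<beta> \<omega>"
      unfolding Z_def using i(1) by (intro member_le_sum[of i "{1..l}" "\<lambda>i. exp (\<beta> * y i \<omega>)"]) auto
    thus ?thesis using i by simp
  qed
  have Z_upper: "Z \<beta> \<omega> \<le> l * exp (\<beta> * Y \<omega>)" if "\<beta> \<ge> 0" for \<beta> \<omega>
  proof -
    have "Z \<beta> \<omega> \<le> (\<Sum>i=1..l. exp (\<beta> * Y \<omega>))"
      unfolding Z_def using that Y_ge by (intro sum_mono) (simp add: mult_left_mono)
    thus ?thesis by simp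
  qed
  define k where "k = min 1 (real l powr c)"
  define K where "K = max 1 (real l powr c)"
  have k: "k > 0" using l by (simp add: k_def)
  have bounds: "k * exp (\<beta> * (c * Y \<omega>)) \<le> Z \<beta> \<omega> powr c" "Z \<beta> \<omega> powr c \<le> K * exp (\<beta> * (c * Y \<omega>))"
    if \<beta>: "\<beta> \<ge> 0" for \<beta> \<omega>
  proof -
    have e: "exp (\<beta> * Y \<omega>) powr c = exp (\<beta> * (c * Y \<omega>))" "(l * exp (\<beta> * Y \<omega>)) powr c = l powr c * exp (\<beta> * (c * Y \<omega>))"
      by (simp_all add: powr_mult exp_powr_real mult_ac)
    have "min (exp (\<beta> * Y \<omega>) powr c) ((l * exp (\<beta> * Y \<omega>)) powr c) \<le> Z \<beta> \<omega> powr c \<and>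
        Z \<beta> \<omega> powr c \<le> max (exp (\<beta> * Y \<omega>) powr c) ((l * exp (\<beta> * Y \<omega>)) powr c)"
    proof (cases "c \<ge> 0")
      case True
      thus ?thesis
        using powr_mono2[OF True _ Z_lower, of \<beta> \<omega>] powr_mono2[OF True less_imp_le[OF Zpos] Z_upper[OF \<beta>], of \<omega>]
        by auto
    next
      case False
      hence "c \<le> 0" by simp
      thus ?thesis
        using powr_mono2'[OF \<open>c \<le> 0\<close> _ Z_lower, of \<beta> \<omega>] powr_mono2'[OF \<open>c \<le> 0\<close> Zpos Z_upper[OF \<beta>], of \<omega>]
        by auto
    qed
    hence b: "min (exp (\<beta> * (c * Y \<omega>))) (l powr c * exp (\<beta> * (c * Y \<omega>))) \<le> Z \<beta> \<omega> powr c"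
        "Z \<beta> \<omega> powr c \<le> max (exp (\<beta> * (c * Y \<omega>))) (l powr c * exp (\<beta> * (c * Y \<omega>)))"
      unfolding e by auto
    have "k * exp (\<beta> * (c * Y \<omega>)) \<le> min (1 * exp (\<beta> * (c * Y \<omega>))) (l powr c * exp (\<beta> * (c * Y \<omega>)))"
      by (intro min.boundedI mult_right_mono; simp add: k_def)
    from order_trans[OF this[unfolded mult_1] b(1)] show "k * exp (\<beta> * (c * Y \<omega>)) \<le> Z \<beta> \<omega> powr c" .
    have "max (1 * exp (\<beta> * (c * Y \<omega>))) (l powr c * exp (\<beta> * (c * Y \<omega>))) \<le> K * exp (\<beta> * (c * Y \<omega>))"
      by (intro max.boundedI mult_right_mono; simp add: K_def)
    from order_trans[OF b(2) this[unfolded mult_1]] show "Z \<beta> \<omega> powr c \<le> K * exp (\<beta> * (c * Y \<omega>))" .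
  qed
  have intZ: "integrable N (\<lambda>\<omega>. Z \<beta> \<omega> powr c)" if "\<beta> > 0" for \<beta>
    using int[OF that] by (simp add: Z_def)
  show thesis
  proof (cases "AE \<omega> in N. c * Y \<omega> \<le> 0")
    case False
    \<comment> \<open>Since \<open>exp z\<close> is at least \<open>z\<close>, the positive part of \<open>c Y\<close> gives a lower bound linear in \<open>\<beta>\<close>.\<close>
    define P where "P \<omega> = max 0 (c * Y \<omega>)" for \<omega>
    have P_le: "k * (\<beta> * P \<omega>) \<le> Z \<beta> \<omega> powr c" if "\<beta> > 0" for \<beta> \<omega>
    proof -
      have "\<beta> * P \<omega> \<le> exp (\<beta> * (c * Y \<omega>))"
      proof (cases "c * Y \<omega> \<le> 0")
        case False
        hence "\<beta> * P \<omega> = \<beta> * (c * Y \<omega>)" by (simp add: P_def)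
        also have "\<dots> \<le> exp (\<beta> * (c * Y \<omega>))"
          using exp_ge_add_one_self[of "\<beta> * (c * Y \<omega>)"] by linarith
        finally show ?thesis .
      qed (simp add: P_def)
      hence "k * (\<beta> * P \<omega>) \<le> k * exp (\<beta> * (c * Y \<omega>))" using k by simp
      also have "\<dots> \<le> Z \<beta> \<omega> powr c" using that by (intro bounds) auto
      finally show ?thesis .
    qed
    have intP: "integrable N P"
    proof (rule Bochner_Integration.integrable_bound)
      show "integrable N (\<lambda>\<omega>. Z 1 \<omega> powr c / k)" using intZ[of 1] by simp
      show "P \<in> borel_measurable N" unfolding P_def by measurable
      show "AE \<omega> in N. norm (P \<omega>) \<le> norm (Z 1 \<omega> powr c / k)"
      proof (rule AE_I2)
        fix \<omega>
        have "P \<omega> \<ge> 0" by (simp add: P_def)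
        thus "norm (P \<omega>) \<le> norm (Z 1 \<omega> powr c / k)"
          using P_le[of 1 \<omega>] k by (simp add: field_simps)
      qed
    qed
    have "(\<integral>\<omega>. P \<omega> \<partial>N) \<noteq> 0"
    proof
      assume "(\<integral>\<omega>. P \<omega> \<partial>N) = 0"
      hence "AE \<omega> in N. P \<omega> = 0"
        using intP by (subst (asm) integral_nonneg_eq_0_iff_AE) (auto simp: P_def)
      hence "AE \<omega> in N. c * Y \<omega> \<le> 0" by eventually_elim (metis P_def max.cobounded2)
      with False show False by contradiction
    qed
    moreover have "(\<integral>\<omega>. P \<omega> \<partial>N) \<ge> 0" by (intro Bochner_Integration.integral_nonneg) (simp add: P_def)
    ultimately have pos: "k * (\<integral>\<omega>. P \<omega> \<partial>N) > 0" using k by simp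
    have "filterlim (\<lambda>\<beta>. \<integral>\<omega>. Z \<beta> \<omega> powr c \<partial>N) at_top at_top"
    proof (rule filterlim_at_top_mono)
      show "filterlim (\<lambda>\<beta>. (k * (\<integral>\<omega>. P \<omega> \<partial>N)) * \<beta>) at_top at_top"
        by (rule filterlim_tendsto_pos_mult_at_top[OF tendsto_const pos filterlim_ident])
      show "eventually (\<lambda>\<beta>. (k * (\<integral>\<omega>. P \<omega> \<partial>N)) * \<beta> \<le> (\<integral>\<omega>. Z \<beta> \<omega> powr c \<partial>N)) at_top"
        using eventually_gt_at_top[of 0]
      proof eventually_elim
        case (elim \<beta>)
        have "(\<integral>\<omega>. k * (\<beta> * P \<omega>) \<partial>N) \<le> (\<integral>\<omega>. Z \<beta> \<omega> powr c \<partial>N)"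
          using elim by (intro integral_mono integrable_mult_right intP intZ P_le)
        thus ?case by (simp add: mult_ac)
      qed
    qed
    hence "((\<lambda>\<beta>. ereal (\<integral>\<omega>. Z \<beta> \<omega> powr c \<partial>N)) \<longlongrightarrow> \<infinity>) at_top"
      by (simp add: tendsto_PInfty_eq_at_top)
    thus thesis unfolding Z_def by (rule that)
  next
    case True
    define f where "f \<omega> = (\<Sum>i=1..l. if y i \<omega> = 0 then 1 else 0) powr c * (if Y \<omega> = 0 then 1 else 0 :: real)" for \<omega>
    have "((\<lambda>\<beta>. \<integral>\<omega>. Z \<beta> \<omega> powr c \<partial>N) \<longlongrightarrow> (\<integral>\<omega>. f \<omega> \<partial>N)) at_top"
    proof (rule integral_dominated_convergence_at_top)
      show "integrable N (\<lambda>_. K)" by simp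
      show "f \<in> borel_measurable N" unfolding f_def by measurable
      show "(\<lambda>\<omega>. Z \<beta> \<omega> powr c) \<in> borel_measurable N" for \<beta> unfolding Z_def by measurable
      show "\<forall>\<^sub>F \<beta> in at_top. AE \<omega> in N. norm (Z \<beta> \<omega> powr c) \<le> K"
        using eventually_ge_at_top[of 0]
      proof eventually_elim
        case (elim \<beta>)
        from True show ?case
        proof eventually_elim
          case (elim \<omega>)
          have "exp (\<beta> * (c * Y \<omega>)) \<le> 1" using \<open>0 \<le> \<beta>\<close> elim by (simp add: mult_nonneg_nonpos)
          hence "K * exp (\<beta> * (c * Y \<omega>)) \<le> K * 1" by (intro mult_left_mono) (auto simp: K_def)
          thus ?case using bounds(2)[OF \<open>0 \<le> \<beta>\<close>, of \<omega>] by simp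
        qed
      qed
      from True show "AE \<omega> in N. ((\<lambda>\<beta>. Z \<beta> \<omega> powr c) \<longlongrightarrow> f \<omega>) at_top"
      proof eventually_elim
        case (elim \<omega>)
        show ?case
        proof (cases "Y \<omega> = 0")
          case Y0: True
          have "((\<lambda>\<beta>. Z \<beta> \<omega>) \<longlongrightarrow> (\<Sum>i=1..l. if y i \<omega> = 0 then 1 else 0)) at_top"
            unfolding Z_def
          proof (rule tendsto_sum)
            fix i assume "i \<in> {1..l}"
            hence "y i \<omega> \<le> 0" using Y_ge Y0 by metis
            show "((\<lambda>\<beta>. exp (\<beta> * y i \<omega>)) \<longlongrightarrow> (if y i \<omega> = 0 then 1 else 0)) at_top"
            proof (cases "y i \<omega> = 0")
              case False
              with \<open>y i \<omega> \<le> 0\<close> have "y i \<omega> < 0" by simp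
              hence "filterlim (\<lambda>\<beta>. \<beta> * y i \<omega>) at_bot at_top"
                by (rule filterlim_tendsto_neg_mult_at_bot[OF tendsto_const _ filterlim_ident, of "y i \<omega>", simplified mult.commute])
              with False show ?thesis
                using filterlim_compose[OF exp_at_bot] by simp
            qed simp
          qed
          moreover have "(\<Sum>i=1..l. if y i \<omega> = 0 then 1 else 0::real) \<noteq> 0"
          proof -
            obtain i where "i \<in> {1..l}" "y i \<omega> = 0" using Y_eq[of \<omega>] Y0 by auto
            thus ?thesis by (subst sum_nonneg_eq_0_iff) auto
          qed
          ultimately show ?thesis
            using Y0 unfolding f_def by (auto intro!: tendsto_powr tendsto_const)
        next
          case Yn0: False
          with elim c have neg: "c * Y \<omega> < 0" by (simp add: less_le)
          have "filterlim (\<lambda>\<beta>. \<beta> * (c * Y \<omega>)) at_bot at_top"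
            by (rule filterlim_tendsto_neg_mult_at_bot[OF tendsto_const neg filterlim_ident, simplified mult.commute])
          hence "((\<lambda>\<beta>. K * exp (\<beta> * (c * Y \<omega>))) \<longlongrightarrow> 0) at_top"
            by (intro tendsto_mult_right_zero filterlim_compose[OF exp_at_bot])
          moreover have "\<forall>\<^sub>F \<beta> in at_top. norm (Z \<beta> \<omega> powr c) \<le> K * exp (\<beta> * (c * Y \<omega>))"
            using eventually_ge_at_top[of 0] by eventually_elim (simp add: bounds)
          ultimately have "((\<lambda>\<beta>. Z \<beta> \<omega> powr c) \<longlongrightarrow> 0) at_top"
            by (rule Lim_null_comparison[rotated])
          thus ?thesis using Yn0 by (simp add: f_def)
        qed
      qed
    qed
    hence "((\<lambda>\<beta>. ereal (\<integral>\<omega>. Z \<beta> \<omega> powr c \<partial>N)) \<longlongrightarrow> ereal (\<integral>\<omega>. f \<omega> \<partial>N)) at_top"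
      by (rule tendsto_ereal)
    thus thesis unfolding Z_def by (rule that)
  qed
qed

section \<open>Transfer to the given probability space\<close>

text \<open>
  Independence of all entries says that their joint law is the product measure.
\<close>

lemma distr_gaussian_entries:
  assumes "independent_std_normals M G u2 h u4"
  shows "distr M borel (\<lambda>\<omega> k. gaussian_entry G u2 h u4 k \<omega>)
      = (gaussian_product :: (('m::finite, 'n::finite) gaussian_index \<Rightarrow> real) measure)"
    and "(\<lambda>\<omega> k. gaussian_entry G u2 h u4 k \<omega> :: real) \<in> M \<rightarrow>\<^sub>M borel"
proof -
  let ?X = "gaussian_entry G u2 h u4"
  interpret prob_space M using assms by (simp add: independent_std_normals_def)
  have indep: "indep_vars (\<lambda>_. borel) ?X UNIV"
    and distr: "\<And>k. distributed M lborel (?X k) std_normal_density"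
    using assms by (auto simp: independent_std_normals_def)
  have rv: "random_variable borel (?X k)" for k
    using distributed_measurable[OF distr[of k]] by simp
  have dist_k: "distr M borel (?X k) = std_gaussian" for k
  proof -
    have "distr M borel (?X k) = distr M lborel (?X k)" by (rule distr_cong) auto
    thus ?thesis using distributed_distr_eq_density[OF distr[of k]] by simp
  qed
  have "distr M (PiM UNIV (\<lambda>_. borel)) (\<lambda>\<omega>. \<lambda>k\<in>UNIV. ?X k \<omega>) = PiM UNIV (\<lambda>k. distr M borel (?X k))"
    using indep_vars_iff_distr_eq_PiM[where I = UNIV and M' = "\<lambda>_. borel" and X = ?X] rv indep by simp
  moreover have "distr M (PiM UNIV (\<lambda>_. borel)) (\<lambda>\<omega>. \<lambda>k\<in>UNIV. ?X k \<omega>) = distr M borel (\<lambda>\<omega> k. ?X k \<omega>)"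
    by (rule distr_cong) (auto simp: sets_PiM_equal_borel)
  ultimately show "distr M borel (\<lambda>\<omega> k. ?X k \<omega>) = gaussian_product"
    by (simp add: dist_k gaussian_product_def)
  have "(\<lambda>\<omega> k. ?X k \<omega>) \<in> M \<rightarrow>\<^sub>M PiM UNIV (\<lambda>_. borel)"
  proof -
    have "(\<lambda>\<omega>. \<lambda>k\<in>UNIV. ?X k \<omega>) \<in> M \<rightarrow>\<^sub>M PiM UNIV (\<lambda>_. borel)"
      by (intro measurable_restrict rv)
    thus ?thesis by (simp add: restrict_def)
  qed
  thus "(\<lambda>\<omega> k. ?X k \<omega>) \<in> M \<rightarrow>\<^sub>M borel"
    using measurable_cong_sets[OF refl sets_PiM_equal_borel] by blast
qed

lemma psi_eq_smoothed_psi: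
  fixes M :: "'w measure" and G :: "'w \<Rightarrow> real^'n^'m" and x :: "nat \<Rightarrow> real^'n"
  assumes "independent_std_normals M G u2 h u4" and "power_of_partition_function l \<beta> s"
  shows "psi M G u2 h u4 l x \<beta> s c t = power_of_partition_function.smoothed_psi l \<beta> s c TYPE('m) x 0 t"
proof -
  interpret power_of_partition_function l \<beta> s c by fact
  let ?X = "\<lambda>\<omega> k. gaussian_entry G u2 h u4 k \<omega>"
  have "(\<Sum>i = 1..l. exp (\<beta> *
          (s * norm (sqrt t *\<^sub>R (G \<omega> *v x i) + (sqrt (1 - t) * norm (x i)) *\<^sub>R u2 \<omega>)
           + sqrt t * norm (x i) * u4 \<omega>
           + sqrt (1 - t) * (h \<omega> \<bullet> x i)))) powr c = F 0 (process x t (?X \<omega>) :: 'm process)" for \<omega>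
  proof -
    have "norm (sqrt t *\<^sub>R (G \<omega> *v x i) + (sqrt (1 - t) * norm (x i)) *\<^sub>R u2 \<omega>) = smoothed_norm 0 (process x t (?X \<omega>) :: 'm process) i" for i
      by (simp add: smoothed_norm_def norm_vec_def L2_set_def process_simps matrix_vector_mult_def mult_ac)
    thus ?thesis
      by (simp add: F_def partition_function_def weight_def process_simps inner_vec_def mult_ac add_ac)
  qed
  hence "psi M G u2 h u4 l x \<beta> s c t = (\<integral>\<omega>. F 0 (process x t (?X \<omega>) :: 'm process) \<partial>M)"
    by (simp add: psi_def)
  also have "\<dots> = (\<integral>g. F 0 (process x t g :: 'm process) \<partial>distr M borel ?X)"
  proof (rule integral_distr[symmetric])
    show "?X \<in> M \<rightarrow>\<^sub>M borel" by (rule distr_gaussian_entries[OF assms(1)])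
    show "(\<lambda>g. F 0 (process x t g :: 'm process)) \<in> borel_measurable borel"
      using borel_measurable_F_process[of 0 x t] measurable_cong_sets[OF sets_gaussian_product refl] by blast
  qed
  finally show ?thesis by (simp add: distr_gaussian_entries[OF assms(1)] smoothed_psi_def)
qed

lemma psi_limit:
  fixes M :: "'w measure" and G :: "'w \<Rightarrow> real^'n^'m" and x :: "nat \<Rightarrow> real^'n"
  assumes "independent_std_normals M G u2 h u4" "l \<ge> 1" "s \<in> {-1, 1}" "c \<noteq> 0" "t \<in> {0..1}"
  shows "\<exists>L. ((\<lambda>\<beta>. ereal (psi M G u2 h u4 l x \<beta> s c t)) \<longlongrightarrow> L) at_top"
proof -
  define y where "y i g = s * sqrt (\<Sum>a\<in>UNIV. (process x t g (i, Some a) :: real)\<^sup>2) + process x t g (i, None :: 'm option)" for i and g :: "('m, 'n) gaussian_index \<Rightarrow> real"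
  have loc: "power_of_partition_function l \<beta> s" if "\<beta> > 0" for \<beta>
    using assms that by unfold_locales auto
  have F: "power_of_partition_function.F l \<beta> s c 0 (process x t g :: 'm process) = (\<Sum>i=1..l. exp (\<beta> * y i g)) powr c"
    if "\<beta> > 0" for \<beta> g
  proof -
    interpret power_of_partition_function l \<beta> s c using loc[OF that] .
    show ?thesis by (simp add: F_def partition_function_def weight_def smoothed_norm_def y_def)
  qed
  have int: "integrable gaussian_product (\<lambda>g. (\<Sum>i=1..l. exp (\<beta> * y i g)) powr c)" if "\<beta> > 0" for \<beta>
  proof -
    interpret power_of_partition_function l \<beta> s c using loc[OF that] .
    have "integrable gaussian_product (\<lambda>g. F 0 (process x t g :: 'm process))"
      unfolding process_def using assms(5)
      by (intro integrable_interpolant[OF _ _ F_exp_bounded] growth_factor_nonneg growth_rate_nonneg continuous_on_F) auto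
    thus ?thesis by (simp add: F[OF that])
  qed
  have meas: "y i \<in> borel_measurable gaussian_product" for i
  proof -
    have "y i \<in> borel_measurable borel"
      unfolding y_def
      by (intro borel_measurable_continuous_onI continuous_intros continuous_on_product_then_coordinatewise[OF continuous_on_process])
    thus ?thesis by measurable
  qed
  obtain L where L: "((\<lambda>\<beta>. ereal (\<integral>g. (\<Sum>i=1..l. exp (\<beta> * y i g)) powr c \<partial>gaussian_product)) \<longlongrightarrow> L) at_top"
    using partition_function_powr_limit[OF gaussian_product.prob_space_axioms assms(2,4) meas int] by blast
  have "psi M G u2 h u4 l x \<beta> s c t = (\<integral>g. (\<Sum>i=1..l. exp (\<beta> * y i g)) powr c \<partial>gaussian_product)" if "\<beta> > 0" for \<beta>
  proof -
    interpret power_of_partition_function l \<beta> s c using loc[OF that] .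
    show ?thesis using psi_eq_smoothed_psi[OF assms(1) loc[OF that], of x c t] by (simp add: smoothed_psi_def F[OF that])
  qed
  hence "\<forall>\<^sub>F \<beta> in at_top. ereal (psi M G u2 h u4 l x \<beta> s c t) = ereal (\<integral>g. (\<Sum>i=1..l. exp (\<beta> * y i g)) powr c \<partial>gaussian_product)"
    by (intro eventually_mono[OF eventually_gt_at_top[of 0]]) simp
  from tendsto_cong[OF this] L have "((\<lambda>\<beta>. ereal (psi M G u2 h u4 l x \<beta> s c t)) \<longlongrightarrow> L) at_top"
    by blast
  thus ?thesis ..
qed

section \<open>Monotonicity and comparison\<close>

text \<open>
  Strict monotonicity allows the derivative to vanish at 0, as it does for \<open>psi\<close>.
\<close>

lemma increasing_on_unit_interval:
  fixes f D :: "real \<Rightarrow> real"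
  assumes D: "\<And>t. t \<in> {0..1} \<Longrightarrow> (f has_real_derivative D t) (at t within {0..1})"
  shows "(\<And>t. t \<in> {0..1} \<Longrightarrow> D t \<ge> 0) \<Longrightarrow> mono_on {0..1} f"
    and "(\<And>t. t \<in> {0<..1} \<Longrightarrow> D t > 0) \<Longrightarrow> strict_mono_on {0..1} f"
proof -
  have cont: "continuous_on {a..b} f" if "0 \<le> a" "b \<le> 1" for a b
  proof -
    have "continuous_on {0..1} f"
      using D by (meson DERIV_continuous continuous_on_eq_continuous_within)
    thus ?thesis using that by (auto intro: continuous_on_subset)
  qed
  have D': "(f has_real_derivative D t) (at t)" if "0 < t" "t < 1" for t
    using D[of t] that by (simp add: at_within_Icc_at)
  show "mono_on {0..1} f" if nonneg: "\<And>t. t \<in> {0..1} \<Longrightarrow> D t \<ge> 0"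
  proof (rule mono_onI)
    fix a b :: real assume ab: "a \<in> {0..1}" "b \<in> {0..1}" "a \<le> b"
    show "f a \<le> f b"
    proof (rule DERIV_nonneg_imp_increasing_open[OF ab(3) _ cont])
      fix t assume "a < t" "t < b"
      thus "\<exists>y. (f has_real_derivative y) (at t) \<and> 0 \<le> y"
        using ab D'[of t] nonneg[of t] by (intro exI[of _ "D t"]) auto
    qed (use ab in auto)
  qed
  show "strict_mono_on {0..1} f" if pos: "\<And>t. t \<in> {0<..1} \<Longrightarrow> D t > 0"
  proof (rule strict_mono_onI)
    fix a b :: real assume ab: "a \<in> {0..1}" "b \<in> {0..1}" "a < b"
    show "f a < f b"
    proof (rule DERIV_pos_imp_increasing_open[OF ab(3) _ cont])
      fix t assume "a < t" "t < b"
      thus "\<exists>y. (f has_real_derivative y) (at t) \<and> 0 < y"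
        using ab D'[of t] pos[of t] by (intro exI[of _ "D t"]) auto
    qed (use ab in auto)
  qed
qed

lemma psi_has_derivative:
  fixes M :: "'w measure" and G :: "'w \<Rightarrow> real^'n^'m" and x :: "nat \<Rightarrow> real^'n"
  assumes "independent_std_normals M G u2 h u4" "l \<ge> 1" "s \<in> {-1, 1}" "\<beta> > 0"
  obtains T where
    "\<And>t. t \<in> {0..1} \<Longrightarrow> (psi M G u2 h u4 l x \<beta> s c has_real_derivative c * (c - 1) * T t) (at t within {0..1})"
    "\<And>t. t \<in> {0..1} \<Longrightarrow> T t \<ge> 0"
    "\<And>t. not_codirectional l x \<Longrightarrow> t \<in> {0<..1} \<Longrightarrow> T t > 0"
proof -
  have loc: "power_of_partition_function l \<beta> s"
    using assms by unfold_locales auto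
  interpret power_of_partition_function l \<beta> s c by (rule loc)
  have "\<exists>T. smoothed_psi_slope TYPE('m) x 0 t = c * (c - 1) * T \<and> T \<ge> 0 \<and> (not_codirectional l x \<longrightarrow> 0 < t \<longrightarrow> T > 0)"
    if "t \<in> {0..1}" for t
    using smoothed_psi_slope_0_sign[where ?'m = 'm, OF that, of x] by metis
  then obtain T where T: "\<And>t. t \<in> {0..1} \<Longrightarrow> smoothed_psi_slope TYPE('m) x 0 t = c * (c - 1) * T t"
      "\<And>t. t \<in> {0..1} \<Longrightarrow> T t \<ge> 0" "\<And>t. not_codirectional l x \<Longrightarrow> t \<in> {0..1} \<Longrightarrow> 0 < t \<Longrightarrow> T t > 0"
    by metis
  have "psi M G u2 h u4 l x \<beta> s c = smoothed_psi TYPE('m) x 0"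
    by (intro ext psi_eq_smoothed_psi assms(1) loc)
  hence "(psi M G u2 h u4 l x \<beta> s c has_real_derivative c * (c - 1) * T t) (at t within {0..1})" if "t \<in> {0..1}" for t
    using smoothed_psi_0_has_derivative[where ?'m = 'm, OF that, of x] T(1)[OF that] by simp
  with T show thesis by (intro that[of T]) auto
qed

text \<open>
  An inequality between two values of \<open>t\<close> that holds at every finite \<open>\<beta>\<close> passes to the limit; this
  turns the monotonicity of \<open>psi\<close> into the comparison principle.
\<close>

lemma psi_limit_comparison:
  fixes M :: "'w measure" and G :: "'w \<Rightarrow> real^'n^'m" and x :: "nat \<Rightarrow> real^'n"
  assumes "independent_std_normals M G u2 h u4" "l \<ge> 1" "s \<in> {-1, 1}" "c \<noteq> 0"
  obtains L :: "real \<Rightarrow> ereal" where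
    "\<And>t. t \<in> {0..1} \<Longrightarrow> ((\<lambda>\<beta>. ereal (psi M G u2 h u4 l x \<beta> s c t)) \<longlongrightarrow> L t) at_top"
    "\<And>t u. t \<in> {0..1} \<Longrightarrow> u \<in> {0..1} \<Longrightarrow>
      (\<And>\<beta>. \<beta> > 0 \<Longrightarrow> psi M G u2 h u4 l x \<beta> s c t \<le> psi M G u2 h u4 l x \<beta> s c u) \<Longrightarrow> L t \<le> L u"
proof -
  obtain L where L: "\<And>t. t \<in> {0..1} \<Longrightarrow> ((\<lambda>\<beta>. ereal (psi M G u2 h u4 l x \<beta> s c t)) \<longlongrightarrow> L t) at_top"
    using psi_limit[OF assms, of _ x] by metis
  show thesis
  proof (rule that[OF L])
    fix t u :: real assume "t \<in> {0..1}" "u \<in> {0..1}"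
      and le: "\<And>\<beta>. \<beta> > 0 \<Longrightarrow> psi M G u2 h u4 l x \<beta> s c t \<le> psi M G u2 h u4 l x \<beta> s c u"
    thus "L t \<le> L u"
      by (intro tendsto_le[OF _ L L] eventually_mono[OF eventually_gt_at_top[of 0]]) auto
  qed
qed

theorem corollary3:
  fixes M :: "'w measure"
    and G :: "'w \<Rightarrow> real^'n^'m"
    and u2 :: "'w \<Rightarrow> real^'m"
    and h :: "'w \<Rightarrow> real^'n"
    and u4 :: "'w \<Rightarrow> real"
    and l :: nat
    and x :: "nat \<Rightarrow> real^'n"
    and c3 s :: real
  assumes "l \<ge> 1"
    and "s \<in> {-1, 1}"
    and "independent_std_normals M G u2 h u4"
  shows
    "(0 < c3 \<and> c3 < 1 \<longrightarrow>
        (\<forall>\<beta>>0.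
           (\<forall>t\<in>{0..1}. \<exists>D.
              (psi M G u2 h u4 l x \<beta> s c3 has_real_derivative D) (at t within {0..1}) \<and>
              D \<le> 0 \<and> (not_codirectional l x \<and> 0 < t \<longrightarrow> D < 0)) \<and>
           antimono_on {0..1} (psi M G u2 h u4 l x \<beta> s c3) \<and>
           (not_codirectional l x \<longrightarrow>
              strict_antimono_on {0..1} (psi M G u2 h u4 l x \<beta> s c3))) \<and>
        (\<exists>L :: real \<Rightarrow> ereal.
           (\<forall>t\<in>{0..1}. ((\<lambda>\<beta>. ereal (psi M G u2 h u4 l x \<beta> s c3 t)) \<longlongrightarrow> L t) at_top) \<and>
           (\<forall>t\<in>{0..1}. L 0 \<ge> L t \<and> L t \<ge> L 1))) \<and>
     (c3 > 1 \<or> c3 < 0 \<longrightarrow>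
        (\<forall>\<beta>>0.
           (\<forall>t\<in>{0..1}. \<exists>D.
              (psi M G u2 h u4 l x \<beta> s c3 has_real_derivative D) (at t within {0..1}) \<and>
              D \<ge> 0 \<and> (not_codirectional l x \<and> 0 < t \<longrightarrow> D > 0)) \<and>
           mono_on {0..1} (psi M G u2 h u4 l x \<beta> s c3) \<and>
           (not_codirectional l x \<longrightarrow>
              strict_mono_on {0..1} (psi M G u2 h u4 l x \<beta> s c3))) \<and>
        (\<exists>L :: real \<Rightarrow> ereal.
           (\<forall>t\<in>{0..1}. ((\<lambda>\<beta>. ereal (psi M G u2 h u4 l x \<beta> s c3 t)) \<longlongrightarrow> L t) at_top) \<and>
           (\<forall>t\<in>{0..1}. L 0 \<le> L t \<and> L t \<le> L 1)))"
proof -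
  let ?psi = "\<lambda>\<beta>. psi M G u2 h u4 l x \<beta> s c3"
  have decreasing: "(\<forall>t\<in>{0..1}. \<exists>D.
              (?psi \<beta> has_real_derivative D) (at t within {0..1}) \<and>
              D \<le> 0 \<and> (not_codirectional l x \<and> 0 < t \<longrightarrow> D < 0)) \<and>
           antimono_on {0..1} (?psi \<beta>) \<and>
           (not_codirectional l x \<longrightarrow> strict_antimono_on {0..1} (?psi \<beta>))"
    if c3: "0 < c3 \<and> c3 < 1" and \<beta>: "\<beta> > 0" for \<beta>
  proof -
    obtain T where T: "\<And>t. t \<in> {0..1} \<Longrightarrow> (?psi \<beta> has_real_derivative c3 * (c3 - 1) * T t) (at t within {0..1})"
      "\<And>t. t \<in> {0..1} \<Longrightarrow> T t \<ge> 0" "\<And>t. not_codirectional l x \<Longrightarrow> t \<in> {0<..1} \<Longrightarrow> T t > 0"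
      using psi_has_derivative[OF assms(3,1,2) \<beta>] by blast
    have neg: "c3 * (c3 - 1) < 0" using c3 by (simp add: mult_pos_neg)
    have D: "((\<lambda>t. - ?psi \<beta> t) has_real_derivative - (c3 * (c3 - 1) * T t)) (at t within {0..1})" if "t \<in> {0..1}" for t
      by (rule DERIV_minus[OF T(1)[OF that]])
    have "mono_on {0..1} (\<lambda>t. - ?psi \<beta> t)"
      using T(2) neg by (intro increasing_on_unit_interval(1)[OF D]) (auto simp: mult_nonpos_nonneg)
    moreover have "strict_mono_on {0..1} (\<lambda>t. - ?psi \<beta> t)" if "not_codirectional l x"
      using T(3)[OF that] neg by (intro increasing_on_unit_interval(2)[OF D]) (auto simp: mult_neg_pos)
    moreover have "\<exists>D. (?psi \<beta> has_real_derivative D) (at t within {0..1}) \<and>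
        D \<le> 0 \<and> (not_codirectional l x \<and> 0 < t \<longrightarrow> D < 0)" if "t \<in> {0..1}" for t
      using T(1)[OF that] T(2)[OF that] T(3)[of t] that neg
      by (intro exI[of _ "c3 * (c3 - 1) * T t"]) (auto simp: mult_nonpos_nonneg mult_neg_pos)
    ultimately show ?thesis by (auto simp: monotone_on_def)
  qed
  have increasing: "(\<forall>t\<in>{0..1}. \<exists>D.
              (?psi \<beta> has_real_derivative D) (at t within {0..1}) \<and>
              D \<ge> 0 \<and> (not_codirectional l x \<and> 0 < t \<longrightarrow> D > 0)) \<and>
           mono_on {0..1} (?psi \<beta>) \<and>
           (not_codirectional l x \<longrightarrow> strict_mono_on {0..1} (?psi \<beta>))"
    if c3: "c3 > 1 \<or> c3 < 0" and \<beta>: "\<beta> > 0" for \<beta>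
  proof -
    obtain T where T: "\<And>t. t \<in> {0..1} \<Longrightarrow> (?psi \<beta> has_real_derivative c3 * (c3 - 1) * T t) (at t within {0..1})"
      "\<And>t. t \<in> {0..1} \<Longrightarrow> T t \<ge> 0" "\<And>t. not_codirectional l x \<Longrightarrow> t \<in> {0<..1} \<Longrightarrow> T t > 0"
      using psi_has_derivative[OF assms(3,1,2) \<beta>] by blast
    have pos: "c3 * (c3 - 1) > 0" using c3 by (auto simp: zero_less_mult_iff)
    have "mono_on {0..1} (?psi \<beta>)"
      using T(2) pos by (intro increasing_on_unit_interval(1)[OF T(1)]) auto
    moreover have "strict_mono_on {0..1} (?psi \<beta>)" if "not_codirectional l x"
      using T(3)[OF that] pos by (intro increasing_on_unit_interval(2)[OF T(1)]) auto
    moreover have "\<exists>D. (?psi \<beta> has_real_derivative D) (at t within {0..1}) \<and>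
        D \<ge> 0 \<and> (not_codirectional l x \<and> 0 < t \<longrightarrow> D > 0)" if "t \<in> {0..1}" for t
      using T(1)[OF that] T(2)[OF that] T(3)[of t] that pos
      by (intro exI[of _ "c3 * (c3 - 1) * T t"]) auto
    ultimately show ?thesis by blast
  qed
  have limit_decreasing: "\<exists>L :: real \<Rightarrow> ereal.
      (\<forall>t\<in>{0..1}. ((\<lambda>\<beta>. ereal (?psi \<beta> t)) \<longlongrightarrow> L t) at_top) \<and> (\<forall>t\<in>{0..1}. L 0 \<ge> L t \<and> L t \<ge> L 1)"
    if c3: "0 < c3 \<and> c3 < 1"
  proof -
    have c0: "c3 \<noteq> 0" using c3 by auto
    have "?psi \<beta> u \<le> ?psi \<beta> t" if "\<beta> > 0" "t \<in> {0..1}" "u \<in> {0..1}" "t \<le> u" for \<beta> t u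
      using decreasing[OF c3 that(1)] that by (auto simp: monotone_on_def)
    moreover obtain L where "\<And>t. t \<in> {0..1} \<Longrightarrow> ((\<lambda>\<beta>. ereal (?psi \<beta> t)) \<longlongrightarrow> L t) at_top"
      "\<And>t u. t \<in> {0..1} \<Longrightarrow> u \<in> {0..1} \<Longrightarrow> (\<And>\<beta>. \<beta> > 0 \<Longrightarrow> ?psi \<beta> t \<le> ?psi \<beta> u) \<Longrightarrow> L t \<le> L u"
      using psi_limit_comparison[OF assms(3,1,2) c0, of x] by blast
    ultimately show ?thesis by (intro exI[of _ L]) auto
  qed
  have limit_increasing: "\<exists>L :: real \<Rightarrow> ereal.
      (\<forall>t\<in>{0..1}. ((\<lambda>\<beta>. ereal (?psi \<beta> t)) \<longlongrightarrow> L t) at_top) \<and> (\<forall>t\<in>{0..1}. L 0 \<le> L t \<and> L t \<le> L 1)"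
    if c3: "c3 > 1 \<or> c3 < 0"
  proof -
    have c0: "c3 \<noteq> 0" using c3 by auto
    have "?psi \<beta> t \<le> ?psi \<beta> u" if "\<beta> > 0" "t \<in> {0..1}" "u \<in> {0..1}" "t \<le> u" for \<beta> t u
      using increasing[OF c3 that(1)] that by (auto simp: monotone_on_def)
    moreover obtain L where "\<And>t. t \<in> {0..1} \<Longrightarrow> ((\<lambda>\<beta>. ereal (?psi \<beta> t)) \<longlongrightarrow> L t) at_top"
      "\<And>t u. t \<in> {0..1} \<Longrightarrow> u \<in> {0..1} \<Longrightarrow> (\<And>\<beta>. \<beta> > 0 \<Longrightarrow> ?psi \<beta> t \<le> ?psi \<beta> u) \<Longrightarrow> L t \<le> L u"
      using psi_limit_comparison[OF assms(3,1,2) c0, of x] by blast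
    ultimately show ?thesis by (intro exI[of _ L]) auto
  qed
  show ?thesis
    using decreasing increasing limit_decreasing limit_increasing by blast
qed

end
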